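(* For every surface $S$, every integer $t\ge 0$ and every $\epsilon>0$, there exists a constant $c=c(S,t,\epsilon)$ such that every $n$-vertex triangulation on $S$ that has at most $t$ vertices of degree other than $6$ has a dominating set of size at most $n\left(\frac{1}{6}+\epsilon\right)+c$.
   Context: All graphs are finite and simple. A surface is a compact connected $2$-manifold without boundary (orientable $S_g$ or non-orientable $N_g$). A triangulation on a surface $S$ is a simple graph embedded on $S$ such that every face is bounded by a triangle. A dominating set of a graph $G$ is a set $D\subseteq V(G)$ such that every vertex of $G$ is in $D$ or adjacent to a vertex of $D$. *)

theory Defs
  imports "HOL-Analysis.Analysis"
begin

definition surface :: "'a topology \<Rightarrow> bool" where
  "surface S \<longleftrightarrow>
     topspace S \<noteq> {} \<and> Hausdorff_space S \<and> second_countable S \<and>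
     compact_space S \<and> connected_space S \<and>
     (\<forall>x\<in>topspace S. \<exists>U. openin S U \<and> x \<in> U \<and>
        subtopology S U homeomorphic_space (euclidean :: (real ^ 2) topology))"

definition simple_graph :: "'a set \<Rightarrow> 'a set set \<Rightarrow> bool" where
  "simple_graph V E \<longleftrightarrow> finite V \<and> (\<forall>e\<in>E. e \<subseteq> V \<and> card e = 2)"

definition vertex_degree :: "'a set set \<Rightarrow> 'a \<Rightarrow> nat" where
  "vertex_degree E v = card {e \<in> E. v \<in> e}"

definition dominating_set :: "'a set \<Rightarrow> 'a set set \<Rightarrow> 'a set \<Rightarrow> bool" where
  "dominating_set V E D \<longleftrightarrow> D \<subseteq> V \<and> (\<forall>v\<in>V. v \<in> D \<or> (\<exists>u\<in>D. {u, v} \<in> E))"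

text \<open>
  The vertices of an embedded graph are points of the surface, and \<open>\<alpha>\<close> assigns to each
  edge (a pair of points) the simple arc that represents it; the interior of this arc
  meets no vertex and no other edge.
\<close>

definition embedded_graph ::
  "'a topology \<Rightarrow> 'a set \<Rightarrow> 'a set set \<Rightarrow> ('a set \<Rightarrow> 'a set) \<Rightarrow> bool" where
  "embedded_graph S V E \<alpha> \<longleftrightarrow>
     simple_graph V E \<and> V \<subseteq> topspace S \<and>
     (\<forall>e\<in>E. \<exists>g. pathin S g \<and> inj_on g {0..1} \<and> {g 0, g 1} = e \<and> g ` {0..1} = \<alpha> e) \<and>
     (\<forall>e\<in>E. (\<alpha> e - e) \<inter> (V \<union> (\<Union>f\<in>E - {e}. \<alpha> f)) = {})"

definition faces ::
  "'a topology \<Rightarrow> 'a set \<Rightarrow> 'a set set \<Rightarrow> ('a set \<Rightarrow> 'a set) \<Rightarrow> 'a set set" where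
  "faces S V E \<alpha> =
     connected_components_of (subtopology S (topspace S - (V \<union> (\<Union>e\<in>E. \<alpha> e))))"

text \<open>
  A face is bounded by a triangle if it is an open disc whose facial walk is a 3-cycle of
  the graph, i.e. its closure is a closed disc with that 3-cycle as boundary circle. Requiring
  only that the frontier of the face be the point set of a 3-cycle would also admit faces
  that are not discs, and the face of a non-contractible triangle in the projective plane,
  whose facial walk has length 6.
\<close>

definition bounded_by_triangle ::
  "'a topology \<Rightarrow> 'a set set \<Rightarrow> ('a set \<Rightarrow> 'a set) \<Rightarrow> 'a set \<Rightarrow> bool" where
  "bounded_by_triangle S E \<alpha> F \<longleftrightarrow>
     (\<exists>a b c. {a, b} \<in> E \<and> {b, c} \<in> E \<and> {a, c} \<in> E \<and>
        (\<exists>h. homeomorphic_map (top_of_set (cball (0 :: real ^ 2) 1))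
               (subtopology S (S closure_of F)) h \<and>
             h ` ball 0 1 = F \<and>
             h ` sphere 0 1 = \<alpha> {a, b} \<union> \<alpha> {b, c} \<union> \<alpha> {a, c}))"

definition triangulation_on ::
  "'a topology \<Rightarrow> 'a set \<Rightarrow> 'a set set \<Rightarrow> ('a set \<Rightarrow> 'a set) \<Rightarrow> bool" where
  "triangulation_on S V E \<alpha> \<longleftrightarrow>
     embedded_graph S V E \<alpha> \<and> (\<forall>F\<in>faces S V E \<alpha>. bounded_by_triangle S E \<alpha> F)"

end

theory Submission
  imports Defs "HOL-Real_Asymp.Real_Asymp"
begin

text \<open>
  Vertices of degree 6 look locally like the triangular lattice. By ball growing, a flat region can be cut
  into bounded pieces at the cost of a small fraction of the vertices, so it suffices to find, for each
  piece, a family of dominating sets that uses every vertex with frequency at most 1/6. A piece is the image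
  of a lattice ball under a developing map, which is injective up to a group of lattice symmetries. If the
  group is generated by one translation \<open>w\<close>, the family is lifted from \<open>w\<close>-periodic dominating sets of the
  lattice of density at most 1/6, which exist for all \<open>w\<close> that can occur in a simple graph. Two independent
  short translations force the whole graph to be a small torus. Rotations do not occur, and the vertices near
  the axis of a short glide reflection are rare, because walking away from the axis one meets no second axis.

  Vertices of other degrees are dealt with by Euler's formula: it bounds their degrees, hence the number of
  vertices near them. The required lower bound on the Euler characteristic comes from counting cocycles
  modulo 2, whose classes are determined by transition data on a finite atlas of the surface.
\<close>

section \<open>Dominating sets of the triangular lattice\<close>

text \<open>The lattice has a perfect dominating code of density 1/7, but it need not be invariant
  under the translation by which the graph closes up; the gap between 1/7 and 1/6 pays for making it
  periodic. Whole families with a frequency bound at each single vertex are needed because the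
  pieces are cut out greedily and their shapes are not under control: averaging over the family
  yields, for every finite subset of a ball, one member that uses at most a sixth of that subset.
  Cutting is cheap since balls in flat regions grow quadratically, whereas a ball without a
  relatively thin sphere would have to grow exponentially. A developing map is only available on a
  finite ball, so arguments about its symmetries carry a radius that shrinks with each step; this is
  the origin of the chain of constants \<open>R\<close>, \<open>K\<close>, \<open>L\<close>,
  \<open>M\<close>, \<open>N\<close>. A surface is given by its topology alone, with no genus
  attached: the constant in the edge bound is the number of marked points in the overlaps of a
  finite atlas, which is chosen before the triangulation.\<close>

definition hexdirs :: "(int \<times> int) set" where
  "hexdirs = {(1,0), (0,1), (-1,1), (-1,0), (0,-1), (1,-1)}"

text \<open>This is the graph distance from 0 in the triangular lattice with steps
  \<open>hexdirs\<close>.\<close>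

definition hexnorm :: "int \<times> int \<Rightarrow> int" where
  "hexnorm p = max (max \<bar>fst p\<bar> \<bar>snd p\<bar>) \<bar>fst p + snd p\<bar>"

text \<open>A uniformly random \<open>i\<close> gives a random \<open>w\<close>-periodic dominating
  set that contains each point with probability at most 1/6. The index type consists of pairs
  because one construction shifts its pattern in two coordinates; a plain shift uses a dummy
  0.\<close>

definition sixth_family :: "int \<times> int \<Rightarrow> bool" where
  "sixth_family w \<longleftrightarrow> (\<exists>(I :: (int \<times> int) set) pat. finite I \<and> I \<noteq> {} \<and>
     (\<forall>i\<in>I. \<forall>p. \<exists>q \<in> pat i. q = p \<or> q - p \<in> hexdirs) \<and>
     (\<forall>i\<in>I. \<forall>p. p + w \<in> pat i \<longleftrightarrow> p \<in> pat i) \<and>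
     (\<forall>p. 6 * card {i\<in>I. p \<in> pat i} \<le> card I))"

text \<open>Patterns are pulled back along \<open>L\<close>, a linear involution that preserves the
  star of 0. Such symmetries bring \<open>w\<close> into a single sector.\<close>

lemma sixth_family_image:
  fixes L :: "int \<times> int \<Rightarrow> int \<times> int"
  assumes add: "\<And>p q. L (p + q) = L p + L q" and inv: "\<And>p. L (L p) = p"
    and dirs: "\<And>d. d \<in> hexdirs \<Longrightarrow> L d \<in> hexdirs" and "sixth_family (L w)"
  shows "sixth_family w"
proof -
  from assms(4) obtain I :: "(int \<times> int) set" and pat where I: "finite I" "I \<noteq> {}"
    and dom: "\<forall>i\<in>I. \<forall>p. \<exists>q \<in> pat i. q = p \<or> q - p \<in> hexdirs"
    and per: "\<forall>i\<in>I. \<forall>p. p + L w \<in> pat i \<longleftrightarrow> p \<in> pat i"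
    and cnt: "\<forall>p. 6 * card {i\<in>I. p \<in> pat i} \<le> card I"
    unfolding sixth_family_def by blast
  have diff: "L (p - q) = L p - L q" for p q
    using add[of "p - q" q] by (simp add: algebra_simps)
  show ?thesis
    unfolding sixth_family_def
  proof (intro exI[of _ I] exI[of _ "\<lambda>i. L -` pat i"] conjI ballI allI)
    fix i p assume "i \<in> I"
    then obtain q where q: "q \<in> pat i" "q = L p \<or> q - L p \<in> hexdirs" using dom by blast
    have "L q = p \<or> L q - p \<in> hexdirs"
      using q(2) dirs[of "q - L p"] by (auto simp: inv diff)
    then show "\<exists>q\<in>L -` pat i. q = p \<or> q - p \<in> hexdirs"
      using q(1) by (intro bexI[of _ "L q"]) (auto simp: inv)
  next
    fix i p assume "i \<in> I"
    then show "p + w \<in> L -` pat i \<longleftrightarrow> p \<in> L -` pat i" using per by (simp only: vimage_eq add)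
  next
    fix p show "6 * card {i \<in> I. p \<in> L -` pat i} \<le> card I" unfolding vimage_eq using cnt by blast
  qed (use I in simp_all)
qed

text \<open>The pattern is the preimage of \<open>S\<close> under the homomorphism (i, j) -> x i + y
  j to the integers modulo \<open>m\<close>. The second condition bounds the density by 1/6, the
  third puts (a, b) into the kernel, and the last says that \<open>S\<close> dominates in the
  quotient, where the star of 0 becomes the listed residues.\<close>

definition hom_pattern_ok :: "int \<Rightarrow> int \<Rightarrow> int \<Rightarrow> int \<Rightarrow> int \<Rightarrow> int list \<Rightarrow> bool" where
  "hom_pattern_ok a b m x y S \<longleftrightarrow> m > 0 \<and> 6 * int (length S) \<le> m \<and> (a * x + b * y) mod m = 0 \<and>
     list_all (\<lambda>t. list_ex (\<lambda>c. (t + c) mod m \<in> set S) [0, x, y, y - x, -x, -y, x - y]) [0..m - 1]"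

lemma card_shift_mod_le:
  fixes m c :: int
  assumes "m > 0" "finite S"
  shows "card {k\<in>{0..<m}. (c + k) mod m \<in> S} \<le> card S"
proof (rule card_inj_on_le[where f = "\<lambda>k. (c + k) mod m"])
  show "inj_on (\<lambda>k. (c + k) mod m) {k \<in> {0..<m}. (c + k) mod m \<in> S}"
  proof (rule inj_onI)
    fix k l assume kl: "k \<in> {k \<in> {0..<m}. (c + k) mod m \<in> S}" "l \<in> {k \<in> {0..<m}. (c + k) mod m \<in> S}"
      and "(c + k) mod m = (c + l) mod m"
    then have "k mod m = l mod m" by (metis add_diff_cancel_left' mod_diff_left_eq)
    then show "k = l" using kl by simp
  qed
qed (use assms in auto)

lemma sixth_family_hom:
  assumes "hom_pattern_ok a b m x y S"
  shows "sixth_family (a, b)"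
proof -
  have m: "m > 0" and S: "6 * int (length S) \<le> m" and ab: "(a * x + b * y) mod m = 0"
    and dom: "\<And>t. 0 \<le> t \<Longrightarrow> t < m \<Longrightarrow> \<exists>c\<in>{0, x, y, y - x, -x, -y, x - y}. (t + c) mod m \<in> set S"
    using assms by (auto simp: hom_pattern_ok_def list_all_iff list_ex_iff)
  \<comment> \<open>The family consists of the \<open>m\<close> translates of one pattern, so a
    point lies in at most as many members as \<open>S\<close> has elements.\<close>
  define pat where "pat = (\<lambda>k :: int \<times> int. {p. (x * fst p + y * snd p + fst k) mod m \<in> set S})"
  define I where "I = {0..<m} \<times> {0::int}"
  have cI: "card I = nat m" by (simp add: I_def card_cartesian_product)
  show ?thesis
    unfolding sixth_family_def
  proof (intro exI[of _ I] exI[of _ pat] conjI ballI allI)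
    show "finite I" "I \<noteq> {}" using m by (auto simp: I_def)
  next
    fix k p :: "int \<times> int" assume "k \<in> I"
    define u where "u = x * fst p + y * snd p + fst k"
    obtain c where c: "c \<in> {0, x, y, y - x, -x, -y, x - y}" "(u mod m + c) mod m \<in> set S"
      using dom[OF pos_mod_sign[OF m] pos_mod_bound[OF m]] by blast
    then have c2: "(u + c) mod m \<in> set S" by (simp add: mod_add_left_eq)
    have ex: "\<exists>d. (d = 0 \<or> d \<in> hexdirs) \<and> c = x * fst d + y * snd d"
      using c(1)
      apply (elim insertE emptyE)
      subgoal by (intro exI[of _ "(0,0)"]) (auto simp: zero_prod_def)
      subgoal by (intro exI[of _ "(1,0)"]) (auto simp: hexdirs_def)
      subgoal by (intro exI[of _ "(0,1)"]) (auto simp: hexdirs_def)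
      subgoal by (intro exI[of _ "(-1,1)"]) (auto simp: hexdirs_def)
      subgoal by (intro exI[of _ "(-1,0)"]) (auto simp: hexdirs_def)
      subgoal by (intro exI[of _ "(0,-1)"]) (auto simp: hexdirs_def)
      subgoal by (intro exI[of _ "(1,-1)"]) (auto simp: hexdirs_def)
      done
    then obtain d where d: "d = 0 \<or> d \<in> hexdirs" "c = x * fst d + y * snd d" by blast
    have "x * fst (p + d) + y * snd (p + d) + fst k = u + c"
      by (simp add: u_def d(2) algebra_simps)
    then have "p + d \<in> pat k" using c2 by (simp add: pat_def)
    then show "\<exists>q\<in>pat k. q = p \<or> q - p \<in> hexdirs"
      using d(1) by (intro bexI[of _ "p + d"]) auto
  next
    fix k p :: "int \<times> int"
    have "(x * fst (p + (a, b)) + y * snd (p + (a, b)) + fst k)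
        = (x * fst p + y * snd p + fst k) + (a * x + b * y)" by (simp add: algebra_simps)
    also have "\<dots> mod m = (x * fst p + y * snd p + fst k) mod m"
      using ab by (metis add.right_neutral mod_add_right_eq)
    finally show "p + (a, b) \<in> pat k \<longleftrightarrow> p \<in> pat k" by (simp add: pat_def)
  next
    fix p
    have "{k\<in>I. p \<in> pat k} = {k\<in>{0..<m}. ((x * fst p + y * snd p) + k) mod m \<in> set S} \<times> {0}"
      by (auto simp: I_def pat_def)
    then have "card {k\<in>I. p \<in> pat k} \<le> card (set S)"
      using card_shift_mod_le[OF m, of "set S"] by (simp add: card_cartesian_product)
    also have "\<dots> \<le> length S" by (rule card_length)
    finally show "6 * card {k\<in>I. p \<in> pat k} \<le> card I" using S cI by linarith
  qed
qed

text \<open>The pattern is the perfect code \<open>i + 3 j \<equiv> 0 (mod 7)\<close> on \<open>a\<close> consecutive columns, with one additional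
  point out of 7 in each of the two columns at the seam.\<close>

lemma sixth_family_seam:
  assumes a: "a \<ge> 12"
  shows "sixth_family (a, b)"
proof -
  have apos: "a > 0" using a by simp
  \<comment> \<open>No domination crosses the seam of the strip of columns 0 to a - 1. In column 0
    the residues 1 and 5 of r + 3 j lose their dominator on the left, in column a - 1 the residues 2
    and 6 lose theirs on the right. An extra point of residue 5, respectively 6, dominates itself
    and the other lost residue next to it.\<close>
  define D where "D = (\<lambda>r j :: int. (r + 3 * j) mod 7 = 0 \<or> r = 0 \<and> j mod 7 = 4 \<or>
                          r = a - 1 \<and> (a + 3 * j) mod 7 = 0)"
  \<comment> \<open>The column is reduced modulo \<open>a\<close>, and each crossing of the seam
    lowers the row by \<open>b\<close>; this makes the pattern invariant under (a, b). The family
    shifts it by \<open>a\<close> columns and 7 rows.\<close>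
  define pat where "pat = (\<lambda>k :: int \<times> int. {p. D ((fst p + fst k) mod a)
                              (snd p + snd k - (fst p + fst k) div a * b)})"
  define I where "I = {0..<a} \<times> {0..<7::int}"
  have cI: "card I = nat (7 * a)" using a by (simp add: I_def card_cartesian_product nat_mult_distrib)
  have red: "\<exists>d. (d = 0 \<or> d \<in> hexdirs) \<and> 0 \<le> r + fst d \<and> r + fst d < a \<and> D (r + fst d) (j + snd d)"
    if r: "0 \<le> r" "r < a" for r j
  proof -
    have "(r + 3 * j) mod 7 \<in> {0..6}" by auto
    then consider "(r + 3 * j) mod 7 = 0" | "(r + 3 * j) mod 7 = 1" | "(r + 3 * j) mod 7 = 2"
      | "(r + 3 * j) mod 7 = 3" | "(r + 3 * j) mod 7 = 4" | "(r + 3 * j) mod 7 = 5" | "(r + 3 * j) mod 7 = 6"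
      by fastforce
    then show ?thesis
    proof cases
      case 1
      then show ?thesis using r by (intro exI[of _ "(0,0)"]) (auto simp: D_def zero_prod_def)
    next
      case 2
      show ?thesis
      proof (cases "r = 0")
        case True
        then have "(j + -1) mod 7 = 4" using 2 by presburger
        then show ?thesis using r True by (intro exI[of _ "(0,-1)"]) (auto simp: D_def hexdirs_def)
      next
        case False
        have "(r + -1 + 3 * j) mod 7 = 0" using 2 by presburger
        then show ?thesis using r False by (intro exI[of _ "(-1,0)"]) (auto simp: D_def hexdirs_def)
      qed
    next
      case 3
      show ?thesis
      proof (cases "r = a - 1")
        case True
        then have "(a + 3 * (j + -1)) mod 7 = 0" using 3 by presburger
        then show ?thesis using r True by (intro exI[of _ "(0,-1)"]) (auto simp: D_def hexdirs_def)
      next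
        case False
        have "(r + 1 + 3 * (j + -1)) mod 7 = 0" using 3 by presburger
        then show ?thesis using r False by (intro exI[of _ "(1,-1)"]) (auto simp: D_def hexdirs_def)
      qed
    next
      case 4
      have "(r + 3 * (j + -1)) mod 7 = 0" using 4 by presburger
      then show ?thesis using r by (intro exI[of _ "(0,-1)"]) (auto simp: D_def hexdirs_def)
    next
      case 5
      have "(r + 3 * (j + 1)) mod 7 = 0" using 5 by presburger
      then show ?thesis using r by (intro exI[of _ "(0,1)"]) (auto simp: D_def hexdirs_def)
    next
      case 6
      show ?thesis
      proof (cases "r = 0")
        case True
        then have "j mod 7 = 4" using 6 by presburger
        then show ?thesis using r True by (intro exI[of _ "(0,0)"]) (auto simp: D_def zero_prod_def)
      next
        case False
        have "(r + -1 + 3 * (j + 1)) mod 7 = 0" using 6 by presburger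
        then show ?thesis using r False by (intro exI[of _ "(-1,1)"]) (auto simp: D_def hexdirs_def)
      qed
    next
      case 7
      show ?thesis
      proof (cases "r = a - 1")
        case True
        then have "(a + 3 * j) mod 7 = 0" using 7 by presburger
        then show ?thesis using r True by (intro exI[of _ "(0,0)"]) (auto simp: D_def zero_prod_def)
      next
        case False
        have "(r + 1 + 3 * j) mod 7 = 0" using 7 by presburger
        then show ?thesis using r False by (intro exI[of _ "(1,0)"]) (auto simp: D_def hexdirs_def)
      qed
    qed
  qed
  have solve7: "card {y\<in>{0..<7::int}. (c + y) mod 7 = s} \<le> 1" for c s
    using card_shift_mod_le[of 7 "{s}" c] by simp
  have cnt: "card {y\<in>{0..<7}. D r (c + y)} \<le> 1 + (if r = 0 then 1 else 0) + (if r = a - 1 then 1 else 0)" for r c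
  proof -
    \<comment> \<open>As 3 * 2 is -1 modulo 7, the congruence has the solution x = 2 u.\<close>
    have s: "(u + 3 * x) mod 7 = 0 \<longleftrightarrow> x mod 7 = (2 * u) mod 7" for u x :: int
    proof -
      have "x - 2 * u = 7 * (x - 2 * k)" if "u + 3 * x = 7 * k" for k using that by simp
      moreover have "u + 3 * x = 7 * (u + 3 * k)" if "x - 2 * u = 7 * k" for k using that by simp
      ultimately have "7 dvd u + 3 * x \<longleftrightarrow> 7 dvd x - 2 * u" by (metis dvd_def)
      then show ?thesis by (simp add: mod_eq_dvd_iff dvd_eq_mod_eq_0)
    qed
    let ?A = "\<lambda>s. {y\<in>{0..<7}. (c + y) mod 7 = s}"
    let ?B = "\<lambda>P s. if P then ?A s else {}"
    have fin: "finite (?A s)" for s by (rule finite_subset[of _ "{0..<7}"]) blast+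
    have finB: "finite (?B P s)" for P s using fin by simp
    have B: "y \<in> ?B P s \<longleftrightarrow> P \<and> y \<in> {0..<7} \<and> (c + y) mod 7 = s" for y P s by simp
    have "{y\<in>{0..<7}. D r (c + y)} \<subseteq> ?A ((2 * r) mod 7) \<union> ?B (r = 0) 4 \<union> ?B (r = a - 1) ((2 * a) mod 7)"
      unfolding D_def s by (intro subsetI, unfold Un_iff B mem_Collect_eq) blast
    then have "card {y\<in>{0..<7}. D r (c + y)} \<le> card (?A ((2 * r) mod 7) \<union> ?B (r = 0) 4 \<union> ?B (r = a - 1) ((2 * a) mod 7))"
      by (intro card_mono finite_UnI fin finB)
    also have "\<dots> \<le> card (?A ((2 * r) mod 7)) + card (?B (r = 0) 4) + card (?B (r = a - 1) ((2 * a) mod 7))"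
      by (meson add_le_mono card_Un_le order_refl order_trans)
    also have "\<dots> \<le> 1 + (if r = 0 then 1 else 0) + (if r = a - 1 then 1 else 0)"
      using solve7[of c "(2 * r) mod 7"] solve7[of c 4] solve7[of c "(2 * a) mod 7"]
      by (intro add_mono) (simp_all only: if_split_asm split: if_splits, simp_all)
    finally show ?thesis .
  qed
  show ?thesis
    unfolding sixth_family_def
  proof (intro exI[of _ I] exI[of _ pat] conjI ballI allI)
    show "finite I" "I \<noteq> {}" using a by (auto simp: I_def)
  next
    fix k p :: "int \<times> int" assume "k \<in> I"
    define i where "i = fst p + fst k"
    define j where "j = snd p + snd k - i div a * b"
    obtain d where d: "d = 0 \<or> d \<in> hexdirs" "0 \<le> i mod a + fst d" "i mod a + fst d < a"
      "D (i mod a + fst d) (j + snd d)"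
      using red[OF pos_mod_sign[OF apos] pos_mod_bound[OF apos], of i j] by blast
    have dm: "(r + q * a) div a = q" "(r + q * a) mod a = r" if "0 \<le> r" "r < a" for r q
      using that by simp_all
    have i': "i + fst d = (i mod a + fst d) + (i div a) * a" by (simp add: algebra_simps)
    have "(i + fst d) div a = i div a" "(i + fst d) mod a = i mod a + fst d"
      using dm[OF d(2,3), of "i div a"] by (simp_all only: i'[symmetric])
    then have "p + d \<in> pat k" using d(4) by (simp add: pat_def i_def j_def algebra_simps)
    then show "\<exists>q\<in>pat k. q = p \<or> q - p \<in> hexdirs"
      using d(1) by (intro bexI[of _ "p + d"]) auto
  next
    fix k p :: "int \<times> int"
    have eq: "fst (p + (a, b)) + fst k = (fst p + fst k) + a" by simp
    have "(fst (p + (a, b)) + fst k) mod a = (fst p + fst k) mod a"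
      "(fst (p + (a, b)) + fst k) div a = (fst p + fst k) div a + 1"
      unfolding eq using apos by simp_all
    then show "p + (a, b) \<in> pat k \<longleftrightarrow> p \<in> pat k" by (simp add: pat_def algebra_simps)
  next
    fix p :: "int \<times> int"
    define i where "i = fst p"
    let ?Y = "\<lambda>x. {y\<in>{0..<7}. D ((i + x) mod a) ((snd p - (i + x) div a * b) + y)}"
    have ct: "(\<Sum>x\<in>{0..<a}. if P x then 1 else 0 :: nat) = card {x\<in>{0..<a}. P x}" for P
      by (simp only: card_eq_sum sum.inter_filter[OF finite_atLeastLessThan_int])
    have finY: "finite (?Y x)" for x by (rule finite_subset[of _ "{0..<7}"]) blast+
    have "{k\<in>I. p \<in> pat k} = Sigma {0..<a} ?Y"
      by (auto simp: I_def pat_def i_def algebra_simps)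
    then have "card {k\<in>I. p \<in> pat k} = (\<Sum>x\<in>{0..<a}. card (?Y x))"
      by (simp only: card_SigmaI[OF finite_atLeastLessThan_int ballI[OF finY]])
    also have "\<dots> \<le> (\<Sum>x\<in>{0..<a}. 1 + (if (i + x) mod a = 0 then 1 else 0) + (if (i + x) mod a = a - 1 then 1 else 0))"
      by (intro sum_mono cnt)
    also have "\<dots> = nat a + card {x\<in>{0..<a}. (i + x) mod a \<in> {0}} + card {x\<in>{0..<a}. (i + x) mod a \<in> {a - 1}}"
      by (simp only: sum.distrib ct singleton_iff) simp
    also have "\<dots> \<le> nat a + 1 + 1"
      using card_shift_mod_le[of a "{0}" i] card_shift_mod_le[of a "{a - 1}" i] a by (intro add_mono) auto
    \<comment> \<open>The source of the bound 12: of the 7 a shifts at most a + 2 contain the point,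
      and 6 (a + 2) <= 7 a means a >= 12.\<close>
    finally have "card {k\<in>I. p \<in> pat k} \<le> nat a + 2" by simp
    then show "6 * card {k\<in>I. p \<in> pat k} \<le> card I" using a cI by linarith
  qed
qed

text \<open>An entry \<open>(m, x, y, S)\<close> stands for the preimage of \<open>S\<close> under \<open>(i, j) \<mapsto> x i + y j (mod m)\<close>. The entries
  were found by a computer search.\<close>

definition hom_patterns :: "(int \<times> int \<times> int \<times> int list) list" where
  "hom_patterns = [(6,1,3,[0]), (6,1,4,[0]), (6,2,3,[0]), (6,2,5,[0]), (6,3,1,[0]), (6,3,2,[0]),
     (7,1,3,[0]), (7,1,5,[0]), (12,1,5,[0,2]), (12,1,8,[0,2]), (12,4,5,[0,2]), (13,1,6,[0,10]),
     (13,1,11,[0,7]), (18,1,7,[0,2,4]), (19,1,13,[0,2,4]), (20,1,14,[0,2,11]),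
     (25,5,1,[0,2,13,15]), (33,3,1,[0,5,12,19,26])]"

text \<open>Half of the range of \<open>b\<close> is enough, since a reflection exchanges
  \<open>b\<close> with -a - b. Lengths from 12 on are covered by the seam construction.\<close>

lemma hom_patterns_suffice:
  "list_all (\<lambda>a. list_all (\<lambda>b. list_ex (\<lambda>(m, x, y, S). hom_pattern_ok a b m x y S) hom_patterns)
     [-(a div 2)..0]) [3..11]"
  by code_simp

lemma sixth_family_sector:
  assumes "a \<ge> 3" "-a \<le> b" "b \<le> 0"
  shows "sixth_family (a, b)"
proof -
  have half: "sixth_family (a, b)" if "-(a div 2) \<le> b" "b \<le> 0" for b
  proof (cases "a \<ge> 12")
    case True
    then show ?thesis by (rule sixth_family_seam)
  next
    case False
    then have "a \<in> {3..11}" using assms by simp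
    moreover have "b \<in> {-(a div 2)..0}" using that by simp
    ultimately have "\<exists>q\<in>set hom_patterns. case q of (m, x, y, S) \<Rightarrow> hom_pattern_ok a b m x y S"
      using hom_patterns_suffice unfolding list_all_iff list_ex_iff set_upto by blast
    then show ?thesis using sixth_family_hom by blast
  qed
  show ?thesis
  proof (cases "-(a div 2) \<le> b")
    case True
    then show ?thesis using half assms by blast
  next
    case False
    then have "sixth_family (a, - a - b)" using assms by (intro half) presburger+
    then show ?thesis
      by (intro sixth_family_image[of "\<lambda>p. (fst p, - fst p - snd p)" "(a, b)"])
         (auto simp: hexdirs_def algebra_simps)
  qed
qed

text \<open>A swap or a flip moves the largest of |a|, |b|, |a + b| into the first coordinate. The
  second coordinate then has no larger absolute value and not the same sign, which up to a global
  sign is the sector treated before. That periods have norm at least 3 will come from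
  \<open>dev_no_short\<close>.\<close>

theorem sixth_family:
  assumes "hexnorm w \<ge> 3"
  shows "sixth_family w"
proof -
  have neg: "sixth_family w" if "sixth_family (- w)" for w
    using that by (intro sixth_family_image[of uminus w]) (auto simp: hexdirs_def)
  have swap: "sixth_family w" if "sixth_family (snd w, fst w)" for w
    using that by (intro sixth_family_image[of "\<lambda>p. (snd p, fst p)" w]) (auto simp: hexdirs_def)
  have flip: "sixth_family w" if "sixth_family (- fst w - snd w, snd w)" for w
    using that by (intro sixth_family_image[of "\<lambda>p. (- fst p - snd p, snd p)" w]) (auto simp: hexdirs_def)
  obtain a b where w: "w = (a, b)" by force
  have big: "sixth_family (a, b)" if "\<bar>a\<bar> \<ge> 3" "\<bar>a\<bar> \<ge> \<bar>b\<bar>" "\<bar>a\<bar> \<ge> \<bar>a + b\<bar>" for a b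
  proof (cases "a \<ge> 0")
    case True
    then show ?thesis using that by (intro sixth_family_sector) auto
  next
    case False
    then have "sixth_family (- (a, b))" using that by (simp, intro sixth_family_sector) auto
    then show ?thesis by (rule neg)
  qed
  consider "\<bar>a\<bar> \<ge> \<bar>b\<bar>" "\<bar>a\<bar> \<ge> \<bar>a + b\<bar>" | "\<bar>b\<bar> \<ge> \<bar>a\<bar>" "\<bar>b\<bar> \<ge> \<bar>a + b\<bar>" | "\<bar>a + b\<bar> \<ge> \<bar>b\<bar>" "\<bar>a + b\<bar> \<ge> \<bar>a\<bar>"
    by linarith
  then show ?thesis
  proof cases
    case 1
    then show ?thesis using assms w by (auto simp: hexnorm_def intro!: big)
  next
    case 2
    then have "sixth_family (b, a)" using assms w by (intro big) (auto simp: hexnorm_def)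
    then show ?thesis using swap[of w] w by simp
  next
    case 3
    then have "sixth_family (- a - b, b)" using assms w by (intro big) (auto simp: hexnorm_def)
    then show ?thesis using flip[of w] w by simp
  qed
qed

section \<open>The lattice and its point group\<close>

text \<open>The unit vectors in cyclic order, indexed by all integers so that a symmetry acts on
  directions by d -> s d + k.\<close>

definition hdir :: "int \<Rightarrow> int \<times> int" where
  "hdir d = (if d mod 6 = 0 then (1,0) else if d mod 6 = 1 then (0,1) else if d mod 6 = 2 then (-1,1)
     else if d mod 6 = 3 then (-1,0) else if d mod 6 = 4 then (0,-1) else (1,-1))"

lemma hdir_simps [simp]:
  "hdir 0 = (1,0)" "hdir 1 = (0,1)" "hdir 2 = (-1,1)" "hdir 3 = (-1,0)" "hdir 4 = (0,-1)" "hdir 5 = (1,-1)"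
  by (simp_all add: hdir_def)

lemma hdir_mod: "hdir (d mod 6) = hdir d"
  by (simp add: hdir_def)

lemma mod6_cases:
  fixes d :: int
  obtains "d mod 6 = 0" | "d mod 6 = 1" | "d mod 6 = 2" | "d mod 6 = 3" | "d mod 6 = 4" | "d mod 6 = 5"
proof -
  have "d mod 6 = 0 \<or> d mod 6 = 1 \<or> d mod 6 = 2 \<or> d mod 6 = 3 \<or> d mod 6 = 4 \<or> d mod 6 = 5"
    by presburger
  then show ?thesis by (elim disjE) (rule that, assumption)+
qed

text \<open>The relation z^2 = z - 1 of a primitive sixth root of unity.\<close>

lemma hdir_rec: "hdir (d + 2) = hdir (d + 1) - hdir d"
proof -
  have "(d + 1) mod 6 = (d mod 6 + 1) mod 6" "(d + 2) mod 6 = (d mod 6 + 2) mod 6"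
    by (simp_all add: mod_add_left_eq)
  then show ?thesis by (cases d rule: mod6_cases) (simp_all add: hdir_def)
qed

lemma hdir_opp: "hdir (d + 3) = - hdir d"
  using hdir_rec[of d] hdir_rec[of "d + 1"] by (simp add: add.assoc)

lemma hexdirs_hdir: assumes "v \<in> hexdirs" obtains d where "v = hdir d"
  using assms hdir_simps unfolding hexdirs_def by (metis emptyE insertE)

lemma hexnorm_0 [simp]: "hexnorm 0 = 0" and hexnorm_nonneg: "hexnorm p \<ge> 0"
  and hexnorm_eq_0: "hexnorm p = 0 \<longleftrightarrow> p = 0"
  by (auto simp: hexnorm_def zero_prod_def prod_eq_iff)

lemma hexnorm_le_iff: "hexnorm p \<le> m \<longleftrightarrow> \<bar>fst p\<bar> \<le> m \<and> \<bar>snd p\<bar> \<le> m \<and> \<bar>fst p + snd p\<bar> \<le> m"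
  by (auto simp: hexnorm_def)

lemma hexnorm_add: "hexnorm (p + q) \<le> hexnorm p + hexnorm q"
proof -
  have "\<bar>fst p\<bar> \<le> hexnorm p \<and> \<bar>snd p\<bar> \<le> hexnorm p \<and> \<bar>fst p + snd p\<bar> \<le> hexnorm p" for p
    using hexnorm_le_iff[of p "hexnorm p"] by simp
  from this[of p] this[of q] show ?thesis unfolding hexnorm_le_iff[of "p + q"] abs_le_iff by auto
qed

lemma hexnorm_minus [simp]: "hexnorm (- p) = hexnorm p"
  using abs_minus_cancel[of "fst p + snd p"] by (simp add: hexnorm_def)

lemma hexnorm_diff: "hexnorm (p - q) \<le> hexnorm p + hexnorm q"
  using hexnorm_add[of p "- q"] by simp

lemma hexnorm_hdir [simp]: "hexnorm (hdir d) = 1"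
  by (simp add: hdir_def hexnorm_def)

definition iscale :: "int \<Rightarrow> int \<times> int \<Rightarrow> int \<times> int" where
  "iscale m p = (m * fst p, m * snd p)"

lemma iscale_simps [simp]: "fst (iscale m p) = m * fst p" "snd (iscale m p) = m * snd p"
  "iscale 0 p = 0" "iscale 1 p = p"
  by (simp_all add: iscale_def zero_prod_def)

lemma iscale_add_left: "iscale (m + n) p = iscale m p + iscale n p"
  and iscale_add: "iscale m (p + q) = iscale m p + iscale m q"
  and iscale_uminus_left: "iscale (- m) p = - iscale m p"
  and iscale_iscale: "iscale m (iscale n p) = iscale (m * n) p"
  by (simp_all add: iscale_def algebra_simps prod_eq_iff)

lemma hexnorm_iscale: "hexnorm (iscale m p) = \<bar>m\<bar> * hexnorm p"
proof -
  have "\<bar>m\<bar> * max (max x y) z = max (max (\<bar>m\<bar> * x) (\<bar>m\<bar> * y)) (\<bar>m\<bar> * z)" for x y z :: int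
    by (simp add: max_mult_distrib_left)
  then show ?thesis by (simp add: hexnorm_def abs_mult flip: distrib_left)
qed

lemma hexball_finite_card:
  assumes "m \<ge> 0"
  shows "finite {p. hexnorm p \<le> m}" "card {p. hexnorm p \<le> m} \<le> nat (2 * m + 1) ^ 2"
proof -
  have sub: "{p. hexnorm p \<le> m} \<subseteq> {-m..m} \<times> {-m..m}" by (auto simp: hexnorm_def)
  then show "finite {p. hexnorm p \<le> m}" by (rule finite_subset) simp
  have "card {p. hexnorm p \<le> m} \<le> card ({-m..m} \<times> {-m..m})" by (rule card_mono[OF _ sub]) simp
  also have "\<dots> = nat (2 * m + 1) ^ 2" by (simp add: card_cartesian_product power2_eq_square)
  finally show "card {p. hexnorm p \<le> m} \<le> nat (2 * m + 1) ^ 2" .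
qed

lemma hexnorm_step:
  assumes "p \<noteq> 0" obtains d where "hexnorm (p - hdir d) = hexnorm p - 1"
proof -
  obtain i j where p: "p = (i, j)" by force
  then have "i \<noteq> 0 \<or> j \<noteq> 0" using assms by (auto simp: zero_prod_def)
  then consider "i > 0" "j \<ge> 0" | "i \<le> 0" "j > 0" "i + j > 0" | "i < 0" "j > 0" "i + j \<le> 0"
    | "i < 0" "j \<le> 0" | "i \<ge> 0" "j < 0" "i + j < 0" | "i > 0" "j < 0" "i + j \<ge> 0"
    by linarith
  then show ?thesis
  proof cases
    case 1 then show ?thesis using that[of 0] by (simp add: p hexnorm_def)
  next
    case 2 then show ?thesis using that[of 1] by (simp add: p hexnorm_def)
  next
    case 3 then show ?thesis using that[of 2] by (simp add: p hexnorm_def)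
  next
    case 4 then show ?thesis using that[of 3] by (simp add: p hexnorm_def)
  next
    case 5 then show ?thesis using that[of 4] by (simp add: p hexnorm_def)
  next
    case 6 then show ?thesis using that[of 5] by (simp add: p hexnorm_def)
  qed
qed

text \<open>Induction along a shortest path from 0, which never leaves the ball.\<close>

lemma hexball_induct [consumes 1, case_names zero step]:
  assumes "hexnorm p \<le> m" "P 0"
    and "\<And>q d. P q \<Longrightarrow> hexnorm q \<le> m \<Longrightarrow> hexnorm (q + hdir d) \<le> m \<Longrightarrow> P (q + hdir d)"
  shows "P p"
  using assms(1)
proof (induction "nat (hexnorm p)" arbitrary: p)
  case 0
  then have "p = 0" using hexnorm_nonneg[of p] hexnorm_eq_0[of p] by linarith
  then show ?case using assms(2) by simp
next
  case (Suc n)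
  then have "p \<noteq> 0" by auto
  then obtain d where d: "hexnorm (p - hdir d) = hexnorm p - 1" by (rule hexnorm_step)
  have "P (p - hdir d)" using Suc d by (intro Suc.hyps(1)) auto
  then show ?case using assms(3)[of "p - hdir d" d] d Suc.prems by simp
qed

text \<open>Two points at distance at most 2 lie in a common closed star, where a frame will keep
  their images apart.\<close>

lemma hexnorm_2_star:
  assumes "hexnorm d \<le> 2"
  obtains x y where "x = 0 \<or> x \<in> hexdirs" "y = 0 \<or> y \<in> hexdirs" "d = x - y"
proof -
  have *: "list_all (\<lambda>i. list_all (\<lambda>j. \<bar>i + j\<bar> \<le> 2 \<longrightarrow> list_ex (\<lambda>x. list_ex (\<lambda>y. i = fst x - fst y \<and> j = snd x - snd y)
      [(0,0), (1,0), (0,1), (-1,1), (-1,0), (0,-1), (1,-1)]) [(0,0), (1,0), (0,1), (-1,1), (-1,0), (0,-1), (1,-1)])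
      [-2..2]) [-2..2::int]"
    by code_simp
  have "fst d \<in> {-2..2}" "snd d \<in> {-2..2}" "\<bar>fst d + snd d\<bar> \<le> 2" using assms by (auto simp: hexnorm_def)
  then have "\<exists>x\<in>insert 0 hexdirs. \<exists>y\<in>insert 0 hexdirs. fst d = fst x - fst y \<and> snd d = snd x - snd y"
    using * unfolding list_all_iff list_ex_iff set_upto hexdirs_def zero_prod_def list.set by blast
  then show ?thesis using that by (metis insertE minus_prod_def prod.collapse)
qed

text \<open>The linear lattice symmetry that sends direction \<open>d\<close> to direction \<open>s d + k\<close>, for \<open>s\<close> = 1 or -1.\<close>

definition hact :: "int \<Rightarrow> int \<Rightarrow> int \<times> int \<Rightarrow> int \<times> int" where
  "hact s k p = iscale (fst p) (hdir k) + iscale (snd p) (hdir (k + s))"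

lemma hact_0 [simp]: "hact s k 0 = 0"
  by (simp add: hact_def)

lemma hact_add: "hact s k (p + q) = hact s k p + hact s k q"
  by (simp add: hact_def iscale_add_left algebra_simps)

lemma hact_minus: "hact s k (- p) = - hact s k p"
  by (simp add: hact_def iscale_uminus_left algebra_simps)

lemma hact_diff: "hact s k (p - q) = hact s k p - hact s k q"
  using hact_add[of s k p "- q"] by (simp add: hact_minus)

lemma hact_iscale: "hact s k (iscale m p) = iscale m (hact s k p)"
  by (simp add: hact_def iscale_iscale iscale_add)

lemma hact_hdir:
  assumes "s = 1 \<or> s = -1"
  shows "hact s k (hdir d) = hdir (s * d + k)"
proof -
  have base: "hact s k (hdir (d mod 6)) = hdir (s * (d mod 6) + k)"
  proof -
    have r: "hdir (k + 2 * s) = hdir (k + s) - hdir k"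
      using assms hdir_rec[of k] hdir_rec[of "k - 2"] by auto
    have o: "hdir (k + 3 * s) = - hdir k" "hdir (k + 4 * s) = - hdir (k + s)"
      "hdir (k + 5 * s) = - hdir (k + 2 * s)"
      using assms hdir_opp[of k] hdir_opp[of "k + 1"] hdir_opp[of "k + 2"]
        hdir_opp[of "k - 3"] hdir_opp[of "k - 4"] hdir_opp[of "k - 5"] by (auto simp: add.assoc)
    show ?thesis
      by (cases d rule: mod6_cases)
         (simp_all add: hact_def iscale_uminus_left r o add.commute mult.commute[of s]
            iscale_uminus_left[of 1, simplified])
  qed
  have "(s * (d mod 6) + k) mod 6 = (s * d + k) mod 6" by (metis mod_add_left_eq mod_mult_right_eq)
  then show ?thesis using base hdir_mod by metis
qed

lemma hact_hact:
  assumes "s = 1 \<or> s = -1" "s' = 1 \<or> s' = -1"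
  shows "hact s k (hact s' k' p) = hact (s * s') (s * k' + k) p"
  unfolding hact_def[of s' k'] by (simp add: hact_add hact_iscale hact_hdir[OF assms(1)])
     (simp add: hact_def algebra_simps)

lemma hact_mod: "hact s (k mod 6) p = hact s k p"
  unfolding hact_def by (metis hdir_mod mod_add_left_eq)

lemma hact_id [simp]: "hact 1 0 p = p"
  by (simp add: hact_def iscale_def)

lemma hexnorm_hact:
  assumes "s = 1 \<or> s = -1"
  shows "hexnorm (hact s k p) = hexnorm p"
proof -
  have le: "hexnorm (hact s k p) \<le> hexnorm p" if s: "s = 1 \<or> s = -1" for s k p
  proof -
    obtain i j where p: "p = (i, j)" by force
    define m where "m = hexnorm p"
    have b: "i \<le> m" "-i \<le> m" "j \<le> m" "-j \<le> m" "i + j \<le> m" "-i - j \<le> m"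
      using hexnorm_le_iff[of p m] by (auto simp: m_def p abs_le_iff)
    have "hexnorm (hact s (k mod 6) p) \<le> m"
      using s unfolding hexnorm_le_iff
      by (elim disjE; cases k rule: mod6_cases) (use b in \<open>simp_all add: hact_def p hdir_def abs_le_iff\<close>)
    then show ?thesis by (simp add: hact_mod m_def)
  qed
  have "hact s (- s * k) (hact s k p) = p"
    using assms by (auto simp: hact_hact)
  then show ?thesis using le[OF assms, of k p] le[OF assms, of "- s * k" "hact s k p"] by simp
qed

lemma hact_surj:
  assumes "s = 1 \<or> s = -1"
  obtains q where "hact s k q = p" "hexnorm q = hexnorm p"
proof -
  have "hact s k (hact s (- s * k) p) = p"
    using assms by (auto simp: hact_hact)
  then show ?thesis using that hexnorm_hact[OF assms] by metis
qed

definition idet :: "int \<times> int \<Rightarrow> int \<times> int \<Rightarrow> int" where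
  "idet p q = fst p * snd q - snd p * fst q"

text \<open>A nontrivial element of the point group that fixes a nonzero \<open>U\<close> is the
  reflection in the line of \<open>U\<close>. The difference of a vector and its mirror image is in
  the eigenspace of -1, hence independent of \<open>U\<close> if it is nonzero. The proof checks all
  elements.\<close>

lemma idet_hact_fixed:
  assumes s: "s = 1 \<or> s = -1" and k: "0 \<le> k" "k < 6" "(s, k) \<noteq> (1, 0)"
    and U: "hact s k U = U" "U \<noteq> 0" and d: "d = 0 \<or> d = 1" "hact s k (hdir d) \<noteq> hdir d"
  shows "idet (hdir d - hact s k (hdir d)) U \<noteq> 0"
proof -
  obtain a b where ab: "U = (a, b)" by force
  have "k \<in> {0, 1, 2, 3, 4, 5}" using k by auto
  moreover have "a \<noteq> 0 \<or> b \<noteq> 0" using U(2) by (auto simp: ab zero_prod_def)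
  moreover have "fst (hact s k (a, b)) = a" "snd (hact s k (a, b)) = b" using U(1) by (simp_all add: ab)
  ultimately show ?thesis
    using s d k(3) unfolding ab
    apply (elim insertE disjE emptyE)
    apply (simp_all add: hact_def idet_def hdir_def)
    done
qed

lemma hact_moves_basis:
  assumes s: "s = 1 \<or> s = -1" and k: "0 \<le> k" "k < 6" "(s, k) \<noteq> (1, 0)"
  obtains d where "d = 0 \<or> d = 1" "hact s k (hdir d) \<noteq> hdir d"
proof -
  have "k \<in> {0, 1, 2, 3, 4, 5}" using k by auto
  then have "hact s k (hdir 0) \<noteq> hdir 0 \<or> hact s k (hdir 1) \<noteq> hdir 1"
    using s k(3) by (elim insertE disjE emptyE) (simp_all add: hact_def iscale_def hdir_def)
  then show ?thesis using that by blast
qed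

section \<open>Graphs with hexagonal links\<close>

text \<open>The cyclic order of the six neighbours of \<open>v\<close>, as a function on integers modulo 6.\<close>

definition hexframe ::
  "('a \<Rightarrow> 'a \<Rightarrow> bool) \<Rightarrow> ('a \<Rightarrow> 'a \<Rightarrow> 'a \<Rightarrow> bool) \<Rightarrow> 'a \<Rightarrow> (int \<Rightarrow> 'a) \<Rightarrow> bool" where
  "hexframe adj tri v f \<longleftrightarrow> (\<forall>d. f (d + 6) = f d) \<and> (\<forall>d d'. f d = f d' \<longrightarrow> (d - d') mod 6 = 0) \<and>
      (\<forall>u. adj v u \<longleftrightarrow> (\<exists>d. u = f d)) \<and> (\<forall>d x. tri v (f d) x \<longleftrightarrow> x = f (d + 1) \<or> x = f (d - 1))"

text \<open>What the domination argument uses of a triangulation: \<open>tri\<close> stands for the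
  faces, \<open>good\<close> for vertices whose link is a hexagon, and \<open>connected_V\<close>
  expresses connectedness through sets closed under adjacency.\<close>

locale hexmesh =
  fixes V :: "'a set" and adj :: "'a \<Rightarrow> 'a \<Rightarrow> bool" and tri :: "'a \<Rightarrow> 'a \<Rightarrow> 'a \<Rightarrow> bool"
    and good :: "'a set"
  assumes finV: "finite V"
    and adj_V: "adj u v \<Longrightarrow> u \<in> V \<and> v \<in> V"
    and adj_sym: "adj u v \<Longrightarrow> adj v u"
    and adj_irrefl: "\<not> adj v v"
    and tri_swap: "tri a b c \<Longrightarrow> tri b a c"
    and good_V: "good \<subseteq> V"
    and good_frame: "v \<in> good \<Longrightarrow> \<exists>f. hexframe adj tri v f"
    and connected_V: "A \<subseteq> V \<Longrightarrow> A \<noteq> {} \<Longrightarrow> (\<And>a b. a \<in> A \<Longrightarrow> adj a b \<Longrightarrow> b \<in> A) \<Longrightarrow> A = V"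
begin

abbreviation frame :: "'a \<Rightarrow> (int \<Rightarrow> 'a) \<Rightarrow> bool" where
  "frame \<equiv> hexframe adj tri"

lemmas frame_def = hexframe_def[of adj tri]

lemma frameD:
  assumes "frame v f"
  shows "f (d + 6) = f d" "f d = f d' \<Longrightarrow> (d - d') mod 6 = 0" "adj v (f d)"
    "adj v u \<Longrightarrow> \<exists>d. u = f d" "tri v (f d) x \<longleftrightarrow> x = f (d + 1) \<or> x = f (d - 1)"
  using assms unfolding frame_def by blast+

lemma frame_period:
  assumes "frame v f" shows "f (d + 6 * n) = f d"
proof (induction n rule: int_induct[of _ 0])
  case (step1 i) then show ?case using frameD(1)[OF assms, of "d + 6 * i"] by (simp add: algebra_simps)
next
  case (step2 i) then show ?case using frameD(1)[OF assms, of "d + 6 * (i - 1)"] by (simp add: algebra_simps)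
qed simp

lemma frame_mod: assumes "frame v f" shows "f (d mod 6) = f d"
  using frame_period[OF assms, of d "- (d div 6)"] by (simp add: minus_mult_div_eq_mod)

lemma frame_eq_iff: assumes "frame v f" shows "f d = f d' \<longleftrightarrow> (d - d') mod 6 = 0"
proof
  assume "(d - d') mod 6 = 0"
  then have "d mod 6 = d' mod 6" by presburger
  then show "f d = f d'" using frame_mod[OF assms] by metis
qed (rule frameD(2)[OF assms])

lemma frame_relabel:
  assumes f: "frame v f" and s: "s = 1 \<or> s = -1"
  shows "frame v (\<lambda>d. f (s * d + k))"
  unfolding frame_def
proof (intro conjI allI impI)
  fix d show "f (s * (d + 6) + k) = f (s * d + k)"
    using frame_period[OF f, of "s * d + k" s] by (simp add: algebra_simps)
next
  fix d d' assume "f (s * d + k) = f (s * d' + k)"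
  then have "(s * d + k - (s * d' + k)) mod 6 = 0" by (rule frameD(2)[OF f])
  then show "(d - d') mod 6 = 0" using s by (elim disjE) (simp, simp, presburger)
next
  fix u
  have "\<exists>e. d = s * e + k" for d using s by (intro exI[of _ "s * (d - k)"]) auto
  then show "adj v u \<longleftrightarrow> (\<exists>d. u = f (s * d + k))" using frameD(3,4)[OF f] by metis
next
  fix d x
  show "tri v (f (s * d + k)) x \<longleftrightarrow> x = f (s * (d + 1) + k) \<or> x = f (s * (d - 1) + k)"
    using s frameD(5)[OF f, of "s * d + k" x] by (elim disjE) (auto simp: algebra_simps)
qed

text \<open>In a link cycle a vertex and its predecessor determine the next vertex, so two
  consecutive values fix the whole frame.\<close>

lemma frame_unique:
  assumes f: "frame v f" and g: "frame v g" and eq: "f d = g d" "f (d + 1) = g (d + 1)"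
  shows "f = g"
proof -
  have "f (d + int n) = g (d + int n) \<and> f (d + int n + 1) = g (d + int n + 1)" for n
  proof (induction n)
    case (Suc n)
    let ?e = "d + int n + 1"
    have "f (?e + 1) \<noteq> f (?e - 1)" using frame_eq_iff[OF f, of "?e + 1" "?e - 1"] by simp
    moreover have "tri v (g ?e) (f (?e + 1))" using frameD(5)[OF f, of ?e "f (?e + 1)"] Suc by simp
    ultimately have "f (?e + 1) = g (?e + 1)" using frameD(5)[OF g, of ?e] Suc by auto
    then show ?case using Suc by (simp add: algebra_simps)
  qed (use eq in simp)
  then have *: "f (d + int n) = g (d + int n)" for n by blast
  have "f e = g e" for e
  proof -
    let ?e = "d + int (nat ((e - d) mod 6))"
    have "e - ?e = 6 * ((e - d) div 6)"
      by (simp add: diff_diff_eq[symmetric] minus_mod_eq_mult_div)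
    then have "(e - ?e) mod 6 = 0" by simp
    then have "f e = f ?e" "g e = g ?e" by (rule frame_eq_iff[OF f, THEN iffD2], rule frame_eq_iff[OF g, THEN iffD2])
    then show ?thesis using *[of "nat ((e - d) mod 6)"] by (simp only:)
  qed
  then show ?thesis by blast
qed

text \<open>Two labellings of one hexagon differ by an element of the dihedral group.\<close>

lemma frames_related:
  assumes f: "frame v f" and g: "frame v g"
  obtains s k where "s = 1 \<or> s = -1" "0 \<le> k" "k < 6" "f = (\<lambda>d. g (s * d + k))"
proof -
  obtain m where m: "f 0 = g m" using frameD(3)[OF f, of 0] frameD(4)[OF g] by blast
  have "tri v (g m) (f 1)" using frameD(5)[OF f, of 0 "f 1"] m by simp
  then have "\<exists>s. (s = 1 \<or> s = -1) \<and> f 1 = g (m + s)" using frameD(5)[OF g, of m] by fastforce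
  then obtain s where s: "s = 1 \<or> s = -1" "f 1 = g (m + s)" by blast
  have fg: "f = (\<lambda>d. g (s * d + m mod 6))"
  proof (rule frame_unique[OF f frame_relabel[OF g s(1)], of 0])
    show "f 0 = g (s * 0 + m mod 6)" using m frame_mod[OF g] by simp
    have "(m + s - (s + m mod 6)) mod 6 = 0" by (simp add: minus_mod_eq_mult_div)
    then have "g (m + s) = g (s + m mod 6)" by (rule frame_eq_iff[OF g, THEN iffD2])
    then show "f (0 + 1) = g (s * (0 + 1) + m mod 6)" using s(2) by simp
  qed
  show ?thesis by (rule that[OF s(1) _ _ fg]) simp_all
qed

text \<open>Parallel transport in direction \<open>d\<close>. The edge from \<open>v\<close> to
  \<open>f d\<close> lies on the triangles with \<open>f (d + 1)\<close> and
  \<open>f (d - 1)\<close>; seen from \<open>f d\<close> these two vertices flank \<open>v\<close>,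
  which is in the opposite direction d + 3.\<close>

lemma frame_transport:
  assumes f: "frame v f" and u: "f d \<in> good"
  obtains f' where "frame (f d) f'" "f' (d + 3) = v" "f' (d + 2) = f (d + 1)" "f' (d + 4) = f (d - 1)"
proof -
  obtain g where g: "frame (f d) g" using good_frame[OF u] by blast
  obtain m where m: "v = g m" using frameD(3)[OF f, of d] frameD(4)[OF g] adj_sym by blast
  have "tri (f d) v (f (d + 1))" "tri (f d) v (f (d - 1))"
    using frameD(5)[OF f, of d] tri_swap by blast+
  then have t: "f (d + 1) = g (m + 1) \<or> f (d + 1) = g (m - 1)" "f (d - 1) = g (m + 1) \<or> f (d - 1) = g (m - 1)"
    using frameD(5)[OF g, of m] m by auto
  have ne: "f (d + 1) \<noteq> f (d - 1)" using frame_eq_iff[OF f, of "d + 1" "d - 1"] by simp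
  show ?thesis
  proof (cases "f (d + 1) = g (m + 1)")
    case True
    then have "f (d - 1) = g (m - 1)" using t ne by auto
    then show ?thesis using True m that[OF frame_relabel[OF g, of "-1" "m + d + 3"]]
      by (simp add: algebra_simps)
  next
    case False
    then have "f (d + 1) = g (m - 1)" "f (d - 1) = g (m + 1)" using t ne by auto
    then show ?thesis using m that[OF frame_relabel[OF g, of 1 "m - d - 3"]]
      by (simp add: algebra_simps)
  qed
qed

fun nball :: "nat \<Rightarrow> 'a \<Rightarrow> 'a set" where
  "nball 0 v = {v}"
| "nball (Suc n) v = nball n v \<union> {u. \<exists>w\<in>nball n v. adj w u}"

lemma nball_mono: "m \<le> n \<Longrightarrow> nball m v \<subseteq> nball n v"
  by (induction n) (auto simp: le_Suc_eq)

lemma nball_self: "v \<in> nball n v"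
  by (induction n) auto

lemma nball_step: "adj v u \<Longrightarrow> nball n u \<subseteq> nball (Suc n) v"
  by (induction n) (auto simp: nball_self)

lemma nball_sym: "u \<in> nball n v \<Longrightarrow> v \<in> nball n u"
proof (induction n arbitrary: u)
  case (Suc n)
  then consider "u \<in> nball n v" | w where "w \<in> nball n v" "adj w u" by auto
  then show ?case
  proof cases
    case 1 then show ?thesis using Suc.IH by auto
  next
    case 2 then show ?thesis using Suc.IH nball_step[OF adj_sym] by blast
  qed
qed simp

lemma nball_V: "v \<in> V \<Longrightarrow> nball n v \<subseteq> V"
  by (induction n) (use adj_V in auto)

section \<open>Developing the graph onto the lattice\<close>

text \<open>A framed vertex is the current position of a walk; \<open>m\<close> is the number of
  moves for which it is sure to stay in \<open>good\<close>.\<close>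

definition state :: "nat \<Rightarrow> 'a \<times> (int \<Rightarrow> 'a) \<Rightarrow> bool" where
  "state m x \<longleftrightarrow> frame (fst x) (snd x) \<and> nball m (fst x) \<subseteq> good"

text \<open>For a state of positive radius such a frame exists by \<open>frame_transport\<close> and
  is unique by \<open>frame_unique\<close>, so the choice is harmless.\<close>

definition move :: "int \<Rightarrow> 'a \<times> (int \<Rightarrow> 'a) \<Rightarrow> 'a \<times> (int \<Rightarrow> 'a)" where
  "move d x = (snd x d, SOME f'. frame (snd x d) f' \<and> f' (d + 3) = fst x \<and> f' (d + 2) = snd x (d + 1))"

lemma state_mono: "state n x \<Longrightarrow> m \<le> n \<Longrightarrow> state m x"
  unfolding state_def using nball_mono by blast

lemma move_state:
  assumes "state (Suc m) x"
  shows "state m (move d x)" "snd (move d x) (d + 3) = fst x" "snd (move d x) (d + 2) = snd x (d + 1)"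
    "snd (move d x) (d + 4) = snd x (d - 1)" "fst (move d x) = snd x d"
proof -
  obtain v f where x: "x = (v, f)" by force
  have f: "frame v f" and b: "nball (Suc m) v \<subseteq> good" using assms by (auto simp: state_def x)
  have adj: "adj v (f d)" using frameD(3)[OF f] .
  then have sub: "nball m (f d) \<subseteq> good" using nball_step b by blast
  then have "f d \<in> good" using nball_self by blast
  then obtain g where g: "frame (f d) g" "g (d + 3) = v" "g (d + 2) = f (d + 1)" "g (d + 4) = f (d - 1)"
    by (rule frame_transport[OF f])
  let ?f = "snd (move d x)"
  have s: "frame (f d) ?f \<and> ?f (d + 3) = v \<and> ?f (d + 2) = f (d + 1)"
    unfolding move_def x by simp (rule someI[of _ g], use g in auto)
  have "?f = g"
    by (rule frame_unique[of "f d", of _ _ "d + 2"]) (use g s in \<open>auto simp: add.assoc\<close>)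
  then show "state m (move d x)" "?f (d + 3) = fst x" "?f (d + 2) = snd x (d + 1)"
    "?f (d + 4) = snd x (d - 1)" "fst (move d x) = snd x d"
    using g sub by (simp_all add: state_def x) (simp_all add: move_def)
qed

lemma move_add_6:
  assumes "state m x" shows "move (d + 6) x = move d x"
proof -
  have f: "frame (fst x) (snd x)" using assms by (simp add: state_def)
  have p: "f (d + 9) = f (d + 3)" "f (d + 8) = f (d + 2)" if "frame u f" for u f
    using frameD(1)[OF that, of "d + 3"] frameD(1)[OF that, of "d + 2"] by (simp_all add: add.assoc)
  have "snd x (d + 6) = snd x d" "snd x (d + 7) = snd x (d + 1)"
    using frameD(1)[OF f, of d] frameD(1)[OF f, of "d + 1"] by (simp_all add: add.assoc)
  then show ?thesis unfolding move_def
    by (auto simp: add.assoc p cong: conj_cong)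
qed

lemma state_eqI:
  assumes "state m x" "state n y" "fst x = fst y" "snd x d = snd y d" "snd x (d + 1) = snd y (d + 1)"
  shows "x = y"
  using assms frame_unique[of "fst x" "snd x" "snd y" d] unfolding state_def by (auto simp: prod_eq_iff)

lemma move_opp:
  assumes "state (Suc (Suc m)) x" shows "move (d + 3) (move d x) = x"
proof -
  note a = move_state[OF assms, of d]
  note b = move_state[OF a(1), of "d + 3"]
  have f: "frame (fst x) (snd x)" using assms by (simp add: state_def)
  have p: "snd (move (d + 3) (move d x)) (e + 6) = snd (move (d + 3) (move d x)) e" for e
    using b(1) frameD(1) unfolding state_def by blast
  show ?thesis
  proof (rule state_eqI[OF b(1) assms, of d])
    show "fst (move (d + 3) (move d x)) = fst x" using a b by (simp add: add.assoc)
    show "snd (move (d + 3) (move d x)) d = snd x d" using a b(2) p[of d] by (simp add: add.assoc)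
    show "snd (move (d + 3) (move d x)) (d + 1) = snd x (d + 1)"
      using a b(4) p[of "d + 1"] by (simp add: algebra_simps)
  qed
qed

lemma move_triangle:
  assumes "state (Suc (Suc m)) x" shows "move (d + 2) (move d x) = move (d + 1) x"
proof -
  note a = move_state[OF assms, of d]
  note b = move_state[OF a(1), of "d + 2"]
  note c = move_state[OF assms, of "d + 1"]
  show ?thesis
  proof (rule state_eqI[OF b(1) c(1), of "d + 4"])
    show "fst (move (d + 2) (move d x)) = fst (move (d + 1) x)" using a b c by simp
    show "snd (move (d + 2) (move d x)) (d + 4) = snd (move (d + 1) x) (d + 4)"
      using a b(3) c(2) by (simp add: add.assoc)
    show "snd (move (d + 2) (move d x)) (d + 4 + 1) = snd (move (d + 1) x) (d + 4 + 1)"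
      using a b(2) c(4) by (simp add: add.assoc)
  qed
qed

lemma move_triangle':
  assumes "state (Suc (Suc m)) x" shows "move (d + 4) (move d x) = move (d + 5) x"
proof -
  note a = move_state[OF assms, of d]
  note b = move_state[OF a(1), of "d + 4"]
  note c = move_state[OF assms, of "d + 5"]
  have f: "frame (fst x) (snd x)" using assms by (simp add: state_def)
  have p: "snd x (d + 5) = snd x (d - 1)" "snd x (d + 6) = snd x d"
    using frameD(1)[OF f, of "d - 1"] frameD(1)[OF f, of d] by (simp_all add: algebra_simps)
  show ?thesis
  proof (rule state_eqI[OF b(1) c(1), of "d + 7"])
    show "fst (move (d + 4) (move d x)) = fst (move (d + 5) x)" using a b c p by simp
    show "snd (move (d + 4) (move d x)) (d + 7) = snd (move (d + 5) x) (d + 7)"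
      using a b(2) c(3) p by (simp add: add.assoc)
    show "snd (move (d + 4) (move d x)) (d + 7 + 1) = snd (move (d + 5) x) (d + 7 + 1)"
      using a b(4) c(2) p by (simp add: algebra_simps)
  qed
qed

text \<open>Both composites of the moves \<open>d\<close> and \<open>d + 2\<close> are the move \<open>d + 1\<close>; everything else follows from this.\<close>

lemma move_commute_2:
  assumes "state (Suc (Suc m)) x" shows "move (d + 2) (move d x) = move d (move (d + 2) x)"
proof -
  have "move d (move (d + 2) x) = move (d + 6) (move (d + 2) x)"
    using move_add_6[OF move_state(1)[OF assms]] by simp
  also have "\<dots> = move (d + 7) x" using move_triangle'[OF assms, of "d + 2"] by (simp add: add.assoc)
  also have "\<dots> = move (d + 1) x" using move_add_6[OF assms, of "d + 1"] by (simp add: add.assoc)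
  finally show ?thesis using move_triangle[OF assms] by simp
qed

text \<open>The move d + 1 is split into the moves \<open>d\<close> and d + 2, which
  commute.\<close>

lemma move_commute_1:
  assumes "state (Suc (Suc (Suc m))) x" shows "move (d + 1) (move d x) = move d (move (d + 1) x)"
proof -
  have x: "state (Suc (Suc m)) x" by (rule state_mono[OF assms]) simp
  have "move (d + 1) (move d x) = move (d + 2) (move d (move d x))"
    using move_triangle[OF move_state(1)[OF assms]] by simp
  also have "\<dots> = move d (move (d + 2) (move d x))"
    by (rule move_commute_2[OF move_state(1)[OF assms]])
  also have "\<dots> = move d (move (d + 1) x)" using move_triangle[OF x] by simp
  finally show ?thesis .
qed

definition moves :: "int \<Rightarrow> int \<Rightarrow> 'a \<times> (int \<Rightarrow> 'a) \<Rightarrow> 'a \<times> (int \<Rightarrow> 'a)" where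
  "moves d n x = (if n \<ge> 0 then (move d ^^ nat n) x else (move (d + 3) ^^ nat (- n)) x)"

lemma funpow_move_state: "state (m + n) x \<Longrightarrow> state m ((move d ^^ n) x)"
proof (induction n arbitrary: m)
  case (Suc n)
  then have "state (Suc m) ((move d ^^ n) x)" using Suc.IH[of "Suc m"] by simp
  then show ?case using move_state(1) by simp
qed simp

lemma moves_state: "state (m + nat \<bar>n\<bar>) x \<Longrightarrow> state m (moves d n x)"
  by (simp add: moves_def abs_if funpow_move_state split: if_splits)

lemma moves_Suc:
  assumes "state (m + nat \<bar>n\<bar> + 2) x" shows "move d (moves d n x) = moves d (n + 1) x"
proof (cases "n \<ge> 0")
  case True
  then show ?thesis by (simp add: moves_def nat_add_distrib)
next
  case False
  define k where "k = nat (- n - 1)"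
  have nk: "nat (- n) = Suc k" and n1: "nat (- (n + 1)) = k" using False by (auto simp: k_def)
  define y where "y = (move (d + 3) ^^ k) x"
  have y: "state 2 y" unfolding y_def
    by (rule funpow_move_state, rule state_mono[OF assms]) (use False in \<open>auto simp: k_def\<close>)
  have "moves d (n + 1) x = y"
    using False n1 by (cases "n = -1") (auto simp: moves_def y_def k_def)
  moreover have "moves d n x = move (d + 3) y" using False nk by (simp add: moves_def y_def)
  moreover have "move d (move (d + 3) y) = y"
    using move_opp[of 0 y "d + 3"] move_add_6[of 1 "move (d + 3) y" d] move_state(1)[of 1 y] y
    by (simp add: numeral_2_eq_2 add.assoc)
  ultimately show ?thesis by simp
qed

lemma funpow_move_commute:
  assumes "\<And>y. state 3 y \<Longrightarrow> move a (move d y) = move d (move a y)" "state (3 + n) x"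
  shows "move a ((move d ^^ n) x) = (move d ^^ n) (move a x)"
  using assms(2)
proof (induction n)
  case (Suc n)
  have "state 3 ((move d ^^ n) x)" by (rule funpow_move_state, rule state_mono[OF Suc.prems]) simp
  then have "move a ((move d ^^ Suc n) x) = move d (move a ((move d ^^ n) x))" using assms(1) by simp
  also have "\<dots> = (move d ^^ Suc n) (move a x)" using Suc.IH state_mono[OF Suc.prems] by simp
  finally show ?case .
qed simp

lemma move_0_moves_1:
  assumes "state (3 + nat \<bar>n\<bar>) x" shows "move 0 (moves 1 n x) = moves 1 n (move 0 x)"
proof -
  have "move 0 (move 1 y) = move 1 (move 0 y)" if "state 3 y" for y
    using move_commute_1[of 0 y 0] that by (simp add: numeral_3_eq_3)
  moreover have "move 0 (move 4 y) = move 4 (move 0 y)" if "state 3 y" for y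
  proof -
    have y: "state (Suc (Suc 1)) y" using that by (simp add: numeral_3_eq_3)
    show ?thesis
      using move_commute_2[OF y, of 4] move_add_6[OF y, of 0] move_add_6[OF move_state(1)[OF y], of 0 4] by simp
  qed
  ultimately show ?thesis
    using funpow_move_commute[of 0 1 "nat n" x] funpow_move_commute[of 0 4 "nat (- n)" x] assms
    by (simp add: moves_def abs_if split: if_splits)
qed

text \<open>A developing map: around each point of the lattice ball the star is carried to a frame
  in cyclic order. The values at distance N + 1 count too, as neighbours of the last layer.\<close>

definition dev :: "(int \<times> int \<Rightarrow> 'a) \<Rightarrow> int \<Rightarrow> bool" where
  "dev \<phi> N \<longleftrightarrow> (\<forall>p. hexnorm p \<le> N \<longrightarrow> frame (\<phi> p) (\<lambda>d. \<phi> (p + hdir d)))"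

text \<open>The point (i, j) is reached by \<open>i\<close> moves in direction 0 and then
  \<open>j\<close> moves in direction 1. Direction 1 is consistent by construction, direction 0
  because the moves commute, and the other four follow by reversal and by triangles. This takes
  about 2 N moves; the 10 is a reserve for the radii consumed by the commutation lemmas.\<close>

lemma dev_exists:
  assumes "v \<in> V" "nball (nat (2 * N) + 10) v \<subseteq> good"
  obtains \<phi> where "dev \<phi> N" "\<phi> 0 = v"
proof -
  have "v \<in> good" using assms(2) nball_self by blast
  then obtain f where f: "frame v f" using good_frame by blast
  define G where "G = (\<lambda>p. moves 1 (snd p) (moves 0 (fst p) (v, f)))"
  define \<phi> where "\<phi> = (\<lambda>p. fst (G p))"
  have st: "state (nat (2 * N) + 10) (v, f)" using f assms(2) by (simp add: state_def)
  have G_state: "state 6 (G p)" if "hexnorm p \<le> N + 2" for p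
  proof -
    have "\<bar>fst p\<bar> \<le> N + 2" "\<bar>snd p\<bar> \<le> N + 2" using that by (simp_all add: hexnorm_le_iff)
    then show ?thesis unfolding G_def
      by (intro moves_state state_mono[OF st]) linarith
  qed
  have row_state: "state (6 + nat \<bar>j\<bar>) (moves 0 i (v, f))" if "\<bar>i\<bar> \<le> N + 2" "\<bar>j\<bar> \<le> N + 2" for i j
    using that by (intro moves_state state_mono[OF st]) linarith
  have up: "move 1 (G (i, j)) = G (i, j + 1)" if "\<bar>i\<bar> \<le> N + 1" "\<bar>j\<bar> \<le> N + 1" for i j
    unfolding G_def fst_conv snd_conv
    by (rule moves_Suc[of 4], rule state_mono[OF row_state[of i j]]) (use that in auto)
  have right: "move 0 (G (i, j)) = G (i + 1, j)" if "\<bar>i\<bar> \<le> N + 1" "\<bar>j\<bar> \<le> N + 1" for i j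
  proof -
    have "move 0 (G (i, j)) = moves 1 j (move 0 (moves 0 i (v, f)))"
      unfolding G_def fst_conv snd_conv
      by (rule move_0_moves_1, rule state_mono[OF row_state[of i j]]) (use that in auto)
    also have "move 0 (moves 0 i (v, f)) = moves 0 (i + 1) (v, f)"
      by (rule moves_Suc[of 0], rule state_mono[OF st]) (use that in linarith)
    finally show ?thesis by (simp add: G_def)
  qed
  have step: "move d (G p) = G (p + hdir d)" if p: "hexnorm p \<le> N" and d: "d \<in> {0..5}" for p d
  proof -
    obtain i j where ij: "p = (i, j)" by force
    have b: "\<bar>i\<bar> \<le> N" "\<bar>j\<bar> \<le> N" "\<bar>i + j\<bar> \<le> N" using p by (simp_all add: ij hexnorm_le_iff)
    have s: "state (Suc (Suc 0)) (G (i + a, j + b))" if "a \<in> {-1..1}" "b \<in> {-1..1}" "a + b \<in> {-1..1}" for a b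
      by (rule state_mono[OF G_state]) (use that b in \<open>auto simp: hexnorm_le_iff\<close>)
    have left: "move 3 (G (i, j')) = G (i - 1, j')" if "j' \<in> {j, j + 1}" for j'
      using right[of "i - 1" j'] move_opp[OF s[of "-1" "j' - j"], of 0] b that by auto
    have down: "move 4 (G (i', j)) = G (i', j - 1)" if "i' \<in> {i, i + 1}" for i'
      using up[of i' "j - 1"] move_opp[OF s[of "i' - i" "-1"], of 1] b that by auto
    have s0: "state (Suc (Suc 0)) (G (i, j))" using s[of 0 0] by simp
    have "d = 0 \<or> d = 1 \<or> d = 2 \<or> d = 3 \<or> d = 4 \<or> d = 5" using d by auto
    then show ?thesis
    proof (elim disjE)
      assume "d = 2" then show ?thesis
        using move_triangle[OF s0, of 1] up[of i j] left[of "j + 1"] b by (simp add: ij)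
    next
      assume "d = 5" then show ?thesis
        using move_triangle'[OF s0, of 0] right[of i j] down[of "i + 1"] b by (simp add: ij)
    qed (use up[of i j] right[of i j] left[of j] down[of i] b in \<open>simp_all add: ij\<close>)
  qed
  have "dev \<phi> N" unfolding dev_def
  proof (intro allI impI)
    fix p assume p: "hexnorm p \<le> N"
    have fr: "frame (fst (G p)) (snd (G p))" using G_state[of p] p by (simp add: state_def)
    have s: "state (Suc 0) (G p)" by (rule state_mono[OF G_state]) (use p in auto)
    have "snd (G p) d = \<phi> (p + hdir d)" for d
    proof -
      have "snd (G p) (d mod 6) = fst (move (d mod 6) (G p))" using move_state(5)[OF s] by simp
      also have "\<dots> = \<phi> (p + hdir (d mod 6))" using step[OF p, of "d mod 6"] by (simp add: \<phi>_def)
      finally show ?thesis using frame_mod[OF fr] hdir_mod by metis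
    qed
    then have "snd (G p) = (\<lambda>d. \<phi> (p + hdir d))" by blast
    then show "frame (\<phi> p) (\<lambda>d. \<phi> (p + hdir d))" using fr by (simp add: \<phi>_def)
  qed
  moreover have "\<phi> 0 = v" by (simp add: \<phi>_def G_def moves_def)
  ultimately show ?thesis using that by blast
qed

lemma dev_shift:
  assumes "dev \<phi> N" "s = 1 \<or> s = -1" "hexnorm q \<le> m"
  shows "dev (\<lambda>p. \<phi> (q + hact s k p)) (N - m)"
  unfolding dev_def
proof (intro allI impI)
  fix p assume "hexnorm p \<le> N - m"
  then have "hexnorm (q + hact s k p) \<le> N"
    using hexnorm_add[of q "hact s k p"] assms(3) hexnorm_hact[OF assms(2)] by (smt (verit))
  then have "frame (\<phi> (q + hact s k p)) (\<lambda>d. \<phi> (q + hact s k p + hdir d))"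
    using assms(1) unfolding dev_def by blast
  from frame_relabel[OF this assms(2), of k]
  show "frame (\<phi> (q + hact s k p)) (\<lambda>d. \<phi> (q + hact s k (p + hdir d)))"
    by (simp add: hact_add hact_hdir[OF assms(2)] add.assoc)
qed

text \<open>Continuation along lattice paths: a star shares two consecutive directions with the star
  of a neighbour, so agreement spreads by \<open>frame_unique\<close>.\<close>

lemma dev_unique:
  assumes \<phi>: "dev \<phi> N" and \<psi>: "dev \<psi> N"
    and eq: "\<phi> 0 = \<psi> 0" "\<phi> (hdir 0) = \<psi> (hdir 0)" "\<phi> (hdir 1) = \<psi> (hdir 1)" and p: "hexnorm p \<le> N"
  shows "\<phi> p = \<psi> p" "\<phi> (p + hdir d) = \<psi> (p + hdir d)"
proof -
  define ag where "ag = (\<lambda>p. \<phi> p = \<psi> p \<and> (\<forall>d. \<phi> (p + hdir d) = \<psi> (p + hdir d)))"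
  have fr: "frame (\<phi> p) (\<lambda>d. \<phi> (p + hdir d))" "frame (\<psi> p) (\<lambda>d. \<psi> (p + hdir d))" if "hexnorm p \<le> N" for p
    using \<phi> \<psi> that unfolding dev_def by blast+
  have N: "hexnorm 0 \<le> N" using p hexnorm_nonneg[of p] by simp
  have ag0: "ag 0"
  proof -
    have "(\<lambda>d. \<phi> (0 + hdir d)) = (\<lambda>d. \<psi> (0 + hdir d))"
      by (rule frame_unique[OF fr(1)[OF N], of _ 0]) (use fr(2)[OF N] eq in \<open>simp_all del: hdir_simps\<close>)
    then show ?thesis using eq unfolding ag_def by metis
  qed
  have "ag p" using p
  proof (induction rule: hexball_induct)
    case zero show ?case by (rule ag0)
  next
    case (step q d)
    let ?u = "q + hdir d"
    have o: "?u + hdir (d + 3) = q" "?u + hdir (d + 2) = q + hdir (d + 1)"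
      by (simp_all add: hdir_opp hdir_rec)
    have u: "\<phi> ?u = \<psi> ?u" using step by (auto simp: ag_def)
    have "(\<lambda>e. \<phi> (?u + hdir e)) = (\<lambda>e. \<psi> (?u + hdir e))"
    proof (rule frame_unique[OF fr(1)])
      show "frame (\<phi> ?u) (\<lambda>e. \<psi> (?u + hdir e))" using fr(2)[of ?u] step u by simp
      show "\<phi> (?u + hdir (d + 2)) = \<psi> (?u + hdir (d + 2))" using step unfolding o ag_def by blast
      have "\<phi> (?u + hdir (d + 3)) = \<psi> (?u + hdir (d + 3))" using step unfolding o ag_def by blast
      then show "\<phi> (?u + hdir (d + 2 + 1)) = \<psi> (?u + hdir (d + 2 + 1))" by (simp add: add.assoc)
    qed (use step in auto)
    then show ?case using u unfolding ag_def by metis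
  qed
  then show "\<phi> p = \<psi> p" "\<phi> (p + hdir d) = \<psi> (p + hdir d)" unfolding ag_def by blast+
qed

text \<open>The frames at the common image differ by a dihedral relabelling, and by uniqueness the
  two developments differ by the corresponding lattice symmetry.\<close>

lemma dev_identification:
  assumes \<phi>: "dev \<phi> N" and pq: "\<phi> p = \<phi> q" "hexnorm p \<le> m" "hexnorm q \<le> m" "m \<le> N"
  obtains s k where "s = 1 \<or> s = -1" "0 \<le> k" "k < 6"
    "\<And>x. hexnorm x \<le> N - m \<Longrightarrow> \<phi> (p + x) = \<phi> (q + hact s k x)"
proof -
  have fr: "frame (\<phi> r) (\<lambda>d. \<phi> (r + hdir d))" if "hexnorm r \<le> m" for r
    using \<phi> that pq(4) unfolding dev_def by (meson order_trans)
  obtain s k where sk: "s = 1 \<or> s = -1" "0 \<le> k" "k < 6"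
    and eq: "(\<lambda>d. \<phi> (p + hdir d)) = (\<lambda>d. \<phi> (q + hdir (s * d + k)))"
    using frames_related[OF fr[OF pq(2)] fr[OF pq(3), folded pq(1)]] by blast
  have 1: "dev (\<lambda>x. \<phi> (p + x)) (N - m)" using dev_shift[OF \<phi> _ pq(2), of 1 0] by simp
  have 2: "dev (\<lambda>x. \<phi> (q + hact s k x)) (N - m)" by (rule dev_shift[OF \<phi> sk(1) pq(3)])
  have e: "\<phi> (p + hdir d) = \<phi> (q + hact s k (hdir d))" for d
    unfolding hact_hdir[OF sk(1)] using fun_cong[OF eq, of d] .
  have "\<phi> (p + x) = \<phi> (q + hact s k x)" if "hexnorm x \<le> N - m" for x
    by (rule dev_unique(1)[OF 1 2 _ e e that]) (simp add: pq(1))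
  then show ?thesis using that sk by blast
qed

text \<open>Closed stars are embedded: there are no loops, and a frame has six different
  values.\<close>

lemma dev_no_short:
  assumes \<phi>: "dev \<phi> N" and "hexnorm (p - q) \<le> 2" "p \<noteq> q" "hexnorm q + 1 \<le> N"
  shows "\<phi> p \<noteq> \<phi> q"
proof -
  obtain x y where x: "x = 0 \<or> x \<in> hexdirs" and y: "y = 0 \<or> y \<in> hexdirs" and xy: "p - q = x - y"
    using hexnorm_2_star[OF assms(2)] by metis
  define r where "r = q - y"
  have pr: "p = r + x" "q = r + y" "x \<noteq> y" using xy assms(3) by (auto simp: r_def algebra_simps)
  have "hexnorm y \<le> 1" using y by (auto elim: hexdirs_hdir)
  then have "hexnorm r \<le> N" using hexnorm_diff[of q y] assms(4) by (simp add: r_def)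
  then have fr: "frame (\<phi> r) (\<lambda>d. \<phi> (r + hdir d))" using \<phi> unfolding dev_def by blast
  have ne: "\<phi> (r + d) \<noteq> \<phi> r" if "d \<in> hexdirs" for d
    using that frameD(3)[OF fr] adj_irrefl by (metis hexdirs_hdir)
  have ne2: "\<phi> (r + d) \<noteq> \<phi> (r + e)" if "d \<in> hexdirs" "e \<in> hexdirs" "d \<noteq> e" for d e
  proof -
    obtain a b where ab: "d = hdir a" "e = hdir b" using \<open>d \<in> hexdirs\<close> \<open>e \<in> hexdirs\<close> by (metis hexdirs_hdir)
    have "(a - b) mod 6 \<noteq> 0"
    proof
      assume "(a - b) mod 6 = 0"
      then have "a mod 6 = b mod 6" by presburger
      then show False using \<open>d \<noteq> e\<close> ab hdir_mod by metis
    qed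
    then show ?thesis using frame_eq_iff[OF fr, of a b] by (simp add: ab)
  qed
  show ?thesis using x y pr ne[of x] ne[of y] ne2[of x y] by auto
qed

end

section \<open>Periods and symmetries of developing maps\<close>

lemma abs_idet_le: "\<bar>idet p q\<bar> \<le> 2 * (hexnorm p * hexnorm q)"
proof -
  have b: "\<bar>fst p\<bar> \<le> hexnorm p" "\<bar>snd p\<bar> \<le> hexnorm p" for p by (simp_all add: hexnorm_def)
  have "\<bar>fst p * snd q\<bar> \<le> hexnorm p * hexnorm q" "\<bar>snd p * fst q\<bar> \<le> hexnorm p * hexnorm q"
    unfolding abs_mult by (intro mult_mono b hexnorm_nonneg abs_ge_zero)+
  then show ?thesis unfolding idet_def by linarith
qed

lemma abs_div_le: fixes a D :: int assumes "D > 0" shows "\<bar>a div D\<bar> \<le> \<bar>a\<bar>"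
proof -
  have "a div D \<le> \<bar>a\<bar>" using assms
    by (smt (verit) int_div_less_self div_by_1 pos_imp_zdiv_neg_iff zdiv_mono2 zero_less_one)
  moreover have "- \<bar>a\<bar> \<le> a div D" using assms
    by (smt (verit) div_by_1 pos_imp_zdiv_neg_iff zdiv_mono2_neg zero_less_one)
  ultimately show ?thesis by linarith
qed

context hexmesh begin

lemma dev_in_V: assumes "dev \<phi> N" "hexnorm p \<le> N" shows "\<phi> p \<in> V"
proof -
  have "frame (\<phi> p) (\<lambda>d. \<phi> (p + hdir d))" using assms unfolding dev_def by blast
  then show ?thesis using frameD(3) adj_V by blast
qed

lemma dev_adj:
  assumes "dev \<phi> N" "hexnorm p \<le> N"
  shows "adj (\<phi> p) (\<phi> (p + hdir d))" "adj (\<phi> p) u \<Longrightarrow> \<exists>d. u = \<phi> (p + hdir d)"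
proof -
  have fr: "frame (\<phi> p) (\<lambda>d. \<phi> (p + hdir d))" using assms unfolding dev_def by blast
  show "adj (\<phi> p) (\<phi> (p + hdir d))" "adj (\<phi> p) u \<Longrightarrow> \<exists>d. u = \<phi> (p + hdir d)"
    using frameD(3)[OF fr, of d] frameD(4)[OF fr, of u] by auto
qed

lemma nball_dev:
  assumes "dev \<phi> N" "int r \<le> N"
  shows "nball r (\<phi> 0) \<subseteq> \<phi> ` {p. hexnorm p \<le> int r}"
  using assms(2)
proof (induction r)
  case 0 show ?case by (auto intro!: image_eqI[of _ _ 0])
next
  case (Suc r)
  show ?case
  proof
    fix u assume "u \<in> nball (Suc r) (\<phi> 0)"
    then consider "u \<in> nball r (\<phi> 0)" | w where "w \<in> nball r (\<phi> 0)" "adj w u" by auto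
    then show "u \<in> \<phi> ` {p. hexnorm p \<le> int (Suc r)}"
    proof cases
      case 1 then show ?thesis using Suc by fastforce
    next
      case 2
      then obtain p where p: "w = \<phi> p" "hexnorm p \<le> int r" using Suc by auto
      then obtain d where "u = \<phi> (p + hdir d)" using dev_adj(2)[OF assms(1), of p u] 2 Suc by auto
      then show ?thesis using p(2) hexnorm_add[of p "hdir d"] by (auto intro!: image_eqI[of _ _ "p + hdir d"])
    qed
  qed
qed

definition period :: "(int \<times> int \<Rightarrow> 'a) \<Rightarrow> int \<Rightarrow> int \<times> int \<Rightarrow> bool" where
  "period \<phi> M \<tau> \<longleftrightarrow> (\<forall>x. hexnorm x \<le> M \<longrightarrow> \<phi> (x + \<tau>) = \<phi> x)"

text \<open>For negative \<open>m\<close> the iteration starts at the translated point and leads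
  back to \<open>x\<close>; this accounts for the factor 2.\<close>

lemma period_iterate:
  assumes \<tau>: "period \<phi> M \<tau>" and x: "hexnorm x + 2 * \<bar>m\<bar> * hexnorm \<tau> \<le> M"
  shows "\<phi> (x + iscale m \<tau>) = \<phi> x"
proof -
  have nat: "\<phi> (x + iscale (int n) \<tau>) = \<phi> x" if "hexnorm x + int n * hexnorm \<tau> \<le> M" for n x
    using that
  proof (induction n)
    case (Suc n)
    have "hexnorm (x + iscale (int n) \<tau>) \<le> hexnorm x + int n * hexnorm \<tau>"
      using hexnorm_add[of x "iscale (int n) \<tau>"] by (simp add: hexnorm_iscale)
    moreover have le: "hexnorm x + int n * hexnorm \<tau> \<le> M"
      using Suc.prems hexnorm_nonneg[of \<tau>] by (simp add: algebra_simps)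
    ultimately have "\<phi> (x + iscale (int n) \<tau> + \<tau>) = \<phi> (x + iscale (int n) \<tau>)"
      using \<tau> unfolding period_def by (meson order_trans)
    moreover have "iscale (int (Suc n)) \<tau> = iscale (int n) \<tau> + \<tau>"
      using iscale_add_left[of "int n" 1 \<tau>] by (simp add: add.commute)
    ultimately show ?case using Suc.IH[OF le] by (simp add: add.assoc)
  qed simp
  show ?thesis
  proof (cases "m \<ge> 0")
    case True
    then obtain n where n: "m = int n" using nonneg_int_cases by blast
    then show ?thesis using nat[of x n] x hexnorm_nonneg[of \<tau>]
      by (simp add: mult.assoc) (smt (verit) mult_nonneg_nonneg of_nat_0_le_iff)
  next
    case False
    then obtain n where n: "m = - int n" by (metis nonneg_int_cases minus_minus linear neg_le_0_iff_le)
    have "hexnorm (x + iscale m \<tau>) \<le> hexnorm x + int n * hexnorm \<tau>"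
      using hexnorm_add[of x "iscale m \<tau>"] by (simp add: hexnorm_iscale n)
    then have "hexnorm (x + iscale m \<tau>) + int n * hexnorm \<tau> \<le> M" using x by (simp add: n)
    from nat[OF this] show ?thesis by (simp add: n add.assoc iscale_uminus_left)
  qed
qed

text \<open>Two independent short periods close the mesh up to a small torus.\<close>

lemma torus_bound:
  assumes \<phi>: "dev \<phi> N" and \<tau>: "period \<phi> M \<tau>1" "period \<phi> M \<tau>2" "idet \<tau>1 \<tau>2 \<noteq> 0"
    and K: "hexnorm \<tau>1 \<le> K" "hexnorm \<tau>2 \<le> K" and M: "(2 * K + 1) * (1 + 6 * K * K) \<le> M" and N: "2 * K \<le> N"
  shows "card V \<le> nat (4 * K + 1) ^ 2"
proof -
  have K0: "K \<ge> 0" using K(1) hexnorm_nonneg order_trans by blast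
  obtain \<sigma>1 \<sigma>2 where \<sigma>: "period \<phi> M \<sigma>1" "period \<phi> M \<sigma>2" "idet \<sigma>1 \<sigma>2 > 0" "hexnorm \<sigma>1 \<le> K" "hexnorm \<sigma>2 \<le> K"
  proof (cases "idet \<tau>1 \<tau>2 > 0")
    case True then show ?thesis using that \<tau> K by blast
  next
    case False
    then have "idet \<tau>2 \<tau>1 > 0" using \<tau>(3) unfolding idet_def by (simp add: mult.commute)
    then show ?thesis using that \<tau> K by blast
  qed
  define D where "D = idet \<sigma>1 \<sigma>2"
  have D: "D > 0" using \<sigma> by (simp add: D_def)
  have reduce: "\<exists>q'. hexnorm q' \<le> 2 * K \<and> \<phi> q = \<phi> q'" if q: "hexnorm q \<le> 2 * K + 1" for q
  proof -
    \<comment> \<open>By Cramer's rule \<open>q\<close> has the coordinates a / D and b / D with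
      respect to the two periods. Subtracting their integer parts leaves a point of the fundamental
      parallelogram, of norm at most 2 K. The number of subtracted periods, bounded by
      \<open>Z\<close>, is what makes the lower bound on \<open>M\<close> cubic in
      \<open>K\<close>.\<close>
    define a where "a = idet q \<sigma>2"
    define b where "b = idet \<sigma>1 q"
    define q1 where "q1 = q + iscale (- (a div D)) \<sigma>1"
    define q2 where "q2 = q1 + iscale (- (b div D)) \<sigma>2"
    define Z where "Z = 2 * ((2 * K + 1) * K)"
    have "\<bar>a\<bar> \<le> Z" "\<bar>b\<bar> \<le> Z"
      unfolding a_def b_def Z_def
      using abs_idet_le[of q \<sigma>2] abs_idet_le[of \<sigma>1 q] mult_mono[OF q \<sigma>(5)] mult_mono[OF \<sigma>(4) q] K0 hexnorm_nonneg
      by (auto simp: mult.commute)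
    then have ab: "\<bar>- (a div D)\<bar> \<le> Z" "\<bar>- (b div D)\<bar> \<le> Z" using abs_div_le[OF D, of a] abs_div_le[OF D, of b] by auto
    have ZK: "\<bar>- (a div D)\<bar> * hexnorm \<sigma>1 \<le> Z * K" "\<bar>- (b div D)\<bar> * hexnorm \<sigma>2 \<le> Z * K"
      using mult_mono[OF ab(1) \<sigma>(4)] mult_mono[OF ab(2) \<sigma>(5)] ab hexnorm_nonneg by auto
    have "M \<ge> 2 * K + 1 + 3 * (Z * K)" using M unfolding Z_def by (simp add: algebra_simps)
    moreover have "hexnorm q1 \<le> 2 * K + 1 + Z * K"
      using hexnorm_add[of q "iscale (- (a div D)) \<sigma>1"] q ZK(1) unfolding q1_def hexnorm_iscale by linarith
    moreover have "Z * K \<ge> 0" using K0 by (simp add: Z_def)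
    ultimately have "hexnorm q + 2 * \<bar>- (a div D)\<bar> * hexnorm \<sigma>1 \<le> M" "hexnorm q1 + 2 * \<bar>- (b div D)\<bar> * hexnorm \<sigma>2 \<le> M"
      using q ZK unfolding mult.assoc by linarith+
    then have "\<phi> q1 = \<phi> q" "\<phi> q2 = \<phi> q1" unfolding q1_def q2_def
      by (auto intro: period_iterate[OF \<sigma>(1)] period_iterate[OF \<sigma>(2)])
    moreover have "hexnorm q2 \<le> 2 * K"
    proof -
      have cr: "iscale D q = iscale a \<sigma>1 + iscale b \<sigma>2"
        unfolding D_def a_def b_def idet_def by (simp add: prod_eq_iff) algebra
      have am: "a = D * (a div D) + a mod D" and bm: "b = D * (b div D) + b mod D" by simp_all
      have "iscale D q2 = iscale (a - D * (a div D)) \<sigma>1 + iscale (b - D * (b div D)) \<sigma>2"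
        using cr unfolding q2_def q1_def prod_eq_iff by (simp add: algebra_simps)
      also have "\<dots> = iscale (a mod D) \<sigma>1 + iscale (b mod D) \<sigma>2" by (simp add: minus_mult_div_eq_mod)
      finally have "hexnorm (iscale D q2) \<le> \<bar>a mod D\<bar> * hexnorm \<sigma>1 + \<bar>b mod D\<bar> * hexnorm \<sigma>2"
        using hexnorm_add hexnorm_iscale by metis
      also have "\<dots> \<le> D * K + D * K"
        using D \<sigma>(4,5) hexnorm_nonneg pos_mod_bound[OF D] pos_mod_sign[OF D]
        by (intro add_mono mult_mono) (auto simp: less_imp_le)
      finally have "D * hexnorm q2 \<le> D * (2 * K)" using D by (simp add: hexnorm_iscale)
      then show ?thesis using D by (simp add: mult_le_cancel_left)
    qed
    ultimately show ?thesis by metis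
  qed
  have "\<phi> ` {p. hexnorm p \<le> 2 * K} = V"
  proof (rule connected_V)
    show "\<phi> ` {p. hexnorm p \<le> 2 * K} \<subseteq> V" using dev_in_V[OF \<phi>] N by auto
    have "hexnorm 0 \<le> 2 * K" using K0 by simp
    then show "\<phi> ` {p. hexnorm p \<le> 2 * K} \<noteq> {}" by blast
    fix x y assume "x \<in> \<phi> ` {p. hexnorm p \<le> 2 * K}" and adj: "adj x y"
    then obtain p where p: "x = \<phi> p" "hexnorm p \<le> 2 * K" by blast
    then obtain d where d: "y = \<phi> (p + hdir d)" using dev_adj(2)[OF \<phi>, of p y] adj N by auto
    have "hexnorm (p + hdir d) \<le> 2 * K + 1" using hexnorm_add[of p "hdir d"] p(2) by simp
    then show "y \<in> \<phi> ` {p. hexnorm p \<le> 2 * K}" using reduce d by blast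
  qed
  then have "card V \<le> card {p. hexnorm p \<le> 2 * K}"
    using card_image_le[OF hexball_finite_card(1)] K0 by (metis mult_nonneg_nonneg zero_le_numeral)
  also have "\<dots> \<le> nat (4 * K + 1) ^ 2" using hexball_finite_card(2)[of "2 * K"] K0 by simp
  finally show ?thesis .
qed

definition dsym :: "(int \<times> int \<Rightarrow> 'a) \<Rightarrow> int \<Rightarrow> int \<Rightarrow> int \<Rightarrow> int \<times> int \<Rightarrow> bool" where
  "dsym \<phi> M s k c \<longleftrightarrow> (\<forall>x. hexnorm x \<le> M \<longrightarrow> \<phi> x = \<phi> (c + hact s k x))"

text \<open>A symmetry of finite order would almost fix the lattice point nearest to the centre of an
  orbit, so that two points of one star would be identified.\<close>

lemma dsym_infinite_order:
  assumes \<phi>: "dev \<phi> N" and sym: "dsym \<phi> M s k c" and s: "s = 1 \<or> s = -1" and k: "0 \<le> k" "k < 6" "(s, k) \<noteq> (1, 0)"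
    and c: "hexnorm c \<le> K" and M: "6 * K + 10 \<le> M" "M \<le> N"
  obtains U where "U \<noteq> 0" "hact s k U = U" "hexnorm U \<le> 6 * K" "period \<phi> (M - 6 * K) U"
proof -
  define g where "g = (\<lambda>x. c + hact s k x)"
  have K0: "K \<ge> 0" using c hexnorm_nonneg order_trans by blast
  have g_norm: "hexnorm (g x) \<le> K + hexnorm x" for x
    using hexnorm_add[of c "hact s k x"] c hexnorm_hact[OF s] unfolding g_def by (smt (verit))
  have g_phi: "\<phi> (g x) = \<phi> x" if "hexnorm x \<le> M" for x using sym that unfolding dsym_def g_def by metis
  have g_add: "g (x + y) = g x + hact s k y" for x y by (simp add: g_def hact_add add.assoc)
  define H where "H = hact s k"
  \<comment> \<open>The exponent of the dihedral group of order 12 is 6, so the sixth power of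
    \<open>g\<close> is a translation, namely by \<open>U\<close>.\<close>
  have H6: "H (H (H (H (H (H x))))) = x" for x
  proof -
    have 2: "H (H x) = hact 1 (s * k + k) x" for x unfolding H_def using s by (auto simp: hact_hact)
    have "H (H (H (H (H (H x))))) = hact 1 (3 * (s * k + k)) x"
      unfolding 2 by (simp add: hact_hact algebra_simps)
    also have "\<dots> = x" using hact_mod[of 1 "3 * (s * k + k)" x] s by auto
    finally show ?thesis .
  qed
  define a2 where "a2 = g c" define a3 where "a3 = g a2" define a4 where "a4 = g a3"
  define a5 where "a5 = g a4" define U where "U = g a5"
  note as = a2_def a3_def a4_def a5_def U_def
  have n2: "hexnorm a2 \<le> 2 * K" using g_norm[of c] c by (simp add: a2_def)
  have n3: "hexnorm a3 \<le> 3 * K" using g_norm[of a2] n2 by (simp add: a3_def)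
  have n4: "hexnorm a4 \<le> 4 * K" using g_norm[of a3] n3 by (simp add: a4_def)
  have n5: "hexnorm a5 \<le> 5 * K" using g_norm[of a4] n4 by (simp add: a5_def)
  have n6: "hexnorm U \<le> 6 * K" using g_norm[of a5] n5 by (simp add: U_def)
  have g6: "g (g (g (g (g (g x))))) = U + x" for x
  proof -
    have 1: "g x = c + H x" by (simp add: g_def H_def)
    have 2: "g (g x) = a2 + H (H x)" unfolding 1 a2_def by (simp add: g_add H_def)
    have 3: "g (g (g x)) = a3 + H (H (H x))" unfolding 2 a3_def by (simp add: g_add H_def)
    have 4: "g (g (g (g x))) = a4 + H (H (H (H x)))" unfolding 3 a4_def by (simp add: g_add H_def)
    have 5: "g (g (g (g (g x)))) = a5 + H (H (H (H (H x))))" unfolding 4 a5_def by (simp add: g_add H_def)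
    have 6: "g (g (g (g (g (g x))))) = U + H (H (H (H (H (H x)))))" unfolding 5 U_def by (simp add: g_add H_def)
    then show ?thesis unfolding H6 .
  qed
  have fixU: "hact s k U = U"
  proof -
    have "U + c = g (g (g (g (g (g c)))))" by (simp add: g6)
    also have "\<dots> = g U" by (simp add: as)
    finally show ?thesis by (simp add: g_def algebra_simps)
  qed
  have per: "period \<phi> (M - 6 * K) U" unfolding period_def
  proof (intro allI impI)
    fix x assume x: "hexnorm x \<le> M - 6 * K"
    have m1: "hexnorm (g x) \<le> M - 5 * K" using g_norm[of x] x by simp
    have m2: "hexnorm (g (g x)) \<le> M - 4 * K" using g_norm[of "g x"] m1 by simp
    have m3: "hexnorm (g (g (g x))) \<le> M - 3 * K" using g_norm[of "g (g x)"] m2 by simp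
    have m4: "hexnorm (g (g (g (g x)))) \<le> M - 2 * K" using g_norm[of "g (g (g x))"] m3 by simp
    have m5: "hexnorm (g (g (g (g (g x))))) \<le> M - K" using g_norm[of "g (g (g (g x)))"] m4 by simp
    have "\<phi> (g (g (g (g (g (g x)))))) = \<phi> x"
      using g_phi[of x] g_phi[of "g x"] g_phi[of "g (g x)"] g_phi[of "g (g (g x))"]
        g_phi[of "g (g (g (g x)))"] g_phi[of "g (g (g (g (g x))))"] x m1 m2 m3 m4 m5 K0 by simp
    then show "\<phi> (x + U) = \<phi> x" unfolding g6 by (simp add: add.commute)
  qed
  have "U \<noteq> 0"
  proof
    assume U0: "U = 0"
    \<comment> \<open>The sum of the orbit of 0; if \<open>U\<close> is 0, then \<open>g\<close>
      fixes the centroid S / 6.\<close>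
    define S where "S = c + a2 + a3 + a4 + a5"
    have h: "hact s k x = g x - c" for x by (simp add: g_def)
    have "hact s k S = (a2 - c) + (a3 - c) + (a4 - c) + (a5 - c) + (U - c)"
      unfolding S_def hact_add h as by simp
    then have hS: "hact s k S = S - iscale 6 c"
      unfolding U0 by (simp add: S_def prod_eq_iff)
    \<comment> \<open>This is S / 6 rounded coordinatewise. Then \<open>r\<close> has norm at most
      6, and 6 (g p - p) is the difference of the image of \<open>r\<close> and \<open>r\<close>, so
      \<open>g\<close> moves \<open>p\<close> by at most 2.\<close>
    define p where "p = ((fst S + 3) div 6, (snd S + 3) div 6)"
    define r where "r = iscale 6 p - S"
    have r1: "fst r = 3 - (fst S + 3) mod 6" "snd r = 3 - (snd S + 3) mod 6"
      by (simp_all add: r_def p_def minus_mod_eq_mult_div[symmetric])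
    have r6: "hexnorm r \<le> 6"
      using pos_mod_bound[of 6 "fst S + 3"] pos_mod_sign[of 6 "fst S + 3"]
        pos_mod_bound[of 6 "snd S + 3"] pos_mod_sign[of 6 "snd S + 3"]
      unfolding hexnorm_le_iff r1 abs_le_iff by auto
    have Sp: "S = iscale 6 p - r" by (simp add: r_def)
    have "iscale 6 (hact s k p) - hact s k r = iscale 6 p - r - iscale 6 c"
      using hS unfolding Sp hact_diff hact_iscale .
    then have "iscale 6 (g p - p) = hact s k r - r"
      by (simp add: g_def prod_eq_iff algebra_simps)
    then have "6 * hexnorm (g p - p) \<le> 12"
      using hexnorm_diff[of "hact s k r" r] r6 hexnorm_hact[OF s, of k r] hexnorm_iscale[of 6 "g p - p"] by simp
    then have short: "hexnorm (g p - p) \<le> 2" by simp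
    have "hexnorm S \<le> 15 * K"
      using hexnorm_add[of "c + a2 + a3 + a4" a5] hexnorm_add[of "c + a2 + a3" a4] hexnorm_add[of "c + a2" a3]
        hexnorm_add[of c a2] c n2 n3 n4 n5 unfolding S_def by linarith
    then have "6 * hexnorm p \<le> 15 * K + 6"
      using hexnorm_add[of S r] r6 hexnorm_iscale[of 6 p] by (simp add: r_def)
    then have p: "hexnorm p + 1 \<le> M" using M K0 by linarith
    have "g p = p"
    proof (rule ccontr)
      assume "g p \<noteq> p"
      then have "\<phi> (g p) \<noteq> \<phi> p" using dev_no_short[OF \<phi> short] p M by simp
      then show False using g_phi[of p] p by simp
    qed
    \<comment> \<open>Now \<open>g\<close> fixes \<open>p\<close>, so its linear part permutes the
      star of \<open>p\<close> without changing the images, and the frame at \<open>p\<close> forces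
      it to be the identity.\<close>
    then have eq: "\<phi> (p + hdir d) = \<phi> (p + hdir (s * d + k))" for d
      using g_phi[of "p + hdir d"] p hexnorm_add[of p "hdir d"] by (simp add: g_add hact_hdir[OF s])
    have fr: "frame (\<phi> p) (\<lambda>d. \<phi> (p + hdir d))" 
      using \<phi> order_trans[of "hexnorm p" M N] p M unfolding dev_def by (simp del: split_paired_All)
    have "(d - (s * d + k)) mod 6 = 0" for d using frame_eq_iff[OF fr, of d "s * d + k"] eq[of d] by simp
    note m = this
    have "k = 0" using m[of 0] k by presburger
    then have "s = 1" using m[of 1] s by auto
    then show False using k(3) \<open>k = 0\<close> by simp
  qed
  then show ?thesis using that fixU n6 per by blast
qed

lemma card_neighbours_good:
  assumes "v \<in> good" shows "finite {u. adj v u}" "card {u. adj v u} \<le> 6"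
proof -
  obtain f where f: "frame v f" using good_frame[OF assms] by blast
  have "{u. adj v u} \<subseteq> f ` {0..<6}"
  proof
    fix u assume "u \<in> {u. adj v u}"
    then obtain d where "u = f d" using frameD(4)[OF f] by blast
    then have "u = f (d mod 6)" using frame_mod[OF f] by simp
    then show "u \<in> f ` {0..<6}" by auto
  qed
  then show "finite {u. adj v u}" "card {u. adj v u} \<le> 6"
    using surj_card_le[of "{0..<6}" "{u. adj v u}" f] by (auto dest: finite_subset)
qed

text \<open>If the same symmetry is seen from two points of a line transverse to its axis, then the graph also has a
  translational symmetry along the line; together with the translation of the previous lemma, this makes it
  a torus.\<close>

lemma symmetric_vertices_bound:
  fixes L :: nat and M N K :: int
  assumes dv: "\<And>x. x \<in> X \<Longrightarrow> x \<in> V \<and> dev (dv x) N \<and> dv x 0 = x"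
    and X: "\<And>x. x \<in> X \<Longrightarrow> \<forall>p. hexnorm p \<le> N \<longrightarrow> dv x p \<in> good"
    and sym: "\<And>x. x \<in> X \<Longrightarrow> dsym (dv x) M s k c" and s: "s = 1 \<or> s = -1" and k: "0 \<le> k" "k < 6" "(s, k) \<noteq> (1, 0)"
    and c: "hexnorm c \<le> K" and d: "d = 0 \<or> d = 1" "hact s k (hdir d) \<noteq> hdir d"
    and MN: "M + 2 * int L + K \<le> N" and M: "(2 * (2 * int L + 6 * K) + 1) * (1 + 6 * (2 * int L + 6 * K) * (2 * int L + 6 * K)) + 12 * K + 4 * int L + 10 \<le> M"
    and big: "card V > nat (4 * (2 * int L + 6 * K) + 1) ^ 2"
  shows "card X * L \<le> 36 * card V"
proof -
  define e where "e = hdir d"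
  define pos where "pos = (\<lambda>i :: nat. iscale (int i) e)"
  \<comment> \<open>A point with two consecutive neighbours determines the development around it.
    Once \<open>F\<close> is injective, the pairs (x, i) are bounded by the number of such triples,
    at most 36 for each good vertex.\<close>
  define F where "F = (\<lambda>(x, i). (dv x (pos i), dv x (pos i + hdir 0), dv x (pos i + hdir 1)))"
  have K0: "K \<ge> 0" using c hexnorm_nonneg order_trans by blast
  have pos_norm: "hexnorm (pos i) = int i" for i by (simp add: pos_def e_def hexnorm_iscale)
  have XV: "X \<subseteq> V" using dv by blast
  then have finX: "finite X" using finV finite_subset by blast
  have Y0: "(2 * (2 * int L + 6 * K) + 1) * (1 + 6 * (2 * int L + 6 * K) * (2 * int L + 6 * K)) \<ge> 0"
    using K0 by (intro mult_nonneg_nonneg add_nonneg_nonneg) auto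
  then have M0: "12 * K + 4 * int L + 10 \<le> M" using M by linarith
  have eqI: "x = y \<and> i = j"
    if x: "x \<in> X" "y \<in> X" and ij: "i \<le> j" "j < L" and eq: "F (x, i) = F (y, j)" for x y i j
  proof -
    have dx: "dev (\<lambda>z. dv x (pos i + z)) (N - L)" "dev (\<lambda>z. dv y (pos j + z)) (N - L)"
      using dev_shift[of "dv x" N 1 "pos i" L 0] dev_shift[of "dv y" N 1 "pos j" L 0] dv x ij pos_norm by auto
    have same: "dv x (pos i + z) = dv y (pos j + z)" if "hexnorm z \<le> N - L" for z
      by (rule dev_unique(1)[OF dx _ _ _ that]) (use eq in \<open>simp_all add: F_def\<close>)
    define t where "t = j - i"
    have pt: "pos j - pos i = pos t" using ij by (simp add: pos_def t_def prod_eq_iff of_nat_diff algebra_simps)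
    have xy: "dv x z = dv y (pos t + z)" if "hexnorm z \<le> N - 2 * int L" for z
    proof -
      have "hexnorm (z - pos i) \<le> N - L" using hexnorm_diff[of z "pos i"] pos_norm[of i] that ij by simp
      from same[OF this] show ?thesis by (simp add: pt[symmetric] algebra_simps)
    qed
    have "t = 0"
    proof (rule ccontr)
      assume "t \<noteq> 0"
      \<comment> \<open>Agreement of \<open>F\<close> at positions \<open>t\<close> apart means that
        \<open>dv x\<close> is \<open>dv y\<close> shifted by \<open>pos t\<close>. Both have the
        same symmetry, so \<open>dv y\<close> has it and also its conjugate by the shift; the two
        differ by the translation \<tau>.\<close>
      define \<tau> where "\<tau> = iscale (int t) (e - hact s k e)"
      define P where "P = M - 6 * K - 2 * int L"
      have PM: "P \<le> M - 6 * K" by (simp add: P_def)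
      have n\<tau>: "hexnorm \<tau> \<le> 2 * int L"
      proof -
        have "hexnorm (e - hact s k e) \<le> 2" using hexnorm_diff[of e "hact s k e"] hexnorm_hact[OF s] by (simp add: e_def)
        then have "int t * hexnorm (e - hact s k e) \<le> int t * 2" by (intro mult_left_mono) auto
        then show ?thesis using ij by (simp add: \<tau>_def hexnorm_iscale t_def)
      qed
      have \<tau>_eq: "\<tau> = pos t - hact s k (pos t)"
        by (simp add: \<tau>_def pos_def hact_iscale prod_eq_iff algebra_simps)
      have "period (dv y) P \<tau>" unfolding period_def
      proof (intro allI impI)
        fix w assume w: "hexnorm w \<le> P"
        obtain z where z: "hact s k z = w - c - hact s k (pos t)" "hexnorm z = hexnorm (w - c - hact s k (pos t))"
          using hact_surj[OF s] by metis
        have nt: "hexnorm (pos t) \<le> L" using pos_norm[of t] ij by (simp add: t_def)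
        have nz: "hexnorm z \<le> M - 5 * K - L"
          using z(2) hexnorm_diff[of "w - c" "hact s k (pos t)"] hexnorm_diff[of w c] hexnorm_hact[OF s, of k "pos t"] nt w c
          unfolding P_def by linarith
        have nz2: "hexnorm (pos t + z) \<le> M" using hexnorm_add[of "pos t" z] nz nt K0 by linarith
        have nz3: "hexnorm (c + hact s k z) \<le> M - 4 * K - L"
          using hexnorm_add[of c "hact s k z"] hexnorm_hact[OF s, of k z] nz c by linarith
        have "dv y (pos t + z) = dv x z" using xy[of z] nz MN K0 by simp
        also have "\<dots> = dv x (c + hact s k z)" 
          using sym[OF x(1)] order_trans[of "hexnorm z" _ M, OF nz] K0 unfolding dsym_def by (simp del: split_paired_All)
        also have "\<dots> = dv y (pos t + (c + hact s k z))" using xy[of "c + hact s k z"] nz3 MN K0 by simp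
        finally have 1: "dv y (pos t + z) = dv y (pos t + (c + hact s k z))" .
        have "dv y (pos t + z) = dv y (c + hact s k (pos t + z))"
          using sym[OF x(2)] nz2 unfolding dsym_def by blast
        then show "dv y (w + \<tau>) = dv y w" using 1 z(1) unfolding hact_add \<tau>_eq by (simp add: algebra_simps)
      qed
      moreover obtain U where U: "U \<noteq> 0" "hact s k U = U" "hexnorm U \<le> 6 * K" "period (dv y) (M - 6 * K) U"
        using dsym_infinite_order[of "dv y" N M s k c K] dv[OF x(2)] sym[OF x(2)] s k c M0 MN K0 by force
      moreover have "period (dv y) P U" using U(4) PM unfolding period_def by (meson order_trans)
      moreover have "idet \<tau> U \<noteq> 0"
      proof -
        have "idet \<tau> U = int t * idet (hdir d - hact s k (hdir d)) U"
          unfolding \<tau>_def e_def idet_def by (simp add: algebra_simps)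
        then show ?thesis using idet_hact_fixed[OF s k U(2,1) d] \<open>t \<noteq> 0\<close> by simp
      qed
      ultimately have "card V \<le> nat (4 * (2 * int L + 6 * K) + 1) ^ 2"
        using dv[OF x(2)] n\<tau> K0 M MN M0 by (intro torus_bound[of "dv y" N P \<tau> U]) (auto simp: P_def)
      then show False using big by simp
    qed
    then have "i = j" using ij by (simp add: t_def)
    moreover have "x = y" using xy[of 0] \<open>t = 0\<close> dv[OF x(1)] dv[OF x(2)] MN M0 K0 by (simp add: pos_def)
    ultimately show ?thesis by simp
  qed
  have "inj_on F (X \<times> {..<L})"
  proof (rule inj_onI)
    fix a b assume ab: "a \<in> X \<times> {..<L}" "b \<in> X \<times> {..<L}" "F a = F b"
    obtain x i y j where xy: "a = (x, i)" "b = (y, j)" by (cases a, cases b)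
    then show "a = b"
      using eqI[of x y i j] eqI[of y x j i] ab by (cases "i \<le> j") auto
  qed
  moreover have "F ` (X \<times> {..<L}) \<subseteq> Sigma good (\<lambda>v. {u. adj v u} \<times> {u. adj v u})"
  proof
    fix w assume "w \<in> F ` (X \<times> {..<L})"
    then obtain x i where x: "x \<in> X" "i < L" "w = F (x, i)" by auto
    have n: "hexnorm (pos i) \<le> N" using pos_norm[of i] x MN M0 K0 by simp
    show "w \<in> Sigma good (\<lambda>v. {u. adj v u} \<times> {u. adj v u})"
      using X[OF x(1)] dev_adj(1)[OF _ n, of "dv x"] dv[OF x(1)] n x(3) unfolding F_def by (simp del: hdir_simps split_paired_All)
  qed
  moreover have fin: "finite (Sigma good (\<lambda>v. {u. adj v u} \<times> {u. adj v u}))"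
    using finite_subset[OF good_V finV] card_neighbours_good(1) by (intro finite_SigmaI finite_cartesian_product)
  ultimately have "card (X \<times> {..<L}) \<le> card (Sigma good (\<lambda>v. {u. adj v u} \<times> {u. adj v u}))"
    by (rule card_inj_on_le)
  also have "\<dots> = (\<Sum>v\<in>good. card {u. adj v u} * card {u. adj v u})"
    using finite_subset[OF good_V finV] card_neighbours_good(1) by (simp add: card_SigmaI card_cartesian_product)
  also have "\<dots> \<le> (\<Sum>v\<in>good. 6 * 6)"
    using card_neighbours_good(2) by (intro sum_mono mult_mono) auto
  also have "\<dots> \<le> 36 * card V" using card_mono[OF finV good_V] by simp
  finally show ?thesis by (simp add: card_cartesian_product)
qed

end

text \<open>Parallel integer vectors satisfy b c = a w with integers \<open>a\<close> and
  \<open>b\<close>, \<open>b\<close> nonzero; dividing \<open>a\<close> by |b| with remainder makes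
  \<open>c\<close> shorter than \<open>w\<close>.\<close>

lemma euclid_parallel:
  assumes "w \<noteq> 0" "idet c w = 0"
  obtains m where "\<bar>m\<bar> \<le> hexnorm c" "hexnorm (c - iscale m w) < hexnorm w"
proof -
  have le: "\<bar>fst p\<bar> \<le> hexnorm p" "\<bar>snd p\<bar> \<le> hexnorm p" for p by (simp_all add: hexnorm_def)
  have w: "hexnorm w > 0" using assms(1) hexnorm_nonneg[of w] hexnorm_eq_0[of w] by linarith
  have main: "\<exists>m. \<bar>m\<bar> \<le> hexnorm c \<and> hexnorm (c - iscale m w) < hexnorm w"
    if b: "b \<noteq> 0" "\<bar>a\<bar> \<le> hexnorm c" and par: "iscale b c = iscale a w" for a b
  proof -
    define m where "m = sgn b * (a div \<bar>b\<bar>)"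
    have bm: "b * m = \<bar>b\<bar> * (a div \<bar>b\<bar>)" by (simp add: m_def abs_sgn mult.assoc)
    have "\<bar>m\<bar> \<le> \<bar>a\<bar>" using b abs_div_le[of "\<bar>b\<bar>" a] by (simp add: m_def abs_mult)
    moreover have "iscale b (c - iscale m w) = iscale (a mod \<bar>b\<bar>) w"
    proof -
      have "a - b * m = a mod \<bar>b\<bar>" unfolding bm by (simp add: minus_mult_div_eq_mod)
      moreover have "iscale b (c - iscale m w) = iscale (a - b * m) w"
        using par by (simp add: prod_eq_iff algebra_simps)
      ultimately show ?thesis by simp
    qed
    then have "\<bar>b\<bar> * hexnorm (c - iscale m w) = (a mod \<bar>b\<bar>) * hexnorm w"
      using hexnorm_iscale b by (metis abs_of_nonneg abs_mod_less mod_by_0 pos_mod_sign zero_less_abs_iff)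
    then have "\<bar>b\<bar> * hexnorm (c - iscale m w) < \<bar>b\<bar> * hexnorm w"
      using w b pos_mod_bound[of "\<bar>b\<bar>" a] by simp
    ultimately show ?thesis using b by (intro exI[of _ m]) (simp add: mult_less_cancel_left)
  qed
  have "iscale (fst w) c = iscale (fst c) w" "iscale (snd w) c = iscale (snd c) w"
    using assms(2) by (simp_all add: idet_def prod_eq_iff mult.commute)
  moreover have "fst w \<noteq> 0 \<or> snd w \<noteq> 0" using assms(1) by (auto simp: prod_eq_iff)
  ultimately show ?thesis using main le that by blast
qed

context hexmesh begin

lemma dev_nball:
  assumes "dev \<phi> N" "hexnorm p \<le> N"
  shows "\<phi> p \<in> nball (nat (hexnorm p)) (\<phi> 0)"
  using assms(2)
proof (induction "nat (hexnorm p)" arbitrary: p)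
  case 0
  then have "p = 0" using hexnorm_nonneg[of p] hexnorm_eq_0[of p] by linarith
  then show ?case by simp
next
  case (Suc n)
  then have "p \<noteq> 0" by auto
  then obtain d where d: "hexnorm (p - hdir d) = hexnorm p - 1" by (rule hexnorm_step)
  have "\<phi> (p - hdir d) \<in> nball (nat (hexnorm (p - hdir d))) (\<phi> 0)" using Suc d by (intro Suc.hyps(1)) auto
  moreover have "nat (hexnorm (p - hdir d)) = n" using Suc.hyps(2) d by simp
  ultimately have "\<phi> (p - hdir d) \<in> nball n (\<phi> 0)" by simp
  moreover have "adj (\<phi> (p - hdir d)) (\<phi> p)"
    using dev_adj(1)[OF assms(1), of "p - hdir d" d] d Suc.prems by simp
  ultimately show ?case using Suc.hyps(2)[symmetric] by auto
qed

text \<open>A symmetry with nontrivial linear part and short translation part. By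
  \<open>dsym_infinite_order\<close> it has infinite order on large balls, so it is a glide
  reflection.\<close>

definition exceptional :: "(int \<times> int \<Rightarrow> 'a) \<Rightarrow> int \<Rightarrow> int \<Rightarrow> bool" where
  "exceptional \<phi> M K \<longleftrightarrow> (\<exists>s k c. (s = 1 \<or> s = -1) \<and> 0 \<le> k \<and> k < 6 \<and> (s, k) \<noteq> (1, 0) \<and>
     hexnorm c \<le> K \<and> dsym \<phi> M s k c)"

text \<open>A sum over all types of symmetry: 12 linear parts, the translation parts in the ball of
  radius \<open>K\<close>, and a basis direction that the linear part moves. This gives the factor
  24.\<close>

lemma exceptional_bound:
  fixes L :: nat and M N K :: int
  assumes dv: "\<And>x. x \<in> X \<Longrightarrow> x \<in> V \<and> dev (dv x) N \<and> dv x 0 = x"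
    and X: "\<And>x. x \<in> X \<Longrightarrow> \<forall>p. hexnorm p \<le> N \<longrightarrow> dv x p \<in> good"
    and exc: "\<And>x. x \<in> X \<Longrightarrow> exceptional (dv x) M K" and K: "K \<ge> 0"
    and MN: "M + 2 * int L + K \<le> N"
    and M: "(2 * (2 * int L + 6 * K) + 1) * (1 + 6 * (2 * int L + 6 * K) * (2 * int L + 6 * K)) + 12 * K + 4 * int L + 10 \<le> M"
    and big: "card V > nat (4 * (2 * int L + 6 * K) + 1) ^ 2"
  shows "card X * L \<le> 24 * nat (2 * K + 1) ^ 2 * (36 * card V)"
proof -
  define T where "T = {1, -1 :: int} \<times> {0..5 :: int} \<times> {c. hexnorm c \<le> K} \<times> {0, 1 :: int}"
  define Xs where "Xs = (\<lambda>(s, k, c, d). {x\<in>X. (s, k) \<noteq> (1, 0) \<and> hact s k (hdir d) \<noteq> hdir d \<and> dsym (dv x) M s k c})"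
  have finT: "finite T" unfolding T_def using hexball_finite_card(1)[OF K] by simp
  have finX: "finite X" using dv finV finite_subset by (metis subsetI)
  have cT: "card T \<le> 24 * nat (2 * K + 1) ^ 2"
    unfolding T_def using hexball_finite_card(2)[OF K] by (simp add: card_cartesian_product)
  have "X \<subseteq> (\<Union>\<theta>\<in>T. Xs \<theta>)"
  proof
    fix x assume x: "x \<in> X"
    then obtain s k c where sk: "s = 1 \<or> s = -1" "0 \<le> k" "k < 6" "(s, k) \<noteq> (1, 0)" "hexnorm c \<le> K" "dsym (dv x) M s k c"
      using exc unfolding exceptional_def by blast
    obtain d where d: "d = 0 \<or> d = 1" "hact s k (hdir d) \<noteq> hdir d" by (rule hact_moves_basis[OF sk(1-4)])
    have "(s, k, c, d) \<in> T" using sk d by (auto simp: T_def)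
    moreover have "x \<in> Xs (s, k, c, d)" unfolding Xs_def using x sk d by simp
    ultimately show "x \<in> (\<Union>\<theta>\<in>T. Xs \<theta>)" by blast
  qed
  then have "card X \<le> card (\<Union>\<theta>\<in>T. Xs \<theta>)"
    using finT finX by (intro card_mono) (auto simp: Xs_def)
  also have "\<dots> \<le> (\<Sum>\<theta>\<in>T. card (Xs \<theta>))" by (rule card_UN_le[OF finT])
  finally have "card X * L \<le> (\<Sum>\<theta>\<in>T. card (Xs \<theta>)) * L" by simp
  also have "\<dots> = (\<Sum>\<theta>\<in>T. card (Xs \<theta>) * L)" by (simp add: sum_distrib_right)
  also have "\<dots> \<le> (\<Sum>\<theta>\<in>T. 36 * card V)"
  proof (rule sum_mono)
    fix \<theta> assume \<theta>: "\<theta> \<in> T"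
    obtain s k c d where skcd: "\<theta> = (s, k, c, d)" by (cases \<theta>)
    have t: "s = 1 \<or> s = -1" "0 \<le> k" "k < 6" "hexnorm c \<le> K" "d = 0 \<or> d = 1"
      using \<theta> by (auto simp: skcd T_def)
    show "card (Xs \<theta>) * L \<le> 36 * card V"
    proof (cases "(s, k) \<noteq> (1, 0) \<and> hact s k (hdir d) \<noteq> hdir d")
      case False
      then have "Xs \<theta> = {}" unfolding skcd Xs_def by auto
      then show ?thesis by simp
    next
      case True
      show ?thesis
      proof (rule symmetric_vertices_bound[of "Xs \<theta>" dv N M s k c K d L])
        show "x \<in> V \<and> dev (dv x) N \<and> dv x 0 = x" "\<forall>p. hexnorm p \<le> N \<longrightarrow> dv x p \<in> good" "dsym (dv x) M s k c"
          if "x \<in> Xs \<theta>" for x using that dv X unfolding Xs_def skcd by auto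
      qed (use True t MN M big in auto)
    qed
  qed
  also have "\<dots> = card T * (36 * card V)" by simp
  also have "\<dots> \<le> 24 * nat (2 * K + 1) ^ 2 * (36 * card V)" using cT by (rule mult_right_mono) simp
  finally show ?thesis .
qed

text \<open>Without exceptional symmetries all identifications are translations; those inside the
  ball of radius R + 1 have length at most \<open>K\<close>, the diameter. Independent ones are
  excluded by \<open>torus_bound\<close>, and division with remainder makes each a multiple of a
  shortest one.\<close>

lemma unexceptional_period:
  fixes K M N :: int and R :: nat
  assumes \<phi>: "dev \<phi> N" and exc: "\<not> exceptional \<phi> M K" and K: "K = 2 * (int R + 1)" and MN: "M + 2 * K \<le> N"
    and M: "(2 * K + 1) * (1 + 6 * K * K) \<le> M" and big: "card V > nat (4 * K + 1) ^ 2"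
  obtains w where "hexnorm w \<ge> 3"
    "\<And>p q. hexnorm p \<le> int R + 1 \<Longrightarrow> hexnorm q \<le> int R + 1 \<Longrightarrow> \<phi> p = \<phi> q \<Longrightarrow> \<exists>m. q = p + iscale m w"
proof -
  have K2: "K \<ge> 2" using K by simp
  have KM: "6 * (K * K) + 2 * K + 1 \<le> M"
  proof -
    have "K * (K * K) \<ge> 0" using K2 by simp
    then show ?thesis using M by (simp add: algebra_simps)
  qed
  have KK: "K * K \<ge> 0" by simp
  have M1: "2 * K + 1 \<le> M" "2 * (K * K) + K \<le> M" using KM KK K2 by linarith+
  have per: "period \<phi> M c" if c: "hexnorm c \<le> K" "\<phi> c = \<phi> 0" for c
  proof -
    obtain s k where sk: "s = 1 \<or> s = -1" "0 \<le> k" "k < 6"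
      and eq: "\<And>x. hexnorm x \<le> N - K \<Longrightarrow> \<phi> (0 + x) = \<phi> (c + hact s k x)"
      by (rule dev_identification[OF \<phi>, of 0 c K]) (use c MN M1 K2 in auto)
    have "dsym \<phi> M s k c" unfolding dsym_def using eq MN K2 by (simp del: split_paired_All)
    then have "(s, k) = (1, 0)" using exc sk c(1) unfolding exceptional_def by blast
    then show ?thesis using eq MN K2 unfolding period_def by (simp add: add.commute del: split_paired_All)
  qed
  have ident: "hexnorm (q - p) \<le> K \<and> \<phi> (q - p) = \<phi> 0"
    if pq: "hexnorm p \<le> int R + 1" "hexnorm q \<le> int R + 1" "\<phi> p = \<phi> q" for p q
  proof -
    obtain s k where sk: "s = 1 \<or> s = -1" "0 \<le> k" "k < 6"
      and eq: "\<And>x. hexnorm x \<le> N - (int R + 1) \<Longrightarrow> \<phi> (p + x) = \<phi> (q + hact s k x)"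
      by (rule dev_identification[OF \<phi> pq(3,1,2)]) (use MN M1 K2 K in auto)
    define c where "c = q - hact s k p"
    have c: "hexnorm c \<le> K" using hexnorm_diff[of q "hact s k p"] hexnorm_hact[OF sk(1), of k p] pq K by (simp add: c_def)
    have eq2: "\<phi> y = \<phi> (c + hact s k y)" if "hexnorm y \<le> M" for y
    proof -
      have "hexnorm (y - p) \<le> N - (int R + 1)" using hexnorm_diff[of y p] that pq MN K by simp
      from eq[OF this] show ?thesis by (simp add: c_def hact_diff algebra_simps)
    qed
    then have "dsym \<phi> M s k c" unfolding dsym_def by blast
    then have "(s, k) = (1, 0)" using exc sk c unfolding exceptional_def by blast
    then show ?thesis using c eq2[of 0] M1 K2 by (simp add: c_def)
  qed
  define Per where "Per = {c. hexnorm c \<le> K \<and> \<phi> c = \<phi> 0 \<and> c \<noteq> 0}"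
  show ?thesis
  proof (cases "Per = {}")
    case True
    \<comment> \<open>The development is injective on the ball, so any vector of norm at least 3
      will do.\<close>
    show ?thesis
    proof (rule that[of "(7, 0)"])
      show "hexnorm (7, 0) \<ge> 3" by (simp add: hexnorm_def)
      fix p q assume "hexnorm p \<le> int R + 1" "hexnorm q \<le> int R + 1" "\<phi> p = \<phi> q"
      then have "q - p = 0" using ident[of p q] True unfolding Per_def by blast
      then show "\<exists>m. q = p + iscale m (7, 0)" by (intro exI[of _ 0]) simp
    qed
  next
    case False
    then obtain w where w: "w \<in> Per" and min: "\<And>c. c \<in> Per \<Longrightarrow> nat (hexnorm w) \<le> nat (hexnorm c)"
      using ex_has_least_nat[of "\<lambda>c. c \<in> Per" _ "\<lambda>c. nat (hexnorm c)"] by blast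
    have wK: "hexnorm w \<le> K" "\<phi> w = \<phi> 0" "w \<noteq> 0" using w by (auto simp: Per_def)
    show ?thesis
    proof (rule that[of w])
      show "hexnorm w \<ge> 3"
      proof (rule ccontr)
        assume "\<not> hexnorm w \<ge> 3"
        then have "\<phi> w \<noteq> \<phi> 0" using dev_no_short[OF \<phi>, of w 0] wK MN M1 K2 by simp
        then show False using wK by simp
      qed
      fix p q assume pq: "hexnorm p \<le> int R + 1" "hexnorm q \<le> int R + 1" "\<phi> p = \<phi> q"
      define c where "c = q - p"
      have c: "hexnorm c \<le> K" "\<phi> c = \<phi> 0" using ident[OF pq] by (simp_all add: c_def)
      have par: "idet c w = 0"
      proof (rule ccontr)
        assume "idet c w \<noteq> 0"
        then have "card V \<le> nat (4 * K + 1) ^ 2"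
          using torus_bound[OF \<phi> per[OF c] per[OF wK(1,2)] _ c(1) wK(1) M] MN M1 K2 by simp
        then show False using big by simp
      qed
      obtain m where m: "\<bar>m\<bar> \<le> hexnorm c" "hexnorm (c - iscale m w) < hexnorm w"
        by (rule euclid_parallel[OF wK(3) par])
      have mw: "\<bar>m\<bar> * hexnorm w \<le> K * K"
        using m(1) c(1) wK(1) K2 by (intro mult_mono) (auto simp: hexnorm_nonneg)
      have "\<phi> (iscale (- m) w) = \<phi> 0"
        using period_iterate[OF per[OF wK(1,2)], of 0 "- m"] mw M1 K2 by (simp add: mult.assoc)
      moreover have "\<phi> (iscale (- m) w + c) = \<phi> (iscale (- m) w)"
        using per[OF c] mw M1 K2 hexnorm_iscale[of "- m" w] unfolding period_def by (simp del: split_paired_All)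
      ultimately have "\<phi> (c - iscale m w) = \<phi> 0" by (simp add: iscale_uminus_left)
      moreover have "hexnorm (c - iscale m w) \<le> K" using m(2) wK(1) by simp
      moreover have "c - iscale m w \<notin> Per" using min[of "c - iscale m w"] m(2) hexnorm_nonneg[of "c - iscale m w"] by fastforce
      ultimately have "c - iscale m w = 0" unfolding Per_def by blast
      then show "\<exists>m. q = p + iscale m w" by (intro exI[of _ m]) (simp add: c_def algebra_simps)
    qed
  qed
qed

text \<open>The counterpart of \<open>sixth_family\<close> for a set of vertices. The members may
  extend beyond \<open>A\<close>; this is repaired when \<open>A\<close> is cut out.\<close>

definition sixth_dominated :: "'a set \<Rightarrow> bool" where
  "sixth_dominated A \<longleftrightarrow> (\<exists>(I :: (int \<times> int) set) D. finite I \<and> I \<noteq> {} \<and>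
     (\<forall>i\<in>I. \<forall>u\<in>A. u \<in> D i \<or> (\<exists>w\<in>D i. adj w u)) \<and> (\<forall>u. 6 * card {i\<in>I. u \<in> D i} \<le> card I))"

lemma unexceptional_dominated:
  fixes K M N :: int and R :: nat
  assumes \<phi>: "dev \<phi> N" and exc: "\<not> exceptional \<phi> M K" and K: "K = 2 * (int R + 1)" and MN: "M + 2 * K \<le> N"
    and M: "(2 * K + 1) * (1 + 6 * K * K) \<le> M" and big: "card V > nat (4 * K + 1) ^ 2"
  shows "sixth_dominated (nball R (\<phi> 0))"
proof -
  obtain w where w: "hexnorm w \<ge> 3"
    and ident: "\<And>p q. hexnorm p \<le> int R + 1 \<Longrightarrow> hexnorm q \<le> int R + 1 \<Longrightarrow> \<phi> p = \<phi> q \<Longrightarrow> \<exists>m. q = p + iscale m w"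
    by (rule unexceptional_period[OF assms]) (rule that)
  have M0: "0 \<le> M" using M K by (smt (verit) mult_nonneg_nonneg of_nat_0_le_iff)
  then have RN: "int R + 1 \<le> N" using MN K by simp
  obtain I :: "(int \<times> int) set" and pat where I: "finite I" "I \<noteq> {}"
    and dom: "\<forall>i\<in>I. \<forall>p. \<exists>q \<in> pat i. q = p \<or> q - p \<in> hexdirs"
    and inv: "\<forall>i\<in>I. \<forall>p. p + w \<in> pat i \<longleftrightarrow> p \<in> pat i"
    and cnt: "\<forall>p. 6 * card {i\<in>I. p \<in> pat i} \<le> card I"
    using sixth_family[OF w] unfolding sixth_family_def by blast
  have inv': "p + iscale m w \<in> pat i \<longleftrightarrow> p \<in> pat i" if "i \<in> I" for i p m
  proof (induction m rule: int_induct[of _ 0])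
    case (step1 m)
    have "p + iscale (m + 1) w = (p + iscale m w) + w" by (simp add: iscale_add_left add.assoc)
    then show ?case using step1 inv that by metis
  next
    case (step2 m)
    have "(p + iscale (m - 1) w) + w = p + iscale m w" using iscale_add_left[of "m - 1" 1 w] by (simp add: add.assoc)
    then show ?case using step2 inv that by metis
  qed simp
  \<comment> \<open>Radius R + 1 leaves room for a neighbour that dominates a point at distance
    \<open>R\<close>.\<close>
  define D where "D = (\<lambda>i. \<phi> ` (pat i \<inter> {p. hexnorm p \<le> int R + 1}))"
  show ?thesis unfolding sixth_dominated_def
  proof (intro exI[of _ I] exI[of _ D] conjI ballI allI)
    fix i u assume i: "i \<in> I" and "u \<in> nball R (\<phi> 0)"
    then obtain p where p: "u = \<phi> p" "hexnorm p \<le> int R" using nball_dev[OF \<phi>, of R] RN by auto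
    obtain q where q: "q \<in> pat i" "q = p \<or> q - p \<in> hexdirs" using dom i by blast
    show "u \<in> D i \<or> (\<exists>w\<in>D i. adj w u)"
    proof (cases "q = p")
      case True then show ?thesis using p q by (auto simp: D_def)
    next
      case False
      then obtain d where d: "q = p + hdir d" using q(2) by (metis hexdirs_hdir add_diff_cancel_left' diff_add_cancel add.commute)
      have "hexnorm q \<le> int R + 1" using hexnorm_add[of p "hdir d"] p(2) d by simp
      then have "\<phi> q \<in> D i" using q(1) by (auto simp: D_def)
      moreover have "adj (\<phi> q) u" using dev_adj(1)[OF \<phi>, of p d] p d RN adj_sym by simp
      ultimately show ?thesis by blast
    qed
  next
    fix u
    show "6 * card {i\<in>I. u \<in> D i} \<le> card I"
    proof (cases "\<exists>p. hexnorm p \<le> int R + 1 \<and> u = \<phi> p")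
      case True
      then obtain p where p: "hexnorm p \<le> int R + 1" "u = \<phi> p" by blast
      \<comment> \<open>All preimages of \<open>u\<close> in the ball differ by multiples of
        \<open>w\<close>, under which the patterns are invariant, so \<open>u\<close> inherits the
        frequency of any one of them.\<close>
      have "{i\<in>I. u \<in> D i} \<subseteq> {i\<in>I. p \<in> pat i}"
      proof
        fix i assume "i \<in> {i\<in>I. u \<in> D i}"
        then obtain q where q: "i \<in> I" "q \<in> pat i" "hexnorm q \<le> int R + 1" "\<phi> p = \<phi> q" using p by (auto simp: D_def)
        then obtain m where "q = p + iscale m w" using ident p by blast
        then show "i \<in> {i\<in>I. p \<in> pat i}" using inv' q by simp
      qed
      then have "card {i\<in>I. u \<in> D i} \<le> card {i\<in>I. p \<in> pat i}" using I by (intro card_mono) auto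
      then show ?thesis using cnt by (meson mult_le_mono2 order_trans)
    next
      case False
      then have "{i\<in>I. u \<in> D i} = {}" by (auto simp: D_def)
      then show ?thesis by (simp only: card.empty mult_0_right zero_le)
    qed
  qed (use I in auto)
qed

end

section \<open>Ball growing and the assembly of a dominating set\<close>

context hexmesh begin

text \<open>Balls of the subgraph induced on \<open>X\<close>, which will be the part not yet cut
  off.\<close>

fun xball :: "'a set \<Rightarrow> nat \<Rightarrow> 'a \<Rightarrow> 'a set" where
  "xball X 0 v = {v}"
| "xball X (Suc n) v = xball X n v \<union> {u\<in>X. \<exists>w\<in>xball X n v. adj w u}"

lemma xball_subset: "v \<in> X \<Longrightarrow> xball X n v \<subseteq> X"
  by (induction n) auto

lemma xball_nball: "xball X n v \<subseteq> nball n v"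
  by (induction n) auto

lemma sixth_dominated_subset: "sixth_dominated A \<Longrightarrow> B \<subseteq> A \<Longrightarrow> sixth_dominated B"
  unfolding sixth_dominated_def by (meson subsetD)

text \<open>Double counting of the pairs (i, u) with \<open>u\<close> in \<open>D i\<close>: on
  average a member meets \<open>P\<close> in at most a sixth of its vertices.\<close>

lemma sixth_dominated_choice:
  assumes "sixth_dominated P" "finite P"
  obtains D where "\<And>u. u \<in> P \<Longrightarrow> u \<in> D \<or> (\<exists>w\<in>D. adj w u)" "6 * card (D \<inter> P) \<le> card P"
proof -
  obtain I :: "(int \<times> int) set" and D where I: "finite I" "I \<noteq> {}"
    and dom: "\<forall>i\<in>I. \<forall>u\<in>P. u \<in> D i \<or> (\<exists>w\<in>D i. adj w u)" and cnt: "\<forall>u. 6 * card {i\<in>I. u \<in> D i} \<le> card I"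
    using assms(1) unfolding sixth_dominated_def by blast
  have "\<exists>i\<in>I. 6 * card (D i \<inter> P) \<le> card P"
  proof (rule ccontr)
    assume "\<not> (\<exists>i\<in>I. 6 * card (D i \<inter> P) \<le> card P)"
    then have less: "\<And>i. i \<in> I \<Longrightarrow> card P < 6 * card (D i \<inter> P)" by (meson not_le_imp_less)
    have "card I * card P = (\<Sum>i\<in>I. card P)" by simp
    also have "\<dots> < (\<Sum>i\<in>I. 6 * card (D i \<inter> P))" using I less by (intro sum_strict_mono) auto
    also have "\<dots> = 6 * (\<Sum>i\<in>I. \<Sum>u\<in>P. if u \<in> D i then 1 else 0)"
    proof -
      have "card (D i \<inter> P) = (\<Sum>u\<in>P. if u \<in> D i then 1 else 0)" for i
        using sum.inter_filter[OF assms(2), of "\<lambda>_. 1::nat" "\<lambda>u. u \<in> D i"]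
        by (simp add: Int_def conj_commute)
      then show ?thesis by (simp add: sum_distrib_left)
    qed
    also have "\<dots> = 6 * (\<Sum>u\<in>P. \<Sum>i\<in>I. if u \<in> D i then 1 else 0)" by (subst sum.swap) simp
    also have "\<dots> = (\<Sum>u\<in>P. 6 * card {i\<in>I. u \<in> D i})"
    proof -
      have "card {i\<in>I. u \<in> D i} = (\<Sum>i\<in>I. if u \<in> D i then 1 else 0)" for u
        using sum.inter_filter[OF I(1), of "\<lambda>_. 1::nat" "\<lambda>i. u \<in> D i"] by (simp only: card_eq_sum)
      then show ?thesis by (simp only: sum_distrib_left)
    qed
    also have "\<dots> \<le> (\<Sum>u\<in>P. card I)" using cnt by (intro sum_mono) blast
    also have "\<dots> = card I * card P" by simp
    finally show False by simp
  qed
  then show ?thesis using that dom by blast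
qed

text \<open>Ball growing: a ball of the remaining graph whose next sphere is relatively small is dominated
  by one member of its family, and the sphere itself is added to the dominating set.\<close>

lemma greedy_domination:
  fixes \<delta> :: real
  assumes \<delta>: "\<delta> > 0"
    and growth: "\<And>v. v \<in> X0 \<Longrightarrow> real (card (nball R v)) < (1 + \<delta>) ^ R"
    and fam: "\<And>v. v \<in> X0 \<Longrightarrow> sixth_dominated (nball R v)"
    and X0: "X0 \<subseteq> V" and X: "X \<subseteq> X0" and Y: "\<And>x u. x \<in> X \<Longrightarrow> adj x u \<Longrightarrow> u \<in> X \<union> Y"
  shows "\<exists>D\<subseteq>X. real (card D) \<le> (1 / 6 + \<delta>) * real (card X) \<and> (\<forall>x\<in>X. x \<in> D \<or> (\<exists>w\<in>D \<union> Y. adj w x))"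
proof -
  have "finite X" using X X0 finV finite_subset by (meson order_trans)
  then show ?thesis using X Y
  proof (induction X arbitrary: Y rule: finite_psubset_induct)
    case (psubset X)
    show ?case
    proof (cases "X = {}")
      case True then show ?thesis by auto
    next
      case False
      then obtain v where v: "v \<in> X" by blast
      have v0: "v \<in> X0" using v psubset.prems by blast
      define B where "B = (\<lambda>r. xball X r v)"
      have BX: "B r \<subseteq> X" for r unfolding B_def by (rule xball_subset[OF v])
      have finB: "finite (B r)" for r using BX psubset.hyps finite_subset by blast
      have B_nball: "B R \<subseteq> nball R v" unfolding B_def by (rule xball_nball)
      have fin_nball: "finite (nball R v)" using nball_V[of v R] v0 X0 finV finite_subset by blast
      \<comment> \<open>Otherwise each step enlarges the ball by a factor above 1 + \<delta>,
        against the growth bound at radius \<open>R\<close>.\<close>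
      have "\<exists>r<R. real (card (B (Suc r))) \<le> (1 + \<delta>) * real (card (B r))"
      proof (rule ccontr)
        assume "\<not> ?thesis"
        then have gr: "real (card (B (Suc r))) > (1 + \<delta>) * real (card (B r))" if "r < R" for r using that by auto
        have "(1 + \<delta>) ^ r \<le> real (card (B r))" if "r \<le> R" for r
          using that
        proof (induction r)
          case 0 show ?case by (simp add: B_def)
        next
          case (Suc r)
          have "(1 + \<delta>) ^ Suc r \<le> (1 + \<delta>) * real (card (B r))" using Suc \<delta> by simp
          then show ?case using gr[of r] Suc.prems by simp
        qed
        from this[of R] have "(1 + \<delta>) ^ R \<le> real (card (B R))" by simp
        also have "\<dots> \<le> real (card (nball R v))" using card_mono[OF fin_nball B_nball] by simp
        finally show False using growth[OF v0] by simp
      qed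
      then obtain r where r: "r < R" "real (card (B (Suc r))) \<le> (1 + \<delta>) * real (card (B r))" by blast
      define P where "P = B r"
      define Q where "Q = B (Suc r)"
      have PQ: "P \<subseteq> Q" and Q: "Q = P \<union> {u\<in>X. \<exists>w\<in>P. adj w u}" by (auto simp: P_def Q_def B_def)
      have vP: "v \<in> P"
      proof -
        have "v \<in> xball X n v" for n by (induction n) auto
        then show ?thesis by (simp add: P_def B_def)
      qed
      have QX: "Q \<subseteq> X" "P \<subseteq> X" "finite Q" "finite P" using BX finB by (auto simp: P_def Q_def)
      have "P \<subseteq> nball R v" using xball_nball[of X r v] nball_mono[of r R v] r(1) unfolding P_def B_def by auto
      then have "sixth_dominated P" using fam[OF v0] sixth_dominated_subset by blast
      then obtain D0 where D0: "\<And>u. u \<in> P \<Longrightarrow> u \<in> D0 \<or> (\<exists>w\<in>D0. adj w u)" "6 * card (D0 \<inter> P) \<le> card P"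
        using sixth_dominated_choice QX by metis
      have "X - Q \<subset> X" using vP PQ QX by blast
      moreover have "X - Q \<subseteq> X0" using psubset.prems by blast
      moreover have "u \<in> (X - Q) \<union> (Y \<union> (Q - P))" if "x \<in> X - Q" "adj x u" for x u
      proof -
        have "u \<in> X \<union> Y" using psubset.prems(2) that by blast
        moreover have "u \<notin> P" using that adj_sym Q by blast
        ultimately show ?thesis by blast
      qed
      ultimately obtain D1 where D1: "D1 \<subseteq> X - Q" "real (card D1) \<le> (1 / 6 + \<delta>) * real (card (X - Q))"
        "\<forall>x\<in>X - Q. x \<in> D1 \<or> (\<exists>w\<in>D1 \<union> (Y \<union> (Q - P)). adj w x)"
        using psubset.IH[of "X - Q" "Y \<union> (Q - P)"] by blast
      define D where "D = D1 \<union> (Q - P) \<union> (D0 \<inter> P)"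
      have "card D \<le> card D1 + card (Q - P) + card (D0 \<inter> P)"
        unfolding D_def by (meson add_le_mono card_Un_le order_refl order_trans)
      moreover have "real (card (Q - P)) \<le> \<delta> * real (card P)"
        using r(2) card_Diff_subset[OF QX(4) PQ] card_mono[OF QX(3) PQ] unfolding P_def[symmetric] Q_def[symmetric]
        by (simp add: of_nat_diff algebra_simps)
      moreover have "real (card (D0 \<inter> P)) \<le> real (card P) / 6" using D0(2) by simp
      ultimately have "real (card D) \<le> (1 / 6 + \<delta>) * real (card (X - Q)) + (1 / 6 + \<delta>) * real (card P)"
        using D1(2) by (simp add: algebra_simps)
      also have "\<dots> \<le> (1 / 6 + \<delta>) * real (card (X - Q)) + (1 / 6 + \<delta>) * real (card Q)"
        using \<delta> card_mono[OF QX(3) PQ] by (intro add_left_mono mult_left_mono) auto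
      also have "\<dots> = (1 / 6 + \<delta>) * real (card X)"
        using card_Diff_subset[OF QX(3,1)] card_mono[OF psubset.hyps QX(1)]
        by (simp add: of_nat_diff algebra_simps flip: distrib_left)
      finally have cD: "real (card D) \<le> (1 / 6 + \<delta>) * real (card X)" .
      have "x \<in> D \<or> (\<exists>w\<in>D \<union> Y. adj w x)" if x: "x \<in> X" for x
      proof -
        consider "x \<in> P" | "x \<in> Q - P" | "x \<in> X - Q" using x by blast
        then show ?thesis
        proof cases
          case 1
          then consider "x \<in> D0" | w where "w \<in> D0" "adj w x" using D0(1) by blast
          then show ?thesis
          proof cases
            case 1 then show ?thesis using \<open>x \<in> P\<close> by (auto simp: D_def)
          next
            case 2
            then have "w \<in> X \<union> Y" using psubset.prems(2) x adj_sym by blast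
            moreover have "w \<in> Q" if "w \<in> X" using that 2 \<open>x \<in> P\<close> adj_sym Q by blast
            ultimately show ?thesis using 2 unfolding D_def by blast
          qed
        next
          case 2 then show ?thesis by (auto simp: D_def)
        next
          case 3 then show ?thesis using D1(3) unfolding D_def by blast
        qed
      qed
      moreover have "D \<subseteq> X" using D1(1) QX by (auto simp: D_def)
      ultimately show ?thesis using cD by blast
    qed
  qed
qed

lemma card_nball_le:
  assumes "v \<in> V" "\<And>v. v \<in> V \<Longrightarrow> card {u. adj v u} \<le> \<Delta>"
  shows "card (nball n v) \<le> (\<Delta> + 1) ^ n"
proof (induction n)
  case (Suc n)
  have nV: "nball n v \<subseteq> V" by (rule nball_V[OF assms(1)])
  then have fin: "finite (nball n v)" using finV finite_subset by blast
  have finu: "finite {u. adj w u}" for w using adj_V finV by (metis (mono_tags, lifting) finite_subset mem_Collect_eq subsetI)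
  have "nball (Suc n) v \<subseteq> nball n v \<union> (\<Union>w\<in>nball n v. {u. adj w u})" by auto
  then have "card (nball (Suc n) v) \<le> card (nball n v \<union> (\<Union>w\<in>nball n v. {u. adj w u}))"
    using fin finu by (intro card_mono) auto
  also have "\<dots> \<le> card (nball n v) + (\<Sum>w\<in>nball n v. card {u. adj w u})"
    using card_Un_le[of "nball n v" "\<Union>w\<in>nball n v. {u. adj w u}"] card_UN_le[OF fin, of "\<lambda>w. {u. adj w u}"]
    by linarith
  also have "\<dots> \<le> card (nball n v) + (\<Sum>w\<in>nball n v. \<Delta>)"
    using assms(2) nV by (intro add_left_mono sum_mono) auto
  also have "\<dots> = (\<Delta> + 1) * card (nball n v)" by (simp add: algebra_simps)
  also have "\<dots> \<le> (\<Delta> + 1) * (\<Delta> + 1) ^ n" using Suc by (rule mult_left_mono) simp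
  finally show ?case by simp
qed simp

end

text \<open>Vertices far from bad ones and not exceptional are dominated greedily; all others are
  put into the dominating set, and there are at most \<delta> n plus a constant of them. Each
  constant depends only on those defined before it.\<close>

theorem hexmesh_domination:
  fixes \<epsilon> :: real and t \<Delta> :: nat
  assumes "\<epsilon> > 0"
  shows "\<exists>c :: real. \<forall>(V :: 'a set) adj tri good. hexmesh V adj tri good \<and> card (V - good) \<le> t \<and>
     (\<forall>v\<in>V. card {u. adj v u} \<le> \<Delta>) \<longrightarrow>
     (\<exists>D\<subseteq>V. (\<forall>v\<in>V. v \<in> D \<or> (\<exists>u\<in>D. adj u v)) \<and> real (card D) \<le> real (card V) * (1 / 6 + \<epsilon>) + c)"
proof -
  define \<delta> where "\<delta> = \<epsilon> / 2"
  have \<delta>: "\<delta> > 0" using assms by (simp add: \<delta>_def)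
  \<comment> \<open>The quadratic growth of lattice balls stays below (1 + \<delta>) ^ R for some
    \<open>R\<close>.\<close>
  have "eventually (\<lambda>R::nat. (2 * real R + 1) ^ 2 < (1 + \<delta>) ^ R) at_top" using \<delta> by real_asymp
  then obtain R :: nat where R: "(2 * real R + 1) ^ 2 < (1 + \<delta>) ^ R"
    using eventually_happens'[OF sequentially_bot] by blast
  define K where "K = 2 * (int R + 1)"
  define C where "C = 24 * nat (2 * K + 1) ^ 2 * 36"
  \<comment> \<open>By \<open>exceptional_bound\<close> at most C n / L vertices are exceptional,
    which this choice makes at most \<delta> n.\<close>
  obtain L :: nat where L: "real C / \<delta> < real L" using reals_Archimedean2 by blast
  define K' where "K' = 2 * int L + 6 * K"
  define M where "M = (2 * K' + 1) * (1 + 6 * K' * K') + 12 * K + 4 * int L + 10"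
  define N where "N = M + 2 * int L + 2 * K"
  define h where "h = nat (2 * N) + 10"
  \<comment> \<open>Graphs up to this size, among them the small tori, are absorbed by the
    constant.\<close>
  define B where "B = nat (4 * K' + 1) ^ 2"
  define c where "c = real B + real (t * (\<Delta> + 1) ^ h)"
  have K0: "K \<ge> 2" by (simp add: K_def)
  have KK': "K \<le> K'" using K0 by (simp add: K'_def)
  have M1: "(2 * K + 1) * (1 + 6 * K * K) \<le> M"
  proof -
    have "(2 * K + 1) * (1 + 6 * K * K) \<le> (2 * K' + 1) * (1 + 6 * K' * K')"
      using KK' K0 by (intro mult_mono add_mono mult_mono) auto
    then show ?thesis using K0 by (simp add: M_def)
  qed
  have M0: "0 \<le> M" using M1 K0 by (smt (verit) mult_nonneg_nonneg)
  show ?thesis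
  proof (intro exI[of _ c] allI impI)
    fix V :: "'a set" and adj tri good
    assume a: "hexmesh V adj tri good \<and> card (V - good) \<le> t \<and> (\<forall>v\<in>V. card {u. adj v u} \<le> \<Delta>)"
    then interpret hexmesh V adj tri good by blast
    have bad: "card (V - good) \<le> t" and deg: "\<And>v. v \<in> V \<Longrightarrow> card {u. adj v u} \<le> \<Delta>" using a by auto
    show "\<exists>D\<subseteq>V. (\<forall>v\<in>V. v \<in> D \<or> (\<exists>u\<in>D. adj u v)) \<and> real (card D) \<le> real (card V) * (1 / 6 + \<epsilon>) + c"
    proof (cases "card V \<le> B")
      case True
      have "0 \<le> real (card V) * (1 / 6 + \<epsilon>)" using assms by (intro mult_nonneg_nonneg) auto
      moreover have "real (card V) \<le> real B" "0 \<le> real (t * (\<Delta> + 1) ^ h)" using True by simp_all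
      ultimately have "real (card V) \<le> real (card V) * (1 / 6 + \<epsilon>) + c" unfolding c_def by linarith
      then show ?thesis by blast
    next
      case False
      then have big: "card V > nat (4 * K' + 1) ^ 2" by (simp add: B_def)
      have "nat (4 * K + 1) ^ 2 \<le> nat (4 * K' + 1) ^ 2" using KK' by (intro power_mono) auto
      then have big': "card V > nat (4 * K + 1) ^ 2" using big by (rule le_less_trans)
      define G where "G = {x\<in>V. nball h x \<subseteq> good}"
      have "\<forall>x\<in>G. \<exists>\<phi>. dev \<phi> N \<and> \<phi> 0 = x" using dev_exists unfolding G_def h_def by blast
      then obtain dv where dv: "\<And>x. x \<in> G \<Longrightarrow> dev (dv x) N \<and> dv x 0 = x" by metis
      define X1 where "X1 = {x\<in>G. exceptional (dv x) M K}"
      define X where "X = G - X1"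
      have GV: "G \<subseteq> V" by (auto simp: G_def)
      have "card X1 * L \<le> 24 * nat (2 * K + 1) ^ 2 * (36 * card V)"
      proof (rule exceptional_bound[of X1 dv N M K L])
        show "x \<in> V \<and> dev (dv x) N \<and> dv x 0 = x" if "x \<in> X1" for x using that dv GV by (auto simp: X1_def)
        show "\<forall>p. hexnorm p \<le> N \<longrightarrow> dv x p \<in> good" if "x \<in> X1" for x
        proof (intro allI impI)
          fix p assume p: "hexnorm p \<le> N"
          have x: "x \<in> G" using that by (simp add: X1_def)
          then have "dv x p \<in> nball (nat (hexnorm p)) x" using dev_nball[of "dv x" N p] dv p by auto
          moreover have "nat (hexnorm p) \<le> h" using p M0 K0 by (simp add: h_def N_def)
          ultimately show "dv x p \<in> good" using x nball_mono[of "nat (hexnorm p)" h x] by (auto simp: G_def)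
        qed
      qed (use K0 big in \<open>auto simp: X1_def N_def M_def K'_def\<close>)
      then have "card X1 * L \<le> C * card V" by (simp add: C_def)
      then have "real (card X1) * real L \<le> real C * real (card V)" by (metis of_nat_le_iff of_nat_mult)
      moreover have "real C * real (card V) \<le> (\<delta> * real L) * real (card V)"
        using L \<delta> by (intro mult_right_mono) (auto simp: field_simps)
      ultimately have "real (card X1) * real L \<le> (\<delta> * real (card V)) * real L" by (simp add: mult_ac)
      moreover have "real L > 0" using L \<delta> by (meson divide_nonneg_pos le_less_trans of_nat_0_le_iff)
      ultimately have X1: "real (card X1) \<le> \<delta> * real (card V)" by (simp add: mult_le_cancel_right)
      have "V - G \<subseteq> (\<Union>b\<in>V - good. nball h b)"
      proof
        fix x assume x: "x \<in> V - G"
        then obtain b where "b \<in> nball h x" "b \<notin> good" by (auto simp: G_def)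
        moreover have "b \<in> V" using calculation nball_V[of x h] x by blast
        ultimately show "x \<in> (\<Union>b\<in>V - good. nball h b)" using nball_sym by blast
      qed
      then have "card (V - G) \<le> card (\<Union>b\<in>V - good. nball h b)"
        using finV finite_subset[OF nball_V finV] by (intro card_mono finite_UN_I) auto
      also have "\<dots> \<le> (\<Sum>b\<in>V - good. card (nball h b))" using finV by (intro card_UN_le) simp
      also have "\<dots> \<le> (\<Sum>b\<in>V - good. (\<Delta> + 1) ^ h)" using card_nball_le deg by (intro sum_mono) auto
      also have "\<dots> \<le> t * (\<Delta> + 1) ^ h" using bad by simp
      finally have VG: "card (V - G) \<le> t * (\<Delta> + 1) ^ h" .
      have "\<exists>D\<subseteq>X. real (card D) \<le> (1 / 6 + \<delta>) * real (card X) \<and> (\<forall>x\<in>X. x \<in> D \<or> (\<exists>w\<in>D \<union> (V - X). adj w x))"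
      proof (rule greedy_domination[OF \<delta>, of X R])
        fix v assume v: "v \<in> X"
        then have v: "v \<in> G" "\<not> exceptional (dv v) M K" by (auto simp: X_def X1_def)
        have d: "dev (dv v) N" "dv v 0 = v" using dv v by auto
        have RN: "int R \<le> N" using M0 K0 by (simp add: N_def K_def)
        have "card (nball R v) \<le> card (dv v ` {p. hexnorm p \<le> int R})"
          using nball_dev[OF d(1) RN] d(2) hexball_finite_card(1)[of "int R"] by (intro card_mono) auto
        also have "\<dots> \<le> card {p. hexnorm p \<le> int R}" using hexball_finite_card(1)[of "int R"] by (intro card_image_le) simp
        also have "\<dots> \<le> nat (2 * int R + 1) ^ 2" using hexball_finite_card(2)[of "int R"] by simp
        finally have "real (card (nball R v)) \<le> real (nat (2 * int R + 1) ^ 2)" by (rule of_nat_mono)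
        also have "\<dots> = (2 * real R + 1) ^ 2" by simp
        also have "\<dots> < (1 + \<delta>) ^ R" by (rule R)
        finally show "real (card (nball R v)) < (1 + \<delta>) ^ R" .
        show "sixth_dominated (nball R v)"
          using unexceptional_dominated[OF d(1) v(2) K_def _ M1 big'] d(2) by (simp add: N_def)
      next
        show "X \<subseteq> V" using GV by (auto simp: X_def)
      qed (use adj_V in auto)
      then obtain D where D: "D \<subseteq> X" "real (card D) \<le> (1 / 6 + \<delta>) * real (card X)"
        "\<forall>x\<in>X. x \<in> D \<or> (\<exists>w\<in>D \<union> (V - X). adj w x)" by blast
      have XV: "X \<subseteq> V" using GV by (auto simp: X_def)
      have "V - X = (V - G) \<union> X1" using GV by (auto simp: X_def X1_def)
      then have "card (V - X) \<le> t * (\<Delta> + 1) ^ h + card X1"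
        using card_Un_le[of "V - G" X1] VG by (metis add_le_mono1 order_trans)
      then have "real (card (V - X)) \<le> real (t * (\<Delta> + 1) ^ h) + real (card X1)"
        unfolding of_nat_add[symmetric] by (rule of_nat_mono)
      then have "real (card (V - X)) \<le> real (t * (\<Delta> + 1) ^ h) + \<delta> * real (card V)"
        using X1 by linarith
      moreover have "(1 / 6 + \<delta>) * real (card X) \<le> (1 / 6 + \<delta>) * real (card V)"
        using card_mono[OF finV XV] \<delta> by (intro mult_left_mono) auto
      moreover have "real (card (D \<union> (V - X))) \<le> real (card D) + real (card (V - X))"
        using card_Un_le[of D "V - X"] by linarith
      ultimately have "real (card (D \<union> (V - X))) \<le> real (card V) * (1 / 6 + \<epsilon>) + c"
        using D(2) by (simp add: c_def \<delta>_def algebra_simps)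
      moreover have "\<forall>v\<in>V. v \<in> D \<union> (V - X) \<or> (\<exists>u\<in>D \<union> (V - X). adj u v)" using D(3) by blast
      moreover have "D \<union> (V - X) \<subseteq> V" using D(1) XV by blast
      ultimately show ?thesis by blast
    qed
  qed
qed

section \<open>Surfaces\<close>

lemma surface_chart_maps:
  assumes "surface S" "x \<in> topspace S"
  obtains U k and h :: "real ^ 2 \<Rightarrow> 'a" where "openin S U" "x \<in> U" "homeomorphic_maps (subtopology S U) euclidean k h"
  using assms unfolding surface_def homeomorphic_space_def by blast

text \<open>Invariance of domain, applied in a chart around each image point. It is used for domains
  in \<open>real ^ 2\<close>, the model of faces, and in \<open>real \<times> real\<close>, the
  model of charts.\<close>

lemma surface_open_image:
  fixes f :: "'n::euclidean_space \<Rightarrow> 'a"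
  assumes S: "surface S" and O: "open O'" and f: "continuous_map (top_of_set O') S f" and inj: "inj_on f O'"
    and dim: "DIM('n) \<ge> 2"
  shows "openin S (f ` O')"
proof (subst openin_subopen, intro ballI)
  fix y assume "y \<in> f ` O'"
  then obtain p where p: "p \<in> O'" "y = f p" by blast
  have fO: "f ` O' \<subseteq> topspace S" using f by (auto simp: continuous_map_def)
  then have "y \<in> topspace S" using p by blast
  then obtain U k and h :: "real ^ 2 \<Rightarrow> 'a" where U: "openin S U" "y \<in> U"
    and kh: "homeomorphic_maps (subtopology S U) euclidean k h"
    by (rule surface_chart_maps[OF S])
  have US: "U \<subseteq> topspace S" by (rule openin_subset[OF U(1)])
  have k: "continuous_map (subtopology S U) euclidean k" and hk: "\<And>x. x \<in> U \<Longrightarrow> h (k x) = x"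
    using kh US by (auto simp: homeomorphic_maps_def)
  define P where "P = {q \<in> O'. f q \<in> U}"
  have "openin (top_of_set O') {q \<in> topspace (top_of_set O'). f q \<in> U}"
    by (rule openin_continuous_map_preimage[OF f U(1)])
  then have "openin (top_of_set O') P" by (simp add: P_def)
  then have P: "open P" using O by (simp add: openin_open_eq)
  have PO: "P \<subseteq> O'" by (auto simp: P_def)
  have "continuous_map (top_of_set P) S f"
    using continuous_map_from_subtopology_mono[OF f PO] by simp
  then have "continuous_map (top_of_set P) (subtopology S U) f"
    by (simp add: continuous_map_in_subtopology P_def image_subset_iff)
  then have "continuous_map (top_of_set P) euclidean (k \<circ> f)" using k by (rule continuous_map_compose)
  then have cont: "continuous_on P (k \<circ> f)" by simp
  have inj2: "inj_on (k \<circ> f) P"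
    using inj PO hk by (smt (verit, best) P_def comp_apply inj_on_def mem_Collect_eq)
  have "open ((k \<circ> f) ` P)" by (rule invariance_of_domain_gen[OF P cont inj2]) (use dim in simp)
  then have "openin (subtopology S U) {x \<in> topspace (subtopology S U). k x \<in> (k \<circ> f) ` P}"
    by (intro openin_continuous_map_preimage[OF k]) simp
  moreover have "{x \<in> topspace (subtopology S U). k x \<in> (k \<circ> f) ` P} = f ` P"
    using hk US by (auto simp: P_def) (metis (no_types, lifting) hk image_eqI mem_Collect_eq)
  ultimately have "openin S (f ` P)" using U(1) openin_trans_full by fastforce
  then show "\<exists>T. openin S T \<and> y \<in> T \<and> T \<subseteq> f ` O'"
    using p U(2) PO by (intro exI[of _ "f ` P"]) (auto simp: P_def)
qed

definition osq :: "real \<Rightarrow> (real \<times> real) set" where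
  "osq r = {-r<..<r} \<times> {-r<..<r}"

lemma open_osq: "open (osq r)" and convex_osq: "convex (osq r)"
  by (simp_all add: osq_def open_Times convex_Times)

text \<open>Charts are normalised to \<open>osq 3\<close>, which leaves room for nested squares of
  half-width 1 and 2. Pairs of reals make rectangles products of intervals.\<close>

lemma surface_chart:
  assumes S: "surface S" and W: "openin S W" and x: "x \<in> W"
  obtains q :: "real \<times> real \<Rightarrow> 'a" where "continuous_map (top_of_set (osq 3)) S q" "inj_on q (osq 3)"
    "q (0, 0) = x" "q ` osq 3 \<subseteq> W"
proof -
  have "x \<in> topspace S" using W x openin_subset by blast
  then obtain U k and h :: "real ^ 2 \<Rightarrow> 'a" where U: "openin S U" "x \<in> U"
    and kh: "homeomorphic_maps (subtopology S U) euclidean k h"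
    by (rule surface_chart_maps[OF S])
  have US: "U \<subseteq> topspace S" by (rule openin_subset[OF U(1)])
  have h: "continuous_map euclidean (subtopology S U) h" and hk: "\<And>x. x \<in> U \<Longrightarrow> h (k x) = x" and kh': "\<And>y. k (h y) = y"
    using kh US by (auto simp: homeomorphic_maps_def)
  have h': "continuous_map euclidean S h" using h continuous_map_in_subtopology by blast
  have "open {z. h z \<in> W}" using openin_continuous_map_preimage[OF h' W] by simp
  moreover have "k x \<in> {z. h z \<in> W}" using x hk U by simp
  ultimately obtain e where e: "e > 0" "ball (k x) e \<subseteq> {z. h z \<in> W}" using open_contains_ball by blast
  \<comment> \<open>On \<open>osq 3\<close> the absolute values of the coordinates add up to less
    than 6, so the factor e / 6 keeps the image inside the ball.\<close>
  define l :: "real \<times> real \<Rightarrow> real ^ 2" where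
    "l = (\<lambda>p. k x + (e / 6) *\<^sub>R (fst p *\<^sub>R axis 1 1 + snd p *\<^sub>R axis 2 1))"
  have l_ball: "l p \<in> ball (k x) e" if "p \<in> osq 3" for p
  proof -
    have "norm (fst p *\<^sub>R axis 1 1 + snd p *\<^sub>R axis 2 1 :: real ^ 2) \<le> \<bar>fst p\<bar> + \<bar>snd p\<bar>"
      by (rule order_trans[OF norm_triangle_ineq]) simp
    also have "\<dots> < 6" using that by (auto simp: osq_def)
    finally have "(e / 6) * norm (fst p *\<^sub>R axis 1 1 + snd p *\<^sub>R axis 2 1 :: real ^ 2) < (e / 6) * 6"
      using e by (intro mult_strict_left_mono) auto
    then show ?thesis using e by (simp add: l_def dist_norm)
  qed
  have l_inj: "inj l"
  proof (rule injI)
    fix p p' assume "l p = l p'"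
    then have "(fst p *\<^sub>R axis 1 1 + snd p *\<^sub>R axis 2 1 :: real ^ 2) = fst p' *\<^sub>R axis 1 1 + snd p' *\<^sub>R axis 2 1"
      using e by (simp add: l_def)
    then have "(fst p *\<^sub>R axis 1 1 + snd p *\<^sub>R axis 2 1 :: real ^ 2) $ i = (fst p' *\<^sub>R axis 1 1 + snd p' *\<^sub>R axis 2 1) $ i" for i
      by simp
    from this[of 1] this[of 2] show "p = p'" by (simp add: axis_def prod_eq_iff)
  qed
  have l_cont: "continuous_on (osq 3) l" unfolding l_def by (intro continuous_intros)
  show ?thesis
  proof (rule that[of "h \<circ> l"])
    show "continuous_map (top_of_set (osq 3)) S (h \<circ> l)"
      by (rule continuous_map_compose[OF _ h']) (use l_cont in simp)
    have "inj h" using kh' by (metis injI)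
    then show "inj_on (h \<circ> l) (osq 3)" using l_inj by (meson inj_compose inj_on_subset subset_UNIV)
    show "(h \<circ> l) (0, 0) = x" using hk U by (simp add: l_def)
    show "(h \<circ> l) ` osq 3 \<subseteq> W" using l_ball e by fastforce
  qed
qed

lemma surface_open_chart_image:
  assumes "surface S" "continuous_map (top_of_set (osq 3)) S q" "inj_on q (osq 3)" "open O'" "O' \<subseteq> osq 3"
  shows "openin S (q ` O')"
proof (rule surface_open_image[OF assms(1,4)])
  show "continuous_map (top_of_set O') S q"
    using continuous_map_from_subtopology_mono[OF assms(2,5)] by simp
  show "inj_on q O'" using assms(3,5) by (rule inj_on_subset)
qed simp

lemma arc_inverse:
  assumes "Hausdorff_space S" "pathin S g" "inj_on g {0..1}"
  obtains u where "continuous_map (subtopology S (g ` {0..1})) (top_of_set {0..1::real}) u" "\<And>t. t \<in> {0..1} \<Longrightarrow> u (g t) = t"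
proof -
  let ?I = "top_of_set {0..1::real}"
  have sub: "g ` {0..1} \<subseteq> topspace S" using assms(2) by (auto simp: pathin_def continuous_map_def)
  have c: "continuous_map ?I (subtopology S (g ` {0..1})) g"
    using assms(2) by (simp add: pathin_def continuous_map_in_subtopology)
  have "closed_map ?I (subtopology S (g ` {0..1})) g"
    using c assms(1) by (intro continuous_imp_closed_map_gen) (auto simp: compact_space_subtopology Hausdorff_imp_kc_space Hausdorff_space_subtopology)
  then have "homeomorphic_map ?I (subtopology S (g ` {0..1})) g"
    using c assms(3) sub by (intro bijective_closed_imp_homeomorphic_map) auto
  then obtain u where "homeomorphic_maps ?I (subtopology S (g ` {0..1})) g u" using homeomorphic_map_maps by blast
  then show ?thesis using that by (auto simp: homeomorphic_maps_def)
qed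

text \<open>A square does not embed into an interval: with a second coordinate 0 added, its image
  would be an open subset of the plane inside a line.\<close>

lemma arc_no_interior:
  assumes S: "surface S" and g: "pathin S g" "inj_on g {0..1}" and W: "openin S W" "x \<in> W" "W \<subseteq> g ` {0..1}"
  shows False
proof -
  have H: "Hausdorff_space S" using S by (simp add: surface_def)
  obtain u where u: "continuous_map (subtopology S (g ` {0..1})) (top_of_set {0..1::real}) u" "\<And>t. t \<in> {0..1} \<Longrightarrow> u (g t) = t"
    by (rule arc_inverse[OF H g]) (rule that)
  obtain q where q: "continuous_map (top_of_set (osq 3)) S q" "inj_on q (osq 3)" "q ` osq 3 \<subseteq> W"
    by (rule surface_chart[OF S W(1,2)])
  have "continuous_map (top_of_set (osq 3)) (subtopology S (g ` {0..1})) q"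
    using q(1,3) W(3) by (auto simp: continuous_map_in_subtopology)
  then have "continuous_map (top_of_set (osq 3)) (top_of_set {0..1}) (u \<circ> q)" using u(1) by (rule continuous_map_compose)
  then have c: "continuous_on (osq 3) (\<lambda>p. (u (q p), 0 :: real))"
    by (auto simp: continuous_map_in_subtopology o_def intro!: continuous_intros)
  have "inj_on (\<lambda>p. (u (q p), 0 :: real)) (osq 3)"
  proof (rule inj_onI)
    fix a b assume ab: "a \<in> osq 3" "b \<in> osq 3" "(u (q a), 0 :: real) = (u (q b), 0)"
    obtain s t where st: "q a = g s" "q b = g t" "s \<in> {0..1}" "t \<in> {0..1}" using ab q(3) W(3) by blast
    then have "s = t" using ab(3) u(2) by simp
    then show "a = b" using st ab inj_onD[OF q(2), of a b] by simp
  qed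
  from invariance_of_domain_gen[OF open_osq c this]
  have op: "open ((\<lambda>p. (u (q p), 0 :: real)) ` osq 3)" by simp
  have "(0, 0) \<in> osq 3" by (simp add: osq_def)
  then obtain e where e: "e > 0" "ball (u (q (0, 0)), 0) e \<subseteq> (\<lambda>p. (u (q p), 0 :: real)) ` osq 3"
    using op open_contains_ball by blast
  have "(u (q (0, 0)), e / 2) \<in> ball (u (q (0, 0)), 0) e" using e by (simp add: dist_Pair_Pair)
  then show False using e by auto
qed

section \<open>Faces and edges of a triangulation\<close>

locale surface_triangulation =
  fixes S :: "'a topology" and V :: "'a set" and E :: "'a set set" and \<alpha> :: "'a set \<Rightarrow> 'a set"
  assumes surf: "surface S" and triang: "triangulation_on S V E \<alpha>"
begin

abbreviation Fs :: "'a set set" where "Fs \<equiv> faces S V E \<alpha>"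

lemma Hausdorff: "Hausdorff_space S" using surf by (simp add: surface_def)

lemma finV: "finite V" and edge: "e \<in> E \<Longrightarrow> e \<subseteq> V \<and> card e = 2" and V_sub: "V \<subseteq> topspace S"
  using triang by (auto simp: triangulation_on_def embedded_graph_def simple_graph_def)

lemma finE: "finite E"
  by (rule finite_subset[of _ "Pow V"]) (use edge finV in auto)

lemma edge_arc:
  assumes "e \<in> E"
  obtains g where "pathin S g" "inj_on g {0..1}" "{g 0, g 1} = e" "g ` {0..1} = \<alpha> e"
proof -
  have "\<exists>g. pathin S g \<and> inj_on g {0..1} \<and> {g 0, g 1} = e \<and> g ` {0..1} = \<alpha> e"
    using triang assms by (simp add: triangulation_on_def embedded_graph_def)
  then show thesis by (elim exE conjE) (rule that)
qed

lemma arc_disjoint: "e \<in> E \<Longrightarrow> (\<alpha> e - e) \<inter> (V \<union> (\<Union>f\<in>E - {e}. \<alpha> f)) = {}"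
  using triang by (simp add: triangulation_on_def embedded_graph_def)

lemma edge_sub_arc: assumes "e \<in> E" shows "e \<subseteq> \<alpha> e"
proof -
  obtain g where g: "{g 0, g 1} = e" "g ` {0..1::real} = \<alpha> e" by (rule edge_arc[OF assms]) (rule that)
  have "{g 0, g 1} \<subseteq> g ` {0..1}" by auto
  then show ?thesis using g by simp
qed

lemma arc_V: assumes "e \<in> E" shows "\<alpha> e \<inter> V = e"
  using arc_disjoint[OF assms] edge_sub_arc[OF assms] edge[OF assms] by blast

lemma arc_inter: assumes "e \<in> E" "f \<in> E" "e \<noteq> f" "x \<in> \<alpha> e" "x \<in> \<alpha> f" shows "x \<in> e" "x \<in> f"
  using arc_disjoint[OF assms(1)] arc_disjoint[OF assms(2)] assms by blast+

lemma arc_compactin: assumes "e \<in> E" shows "compactin S (\<alpha> e)"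
proof -
  obtain g where g: "pathin S g" "g ` {0..1::real} = \<alpha> e" by (rule edge_arc[OF assms]) (rule that)
  then show ?thesis using compactin_path_image by metis
qed

lemma arc_closedin: "e \<in> E \<Longrightarrow> closedin S (\<alpha> e)"
  using arc_compactin Hausdorff compactin_imp_closedin by blast

lemma arc_sub: "e \<in> E \<Longrightarrow> \<alpha> e \<subseteq> topspace S"
  using arc_closedin closedin_subset by blast

text \<open>The triangle of \<open>bounded_by_triangle\<close> recast as a three-element set: its
  sides are the two-element subsets, and no order of the corners is chosen.\<close>

definition face_corners :: "'a set \<Rightarrow> 'a set \<Rightarrow> bool" where
  "face_corners F T \<longleftrightarrow> card T = 3 \<and> (\<forall>e. e \<subseteq> T \<and> card e = 2 \<longrightarrow> e \<in> E) \<and>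
     (\<exists>h :: real ^ 2 \<Rightarrow> 'a. homeomorphic_map (top_of_set (cball 0 1)) (subtopology S (S closure_of F)) h \<and>
        h ` ball 0 1 = F \<and> h ` sphere 0 1 = \<Union> (\<alpha> ` {e. e \<subseteq> T \<and> card e = 2}))"

lemma pairs_of_triple:
  assumes "a \<noteq> b" "b \<noteq> c" "a \<noteq> c"
  shows "{e. e \<subseteq> {a, b, c} \<and> card e = 2} = {{a, b}, {b, c}, {a, c}}"
proof
  show "{e. e \<subseteq> {a, b, c} \<and> card e = 2} \<subseteq> {{a, b}, {b, c}, {a, c}}"
  proof
    fix e assume "e \<in> {e. e \<subseteq> {a, b, c} \<and> card e = 2}"
    then obtain x y where "e = {x, y}" "x \<noteq> y" "x \<in> {a, b, c}" "y \<in> {a, b, c}" by (auto simp: card_2_iff)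
    then show "e \<in> {{a, b}, {b, c}, {a, c}}" by auto
  qed
qed (use assms in auto)

definition corners :: "'a set \<Rightarrow> 'a set" where
  "corners F = (SOME T. face_corners F T)"

lemma corners: assumes "F \<in> Fs" shows "face_corners F (corners F)"
proof -
  obtain a b c and h :: "real ^ 2 \<Rightarrow> 'a" where abc: "{a, b} \<in> E" "{b, c} \<in> E" "{a, c} \<in> E"
    and h: "homeomorphic_map (top_of_set (cball 0 1)) (subtopology S (S closure_of F)) h"
      "h ` ball 0 1 = F" "h ` sphere 0 1 = \<alpha> {a, b} \<union> \<alpha> {b, c} \<union> \<alpha> {a, c}"
  proof -
    have "bounded_by_triangle S E \<alpha> F" using triang assms by (simp add: triangulation_on_def)
    then show thesis unfolding bounded_by_triangle_def by (elim exE conjE) (rule that)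
  qed
  have ne: "a \<noteq> b" "b \<noteq> c" "a \<noteq> c" using edge[OF abc(1)] edge[OF abc(2)] edge[OF abc(3)] by auto
  have "face_corners F {a, b, c}" unfolding face_corners_def
  proof (intro conjI exI[of _ h])
    show "\<forall>e. e \<subseteq> {a, b, c} \<and> card e = 2 \<longrightarrow> e \<in> E"
    proof (intro allI impI)
      fix e assume "e \<subseteq> {a, b, c} \<and> card e = 2"
      then have "e \<in> {{a, b}, {b, c}, {a, c}}" unfolding pairs_of_triple[OF ne, symmetric] by simp
      then show "e \<in> E" using abc by auto
    qed
    show "h ` sphere 0 1 = \<Union> (\<alpha> ` {e. e \<subseteq> {a, b, c} \<and> card e = 2})"
      unfolding pairs_of_triple[OF ne] using h(3) by auto
  qed (use h ne in auto)
  then show ?thesis unfolding corners_def by (rule someI)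
qed

lemma card_corners: "F \<in> Fs \<Longrightarrow> card (corners F) = 3"
  and corners_edge: "F \<in> Fs \<Longrightarrow> e \<subseteq> corners F \<Longrightarrow> card e = 2 \<Longrightarrow> e \<in> E"
  using corners[of F] by (simp_all add: face_corners_def)

lemma face_disc:
  assumes "F \<in> Fs"
  obtains h :: "real ^ 2 \<Rightarrow> 'a" and k where "continuous_map (top_of_set (cball 0 1)) S h"
    "continuous_map (subtopology S (S closure_of F)) (top_of_set (cball 0 1)) k" "inj_on h (cball 0 1)"
    "h ` cball 0 1 = S closure_of F" "\<And>x. x \<in> cball 0 1 \<Longrightarrow> k (h x) = x" "\<And>y. y \<in> S closure_of F \<Longrightarrow> h (k y) = y"
    "h ` ball 0 1 = F" "h ` sphere 0 1 = \<Union> (\<alpha> ` {e. e \<subseteq> corners F \<and> card e = 2})"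
proof -
  obtain h :: "real ^ 2 \<Rightarrow> 'a" where h: "homeomorphic_map (top_of_set (cball 0 1)) (subtopology S (S closure_of F)) h"
      "h ` ball 0 1 = F" "h ` sphere 0 1 = \<Union> (\<alpha> ` {e. e \<subseteq> corners F \<and> card e = 2})"
    using corners[OF assms] unfolding face_corners_def by (elim exE conjE) (rule that)
  then obtain k where k: "homeomorphic_maps (top_of_set (cball 0 1)) (subtopology S (S closure_of F)) h k"
    using homeomorphic_map_maps by blast
  have cl: "S closure_of F \<subseteq> topspace S" by (rule closure_of_subset_topspace)
  have "continuous_map (top_of_set (cball 0 1)) S h" using k unfolding homeomorphic_maps_def
    by (meson continuous_map_into_fulltopology)
  moreover have "h ` cball 0 1 = S closure_of F" using h(1) cl by (auto simp: homeomorphic_eq_everything_map)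
  moreover have "inj_on h (cball 0 1)" using h(1) by (simp add: homeomorphic_eq_everything_map)
  ultimately show ?thesis using that h k cl unfolding homeomorphic_maps_def by (auto simp: Int_absorb1)
qed

lemma closure_face:
  assumes "F \<in> Fs"
  shows "S closure_of F = F \<union> \<Union> (\<alpha> ` {e. e \<subseteq> corners F \<and> card e = 2})"
proof -
  obtain h :: "real ^ 2 \<Rightarrow> 'a" where h: "h ` cball 0 1 = S closure_of F" "h ` ball 0 1 = F"
    "h ` sphere 0 1 = \<Union> (\<alpha> ` {e. e \<subseteq> corners F \<and> card e = 2})"
    by (rule face_disc[OF assms]) (rule that)
  have "cball (0::real^2) 1 = ball 0 1 \<union> sphere 0 1" by auto
  then show ?thesis using h by (metis image_Un)
qed

text \<open>Components need not be open in general; here invariance of domain applies to the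
  parametrisation by the open disc.\<close>

lemma face_open: assumes "F \<in> Fs" shows "openin S F"
proof -
  obtain h :: "real ^ 2 \<Rightarrow> 'a" where h: "continuous_map (top_of_set (cball 0 1)) S h" "inj_on h (cball 0 1)" "h ` ball 0 1 = F"
    by (rule face_disc[OF assms]) (rule that)
  have "openin S (h ` ball 0 1)"
  proof (rule surface_open_image[OF surf])
    show "continuous_map (top_of_set (ball 0 1)) S h"
      using continuous_map_from_subtopology_mono[OF h(1) ball_subset_cball] by simp
    show "inj_on h (ball 0 1)" using h(2) ball_subset_cball by (rule inj_on_subset)
  qed auto
  then show ?thesis using h by simp
qed

lemma Union_Fs: "\<Union>Fs = topspace S - (V \<union> (\<Union>e\<in>E. \<alpha> e))"
  unfolding faces_def Union_connected_components_of by auto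

lemma Fs_disjoint: "F \<in> Fs \<Longrightarrow> F' \<in> Fs \<Longrightarrow> F \<noteq> F' \<Longrightarrow> F \<inter> F' = {}"
  unfolding faces_def by (meson disjnt_def connected_components_of_disjoint)

lemma face_graph_disjoint: "F \<in> Fs \<Longrightarrow> F \<inter> V = {}" "F \<in> Fs \<Longrightarrow> e \<in> E \<Longrightarrow> F \<inter> \<alpha> e = {}"
  using Union_Fs by blast+

lemma face_nonempty: "F \<in> Fs \<Longrightarrow> F \<noteq> {}"
  unfolding faces_def by (rule nonempty_connected_components_of)

definition edge_faces :: "'a set \<Rightarrow> 'a set set" where
  "edge_faces e = {F\<in>Fs. e \<subseteq> corners F}"

text \<open>Two faces along an edge glue to a neighbourhood of the interior of the edge: on each side, use polar
  coordinates in the closed disc with the edge as part of the boundary circle.\<close>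

lemma edge_neighbourhood:
  assumes e: "e \<in> E" and F: "F1 \<in> edge_faces e" "F2 \<in> edge_faces e" "F1 \<noteq> F2"
    and g: "pathin S g" "inj_on g {0..1}" "{g 0, g 1} = e" "g ` {0..1} = \<alpha> e"
  obtains W where "openin S W" "g (1/2) \<in> W" "W \<subseteq> F1 \<union> F2 \<union> \<alpha> e"
proof -
  have disc: "\<exists>(h :: real ^ 2 \<Rightarrow> 'a) u. continuous_map (top_of_set (cball 0 1)) S h \<and> inj_on h (cball 0 1) \<and>
      h ` ball 0 1 = F \<and> continuous_on {0..1} u \<and> (\<forall>s\<in>{0..1}. norm (u s) = 1 \<and> h (u s) = g s)"
    if "F \<in> edge_faces e" for F
  proof -
    have F: "F \<in> Fs" "e \<subseteq> corners F" using that by (auto simp: edge_faces_def)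
    obtain h :: "real ^ 2 \<Rightarrow> 'a" and k where h: "continuous_map (top_of_set (cball 0 1)) S h"
      "continuous_map (subtopology S (S closure_of F)) (top_of_set (cball 0 1)) k" "inj_on h (cball 0 1)"
      "h ` cball 0 1 = S closure_of F" "\<And>x. x \<in> cball 0 1 \<Longrightarrow> k (h x) = x" "\<And>y. y \<in> S closure_of F \<Longrightarrow> h (k y) = y"
      "h ` ball 0 1 = F" "h ` sphere 0 1 = \<Union> (\<alpha> ` {e. e \<subseteq> corners F \<and> card e = 2})"
      by (rule face_disc[OF F(1)]) (rule that)
    have sub: "\<alpha> e \<subseteq> h ` sphere 0 1" using h(8) F(2) edge[OF e] by blast
    have acl: "\<alpha> e \<subseteq> S closure_of F" using sub image_mono[OF sphere_cball, of h 0 1] h(4) by (metis order_trans)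
    have "continuous_map (top_of_set {0..1}) (subtopology S (S closure_of F)) g"
      using g(1) acl unfolding g(4)[symmetric] by (simp add: pathin_def continuous_map_in_subtopology image_subset_iff_funcset)
    then have "continuous_map (top_of_set {0..1}) (top_of_set (cball 0 1)) (k \<circ> g)" using h(2) by (rule continuous_map_compose)
    then have "continuous_on {0..1} (k \<circ> g)" by (simp add: continuous_map_in_subtopology)
    moreover have "norm (k (g s)) = 1 \<and> h (k (g s)) = g s" if s: "s \<in> {0..1}" for s
    proof -
      obtain y where y: "y \<in> sphere 0 1" "g s = h y" using sub g(4) s by blast
      then have "k (g s) = y" using h(5)[of y] by auto
      then show ?thesis using y by auto
    qed
    ultimately show ?thesis using h by (intro exI[of _ h] exI[of _ "k \<circ> g"]) auto
  qed
  obtain h1 :: "real ^ 2 \<Rightarrow> 'a" and u1 where 1: "continuous_map (top_of_set (cball 0 1)) S h1" "inj_on h1 (cball 0 1)"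
      "h1 ` ball 0 1 = F1" "continuous_on {0..1} u1" "\<And>s. s \<in> {0..1} \<Longrightarrow> norm (u1 s) = 1 \<and> h1 (u1 s) = g s"
    using disc[OF F(1)] by blast
  obtain h2 :: "real ^ 2 \<Rightarrow> 'a" and u2 where 2: "continuous_map (top_of_set (cball 0 1)) S h2" "inj_on h2 (cball 0 1)"
      "h2 ` ball 0 1 = F2" "continuous_on {0..1} u2" "\<And>s. s \<in> {0..1} \<Longrightarrow> norm (u2 s) = 1 \<and> h2 (u2 s) = g s"
    using disc[OF F(2)] by blast
  define Q :: "(real \<times> real) set" where "Q = {0<..<1} \<times> {-1<..<1}"
  define f1 where "f1 = (\<lambda>p. h1 ((1 - snd p) *\<^sub>R u1 (fst p)))"
  define f2 where "f2 = (\<lambda>p. h2 ((1 + snd p) *\<^sub>R u2 (fst p)))"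
  \<comment> \<open>The first coordinate runs along the edge, the absolute value of the second is
    the distance from the boundary circle, and its sign selects the disc. At 0 both formulas give
    the edge itself.\<close>
  define f where "f = (\<lambda>p. if 0 \<le> snd p then f1 p else f2 p)"
  have c1: "continuous_map (top_of_set (Q \<inter> {p. 0 \<le> snd p})) S f1"
  proof -
    have "continuous_map (top_of_set (Q \<inter> {p. 0 \<le> snd p})) (top_of_set (cball 0 1)) (\<lambda>p. (1 - snd p) *\<^sub>R u1 (fst p))"
      using 1(5) by (auto simp: continuous_map_in_subtopology Q_def intro!: continuous_intros continuous_on_compose2[OF 1(4)])
    from continuous_map_compose[OF this 1(1)] show ?thesis by (simp add: f1_def o_def)
  qed
  have c2: "continuous_map (top_of_set (Q \<inter> {p. snd p \<le> 0})) S f2"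
  proof -
    have "continuous_map (top_of_set (Q \<inter> {p. snd p \<le> 0})) (top_of_set (cball 0 1)) (\<lambda>p. (1 + snd p) *\<^sub>R u2 (fst p))"
      using 2(5) by (auto simp: continuous_map_in_subtopology Q_def intro!: continuous_intros continuous_on_compose2[OF 2(4)])
    from continuous_map_compose[OF this 2(1)] show ?thesis by (simp add: f2_def o_def)
  qed
  have c: "continuous_map (top_of_set Q) S f"
    unfolding f_def
  proof (rule continuous_map_cases_le)
    show "continuous_map (top_of_set Q) euclideanreal (\<lambda>_. 0)" "continuous_map (top_of_set Q) euclideanreal snd"
      by (auto intro: continuous_intros)
    show "continuous_map (subtopology (top_of_set Q) {x \<in> topspace (top_of_set Q). 0 \<le> snd x}) S f1"
      using c1 by (simp add: subtopology_subtopology Int_def)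
    show "continuous_map (subtopology (top_of_set Q) {x \<in> topspace (top_of_set Q). snd x \<le> 0}) S f2"
      using c2 by (simp add: subtopology_subtopology Int_def)
    show "f1 x = f2 x" if "x \<in> topspace (top_of_set Q)" "0 = snd x" for x
      using that 1(5)[of "fst x"] 2(5)[of "fst x"] by (auto simp: f1_def f2_def Q_def)
  qed
  have in1: "f p \<in> F1" if "p \<in> Q" "snd p > 0" for p
  proof -
    have "(1 - snd p) *\<^sub>R u1 (fst p) \<in> ball 0 1" using that 1(5)[of "fst p"] by (auto simp: Q_def)
    then show ?thesis using that 1(3) by (auto simp: f_def f1_def)
  qed
  have in2: "f p \<in> F2" if "p \<in> Q" "snd p < 0" for p
  proof -
    have "(1 + snd p) *\<^sub>R u2 (fst p) \<in> ball 0 1" using that 2(5)[of "fst p"] by (auto simp: Q_def)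
    then show ?thesis using that 2(3) by (auto simp: f_def f2_def)
  qed
  have in0: "f p = g (fst p)" if "p \<in> Q" "snd p = 0" for p
    using that 1(5)[of "fst p"] by (auto simp: f_def f1_def Q_def)
  have g_arc: "g (fst p) \<in> \<alpha> e" if "p \<in> Q" for p using that g(4) by (force simp: Q_def)
  have FF: "F1 \<in> Fs" "F2 \<in> Fs" using F by (auto simp: edge_faces_def)
  have dis: "F1 \<inter> F2 = {}" "F1 \<inter> \<alpha> e = {}" "F2 \<inter> \<alpha> e = {}"
    using Fs_disjoint[OF FF F(3)] face_graph_disjoint(2)[OF FF(1) e] face_graph_disjoint(2)[OF FF(2) e] by auto
  have polar: "s = s' \<and> r = r'" if eq: "r *\<^sub>R u s = r' *\<^sub>R u s'" and r: "0 < r" "0 < r'"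
    and u: "norm (u s) = 1" "norm (u s') = 1" "u s = u s' \<Longrightarrow> s = s'" for r r' s s' and u :: "real \<Rightarrow> real ^ 2"
  proof -
    have "norm (r *\<^sub>R u s) = norm (r' *\<^sub>R u s')" using eq by simp
    then have "r = r'" using r u by simp
    then show ?thesis using eq r u by simp
  qed
  have ug: "u1 s = u1 s' \<Longrightarrow> s = s'" "u2 s = u2 s' \<Longrightarrow> s = s'" if "s \<in> {0..1}" "s' \<in> {0..1}" for s s'
    using that 1(5)[of s] 1(5)[of s'] 2(5)[of s] 2(5)[of s'] inj_onD[OF g(2), of s s'] by metis+
  have "inj_on f Q"
  proof (rule inj_onI)
    fix p p' assume p: "p \<in> Q" "p' \<in> Q" "f p = f p'"
    have fr: "fst p \<in> {0..1}" "fst p' \<in> {0..1}" using p by (auto simp: Q_def)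
    have sn: "snd p < 1" "snd p' < 1" "-1 < snd p" "-1 < snd p'" using p by (auto simp: Q_def)
    have sg: "(snd p > 0 \<longleftrightarrow> snd p' > 0) \<and> (snd p < 0 \<longleftrightarrow> snd p' < 0)"
      using in1[of p] in1[of p'] in2[of p] in2[of p'] in0[of p] in0[of p'] g_arc[of p] g_arc[of p'] dis p
      by (cases "snd p" "0::real" rule: linorder_cases; cases "snd p'" "0::real" rule: linorder_cases) auto
    show "p = p'"
    proof (cases "snd p \<ge> 0")
      case True
      then have "snd p' \<ge> 0" using sg by linarith
      then have "h1 ((1 - snd p) *\<^sub>R u1 (fst p)) = h1 ((1 - snd p') *\<^sub>R u1 (fst p'))"
        using p(3) True by (simp add: f_def f1_def)
      moreover have "(1 - snd p) *\<^sub>R u1 (fst p) \<in> cball 0 1" "(1 - snd p') *\<^sub>R u1 (fst p') \<in> cball 0 1"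
        using 1(5) fr sn True \<open>snd p' \<ge> 0\<close> by auto
      ultimately have "(1 - snd p) *\<^sub>R u1 (fst p) = (1 - snd p') *\<^sub>R u1 (fst p')" using inj_onD[OF 1(2)] by blast
      from polar[OF this] 1(5) fr sn ug[OF fr] have "fst p = fst p' \<and> 1 - snd p = 1 - snd p'" by auto
      then show ?thesis by (simp add: prod_eq_iff)
    next
      case False
      then have "snd p' < 0" using sg by linarith
      then have "h2 ((1 + snd p) *\<^sub>R u2 (fst p)) = h2 ((1 + snd p') *\<^sub>R u2 (fst p'))"
        using p(3) False by (simp add: f_def f2_def)
      moreover have "(1 + snd p) *\<^sub>R u2 (fst p) \<in> cball 0 1" "(1 + snd p') *\<^sub>R u2 (fst p') \<in> cball 0 1"
        using 2(5) fr sn False \<open>snd p' < 0\<close> by auto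
      ultimately have "(1 + snd p) *\<^sub>R u2 (fst p) = (1 + snd p') *\<^sub>R u2 (fst p')" using inj_onD[OF 2(2)] by blast
      from polar[OF this] 2(5) fr sn ug[OF fr] have "fst p = fst p' \<and> 1 + snd p = 1 + snd p'" by auto
      then show ?thesis by (simp add: prod_eq_iff)
    qed
  qed
  moreover have "open Q" by (simp add: Q_def open_Times)
  ultimately have op: "openin S (f ` Q)" using surface_open_image[OF surf _ c] by simp
  show ?thesis
  proof (rule that[OF op])
    have "(1/2, 0) \<in> Q" by (simp add: Q_def)
    then show "g (1/2) \<in> f ` Q" using in0[of "(1/2, 0)"] by (intro image_eqI[of _ _ "(1/2, 0)"]) auto
    show "f ` Q \<subseteq> F1 \<union> F2 \<union> \<alpha> e"
    proof
      fix y assume "y \<in> f ` Q"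
      then obtain p where p: "p \<in> Q" "y = f p" by blast
      then show "y \<in> F1 \<union> F2 \<union> \<alpha> e"
        using in1[of p] in2[of p] in0[of p] g_arc[of p] by (cases "snd p" "0::real" rule: linorder_cases) auto
    qed
  qed
qed

text \<open>The point \<open>g (1/2)\<close> is in the closure of every face at the edge, but a
  neighbourhood of it is filled by two faces and the edge, which leaves nothing for a third
  face.\<close>

lemma edge_faces_le_2:
  assumes e: "e \<in> E" and F: "F1 \<in> edge_faces e" "F2 \<in> edge_faces e" "F1 \<noteq> F2" "F \<in> edge_faces e"
  shows "F = F1 \<or> F = F2"
proof (rule ccontr)
  assume ne: "\<not> (F = F1 \<or> F = F2)"
  obtain g where g: "pathin S g" "inj_on g {0..1}" "{g 0, g 1} = e" "g ` {0..1} = \<alpha> e" by (rule edge_arc[OF e]) (rule that)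
  obtain W where W: "openin S W" "g (1/2) \<in> W" "W \<subseteq> F1 \<union> F2 \<union> \<alpha> e"
    by (rule edge_neighbourhood[OF e F(1-3) g]) (rule that)
  have FF: "F1 \<in> Fs" "F2 \<in> Fs" "F \<in> Fs" "e \<subseteq> corners F" using F by (auto simp: edge_faces_def)
  have "g (1/2) \<in> \<alpha> e" using g(4) by force
  then have "g (1/2) \<in> S closure_of F" unfolding closure_face[OF FF(3)] using FF(4) edge[OF e] by blast
  then have "F \<inter> W \<noteq> {}" using W(1,2) by (metis in_closure_of disjoint_iff)
  then show False
    using W(3) Fs_disjoint[OF FF(3,1)] Fs_disjoint[OF FF(3,2)] face_graph_disjoint(2)[OF FF(3) e] ne by blast
qed

lemma edge_faces_card: assumes "e \<in> E" shows "finite (edge_faces e)" "card (edge_faces e) \<le> 2"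
proof -
  have "finite (edge_faces e) \<and> card (edge_faces e) \<le> 2"
  proof (cases "\<exists>F1 F2. F1 \<in> edge_faces e \<and> F2 \<in> edge_faces e \<and> F1 \<noteq> F2")
    case True
    then obtain F1 F2 where F: "F1 \<in> edge_faces e" "F2 \<in> edge_faces e" "F1 \<noteq> F2" by blast
    then have "edge_faces e = {F1, F2}" using edge_faces_le_2[OF assms F] by blast
    then show ?thesis using F(3) by simp
  next
    case False
    then have "edge_faces e = {} \<or> (\<exists>F. edge_faces e = {F})" by blast
    then show ?thesis by auto
  qed
  then show "finite (edge_faces e)" "card (edge_faces e) \<le> 2" by auto
qed

lemma corner_edge_exists:
  assumes "F \<in> Fs" obtains e where "e \<in> E" "F \<in> edge_faces e"
proof -
  obtain a b c where "corners F = {a, b, c}" "a \<noteq> b" using card_corners[OF assms] by (auto simp: card_3_iff)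
  then show ?thesis using that[of "{a, b}"] corners_edge[OF assms, of "{a, b}"] assms by (auto simp: edge_faces_def)
qed

text \<open>Each face has a side, and each of the finitely many edges borders at most two
  faces.\<close>

lemma finFs: "finite Fs"
proof (rule finite_subset)
  show "Fs \<subseteq> (\<Union>e\<in>E. edge_faces e)" using corner_edge_exists by blast
  show "finite (\<Union>e\<in>E. edge_faces e)" using finE edge_faces_card(1) by blast
qed

end

section \<open>Carriers, open stars and connectedness\<close>

context surface_triangulation begin

text \<open>The vertex set of the open cell (vertex, edge or face) that contains
  \<open>p\<close>.\<close>

definition carrier :: "'a \<Rightarrow> 'a set" where
  "carrier p = (if p \<in> V then {p} else if \<exists>e\<in>E. p \<in> \<alpha> e then (THE e. e \<in> E \<and> p \<in> \<alpha> e)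
     else corners (THE F. F \<in> Fs \<and> p \<in> F))"

lemma carrier_vertex: "v \<in> V \<Longrightarrow> carrier v = {v}"
  by (simp add: carrier_def)

lemma carrier_edge: assumes "e \<in> E" "p \<in> \<alpha> e" "p \<notin> e" shows "carrier p = e"
proof -
  have "p \<notin> V" using assms arc_V by blast
  moreover have "(THE e. e \<in> E \<and> p \<in> \<alpha> e) = e"
    by (rule the_equality) (use assms arc_inter(1) in blast)+
  moreover have "\<exists>e\<in>E. p \<in> \<alpha> e" using assms by blast
  ultimately show ?thesis by (simp add: carrier_def)
qed

lemma carrier_face: assumes "F \<in> Fs" "p \<in> F" shows "carrier p = corners F"
proof -
  have "(THE F. F \<in> Fs \<and> p \<in> F) = F"
    by (rule the_equality) (use assms Fs_disjoint in blast)+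
  moreover have "p \<notin> V" "\<not> (\<exists>e\<in>E. p \<in> \<alpha> e)" using assms face_graph_disjoint by blast+
  ultimately show ?thesis by (simp add: carrier_def)
qed

lemma point_cases:
  assumes "p \<in> topspace S"
  obtains "p \<in> V" | e where "e \<in> E" "p \<in> \<alpha> e" "p \<notin> e" | F where "F \<in> Fs" "p \<in> F"
proof -
  have "p \<in> V \<or> (\<exists>e\<in>E. p \<in> \<alpha> e \<and> p \<notin> e) \<or> p \<in> \<Union>Fs"
    using assms Union_Fs edge by blast
  then show ?thesis using that by blast
qed

lemma carrier_arc: assumes "e \<in> E" "p \<in> \<alpha> e" shows "carrier p \<subseteq> e"
proof (cases "p \<in> e")
  case True
  then show ?thesis using carrier_vertex edge[OF assms(1)] by auto
next
  case False
  then show ?thesis using carrier_edge[OF assms] by simp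
qed

lemma carrier_closure: assumes "F \<in> Fs" "p \<in> S closure_of F" shows "carrier p \<subseteq> corners F"
proof -
  consider "p \<in> F" | e where "e \<subseteq> corners F" "card e = 2" "p \<in> \<alpha> e"
    using assms(2) unfolding closure_face[OF assms(1)] by blast
  then show ?thesis
  proof cases
    case 1 then show ?thesis using carrier_face[OF assms(1)] by simp
  next
    case 2 then show ?thesis using carrier_arc[OF corners_edge[OF assms(1)]] by blast
  qed
qed

text \<open>All closed cells that miss \<open>x\<close> are removed. There are finitely many, so the
  rest is open, and each cell that meets it has \<open>x\<close> in its closure; hence carriers can
  only grow near \<open>x\<close>.\<close>

definition star :: "'a \<Rightarrow> 'a set" where
  "star x = topspace S - ((V - {x}) \<union> \<Union> (\<alpha> ` {e\<in>E. x \<notin> \<alpha> e}) \<union> \<Union> ((closure_of) S ` {F\<in>Fs. x \<notin> S closure_of F}))"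

lemma star_open: "openin S (star x)"
  unfolding star_def
proof (intro openin_diff openin_topspace closedin_Un closedin_Union)
  have "finite (V - {x})" using finV by simp
  then show "closedin S (V - {x})" using V_sub Hausdorff
    by (meson Diff_subset closedin_Hausdorff_finite subset_trans)
qed (use finE finFs arc_closedin in auto)

lemma star_self: "x \<in> topspace S \<Longrightarrow> x \<in> star x"
  by (auto simp: star_def)

lemma star_sub: "star x \<subseteq> topspace S"
  by (auto simp: star_def)

lemma star_carrier:
  assumes "p \<in> star x" shows "carrier x \<subseteq> carrier p"
proof -
  have "p \<in> topspace S" using assms by (simp add: star_def)
  then show ?thesis
  proof (cases rule: point_cases)
    case 1
    then have "p = x" using assms by (auto simp: star_def)
    then show ?thesis by simp
  next
    case (2 e)
    then have "x \<in> \<alpha> e" using assms by (auto simp: star_def)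
    then show ?thesis using carrier_arc[OF 2(1)] carrier_edge[OF 2] by simp
  next
    case (3 F)
    have "p \<in> S closure_of F" using 3 unfolding closure_face[OF 3(1)] by blast
    then have "x \<in> S closure_of F" using assms 3(1) unfolding star_def by blast
    then show ?thesis using carrier_closure[OF 3(1)] carrier_face[OF 3] by simp
  qed
qed

lemma carrier_clique:
  assumes "p \<in> topspace S" "a \<in> carrier p" "b \<in> carrier p" "a \<noteq> b" shows "{a, b} \<in> E"
  using assms(1)
proof (cases rule: point_cases)
  case 1 then show ?thesis using assms carrier_vertex by auto
next
  case (2 e)
  then have "{a, b} \<subseteq> e" "card e = 2" using carrier_edge assms edge by auto
  then have "{a, b} = e" using assms(4) by (intro card_subset_eq) (auto simp: card_ge_0_finite)
  then show ?thesis using 2 by simp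
next
  case (3 F)
  then show ?thesis using carrier_face assms corners_edge[OF 3(1), of "{a, b}"] by auto
qed

lemma carrier_sub: assumes "p \<in> topspace S" shows "carrier p \<subseteq> V" "carrier p \<noteq> {}"
proof -
  have "carrier p \<subseteq> V \<and> carrier p \<noteq> {}"
    using assms
  proof (cases rule: point_cases)
    case 1 then show ?thesis using carrier_vertex by auto
  next
    case (2 e) then show ?thesis using carrier_edge[OF 2] edge[OF 2(1)] by auto
  next
    case (3 F)
    have ne: "corners F \<noteq> {}" using card_corners[OF 3(1)] by auto
    have "corners F \<subseteq> V"
    proof
      fix a assume a: "a \<in> corners F"
      obtain b where b: "b \<in> corners F" "b \<noteq> a"
        using card_corners[OF 3(1)] a by (metis card_3_iff insertI1 insertI2)
      then have "{a, b} \<in> E" using corners_edge[OF 3(1), of "{a, b}"] a by auto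
      then show "a \<in> V" using edge by blast
    qed
    then show ?thesis using carrier_face[OF 3] ne by simp
  qed
  then show "carrier p \<subseteq> V" "carrier p \<noteq> {}" by auto
qed

text \<open>Without a face at the edge, the arc would contain an open set. With just one, a
  neighbourhood of an interior point of the edge would embed into the closed disc with that point on
  the boundary circle, against invariance of domain.\<close>

lemma edge_two_faces:
  assumes e: "e \<in> E" obtains F1 F2 where "F1 \<noteq> F2" "edge_faces e = {F1, F2}"
proof -
  obtain g where g: "pathin S g" "inj_on g {0..1}" "{g 0, g 1} = e" "g ` {0..1} = \<alpha> e"
    by (rule edge_arc[OF e]) (rule that)
  define x where "x = g (1/2)"
  have xe: "x \<in> \<alpha> e" unfolding x_def using g(4) by force
  have "g (1/2) \<noteq> g 0" "g (1/2) \<noteq> g 1" using inj_onD[OF g(2), of "1/2" 0] inj_onD[OF g(2), of "1/2" 1] by auto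
  then have xne: "x \<notin> e" using g(3) by (auto simp: x_def)
  have xS: "x \<in> topspace S" using xe arc_sub[OF e] by blast
  have cx: "carrier x = e" by (rule carrier_edge[OF e xe xne])
  have W: "p \<in> \<alpha> e \<or> (\<exists>F\<in>edge_faces e. p \<in> F)" if "p \<in> star x" for p
  proof -
    have c: "e \<subseteq> carrier p" using star_carrier[OF that] cx by simp
    have "p \<in> topspace S" using that by (simp add: star_def)
    then show ?thesis
    proof (cases rule: point_cases)
      case 1
      then have "card e \<le> card {p}" using c carrier_vertex by (intro card_mono) auto
      then show ?thesis using edge[OF e] by simp
    next
      case (2 f)
      then have "e \<subseteq> f" using c carrier_edge[OF 2] by simp
      then have "e = f" using edge[OF e] edge[OF 2(1)] by (intro card_subset_eq) (auto simp: card_ge_0_finite)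
      then show ?thesis using 2 by simp
    next
      case (3 F)
      then show ?thesis using c carrier_face[OF 3] by (auto simp: edge_faces_def)
    qed
  qed
  have "\<exists>F. F \<in> edge_faces e"
  proof (rule ccontr)
    assume "\<not> ?thesis"
    then have "star x \<subseteq> g ` {0..1}" using W g(4) by blast
    then show False using arc_no_interior[OF surf g(1,2) star_open star_self[OF xS]] by blast
  qed
  then obtain F1 where F1: "F1 \<in> edge_faces e" by blast
  then have F1': "F1 \<in> Fs" "e \<subseteq> corners F1" by (auto simp: edge_faces_def)
  have "\<exists>F2. F2 \<in> edge_faces e \<and> F2 \<noteq> F1"
  proof (rule ccontr)
    assume no: "\<not> ?thesis"
    have sub: "star x \<subseteq> S closure_of F1"
    proof
      fix p assume "p \<in> star x"
      then have "p \<in> \<alpha> e \<or> p \<in> F1" using W no by blast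
      then show "p \<in> S closure_of F1" unfolding closure_face[OF F1'(1)] using F1'(2) edge[OF e] by blast
    qed
    obtain h :: "real ^ 2 \<Rightarrow> 'a" and k where h: 
      "continuous_map (subtopology S (S closure_of F1)) (top_of_set (cball 0 1)) k"
      "\<And>y. y \<in> cball 0 1 \<Longrightarrow> k (h y) = y" "\<And>y. y \<in> S closure_of F1 \<Longrightarrow> h (k y) = y"
      "h ` sphere 0 1 = \<Union> (\<alpha> ` {e. e \<subseteq> corners F1 \<and> card e = 2})"
      by (rule face_disc[OF F1'(1)]) (rule that)
    obtain q where q: "continuous_map (top_of_set (osq 3)) S q" "inj_on q (osq 3)" "q (0, 0) = x" "q ` osq 3 \<subseteq> star x"
      by (rule surface_chart[OF surf star_open star_self[OF xS]]) (rule that)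
    have qcl: "q ` osq 3 \<subseteq> S closure_of F1" using q(4) sub by blast
    have "continuous_map (top_of_set (osq 3)) (subtopology S (S closure_of F1)) q"
      using q(1) qcl by (simp add: continuous_map_in_subtopology image_subset_iff_funcset)
    then have kq: "continuous_map (top_of_set (osq 3)) (top_of_set (cball 0 1)) (k \<circ> q)" using h(1) by (rule continuous_map_compose)
    then have c: "continuous_on (osq 3) (k \<circ> q)" and im: "(k \<circ> q) ` osq 3 \<subseteq> cball 0 1"
      by (auto simp: continuous_map_in_subtopology)
    have "inj_on (k \<circ> q) (osq 3)"
    proof (rule comp_inj_on[OF q(2)])
      show "inj_on k (q ` osq 3)" using qcl h(3) by (metis inj_on_inverseI subsetD)
    qed
    from invariance_of_domain_gen[OF open_osq c this]
    have op: "open ((k \<circ> q) ` osq 3)" by simp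
    have "x \<in> h ` sphere 0 1" unfolding h(4) using xe F1'(2) edge[OF e] by blast
    then obtain y where y: "y \<in> sphere 0 1" "x = h y" by blast
    then have ky: "k x = y" using h(2)[of y] by auto
    have "(0, 0) \<in> osq 3" by (simp add: osq_def)
    then have "y \<in> (k \<circ> q) ` osq 3" using q(3) ky by (metis comp_apply image_eqI)
    then have "y \<in> interior (cball 0 1)" using op im interior_maximal by blast
    then show False using y(1) by simp
  qed
  then obtain F2 where F2: "F2 \<in> edge_faces e" "F2 \<noteq> F1" by blast
  then have "edge_faces e = {F1, F2}" using edge_faces_le_2[OF e F1 F2(1)] F1 by blast
  then show ?thesis using that F2 by metis
qed

text \<open>A carrier is a clique, so it lies in \<open>A\<close> as soon as it meets
  \<open>A\<close>. Together with \<open>star_carrier\<close> this makes the points whose carrier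
  meets \<open>A\<close>, and the remaining points, two open sets of a connected space.\<close>

lemma graph_connected:
  assumes A: "A \<subseteq> V" "A \<noteq> {}" and cl: "\<And>a b. a \<in> A \<Longrightarrow> {a, b} \<in> E \<Longrightarrow> b \<in> A"
  shows "A = V"
proof -
  have conn: "connected_space S" using surf by (simp add: surface_def)
  define X where "X = {p \<in> topspace S. carrier p \<inter> A \<noteq> {}}"
  define Y where "Y = {p \<in> topspace S. carrier p \<inter> A = {}}"
  have X_iff: "carrier p \<subseteq> A" if "p \<in> X" for p
    using that cl carrier_clique[of p] unfolding X_def by blast
  have "openin S X"
  proof (subst openin_subopen, intro ballI)
    fix x assume x: "x \<in> X"
    have "star x \<subseteq> X" using x star_carrier[of _ x] star_sub[of x] unfolding X_def by blast
    then show "\<exists>T. openin S T \<and> x \<in> T \<and> T \<subseteq> X" using star_open[of x] star_self[of x] x unfolding X_def by (intro exI[of _ "star x"]) simp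
  qed
  moreover have "openin S Y"
  proof (subst openin_subopen, intro ballI)
    fix x assume x: "x \<in> Y"
    have "star x \<subseteq> Y"
    proof
      fix p assume p: "p \<in> star x"
      then have pS: "p \<in> topspace S" by (simp add: star_def)
      have "p \<notin> X"
      proof
        assume "p \<in> X"
        then have "carrier x \<subseteq> A" using X_iff star_carrier[OF p] by blast
        then show False using x carrier_sub(2)[of x] unfolding Y_def by blast
      qed
      then show "p \<in> Y" using pS by (auto simp: X_def Y_def)
    qed
    then show "\<exists>T. openin S T \<and> x \<in> T \<and> T \<subseteq> Y" using star_open[of x] star_self[of x] x unfolding Y_def by (intro exI[of _ "star x"]) simp
  qed
  moreover have "X \<inter> Y = {}" "topspace S \<subseteq> X \<union> Y" by (auto simp: X_def Y_def)
  moreover have "X \<noteq> {}" using A V_sub carrier_vertex unfolding X_def by blast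
  ultimately have Y: "Y = {}" using conn unfolding connected_space_def by blast
  have "v \<in> A" if "v \<in> V" for v
  proof -
    have "v \<in> X" using Y that V_sub by (auto simp: X_def Y_def)
    then show ?thesis using that carrier_vertex by (auto simp: X_def)
  qed
  then show ?thesis using A by blast
qed

text \<open>A vertex has small neighbourhoods that remain connected when the vertex is removed.\<close>

lemma link_connected:
  assumes v: "v \<in> V" and A: "A \<subseteq> {u. {v, u} \<in> E}" "A \<noteq> {}"
    and cl: "\<And>F. F \<in> Fs \<Longrightarrow> v \<in> corners F \<Longrightarrow> corners F \<inter> A \<noteq> {} \<Longrightarrow> corners F - {v} \<subseteq> A"
  shows "A = {u. {v, u} \<in> E}"
proof (rule ccontr)
  assume "A \<noteq> {u. {v, u} \<in> E}"
  then obtain b where b: "{v, b} \<in> E" "b \<notin> A" using A by blast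
  obtain a where a: "a \<in> A" "{v, a} \<in> E" using A by blast
  have vS: "v \<in> topspace S" using v V_sub by blast
  have vA: "v \<notin> A" using A edge by fastforce
  obtain q where q: "continuous_map (top_of_set (osq 3)) S q" "inj_on q (osq 3)" "q (0, 0) = v" "q ` osq 3 \<subseteq> star v"
    by (rule surface_chart[OF surf star_open star_self[OF vS]]) (rule that)
  define Z where "Z = q ` (osq 3 - {(0, 0)})"
  have Zop: "openin S Z" unfolding Z_def
    by (rule surface_open_chart_image[OF surf q(1,2)]) (auto simp: open_osq open_delete)
  have Zall: "openin S (q ` osq 3)" by (rule surface_open_chart_image[OF surf q(1,2) open_osq]) simp
  have o: "(0, 0) \<in> osq 3" by (simp add: osq_def)
  have vZ: "v \<notin> Z"
  proof
    assume "v \<in> Z"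
    then obtain p where p: "p \<in> osq 3 - {(0, 0)}" "v = q p" unfolding Z_def by (rule imageE)
    then have "q p = q (0, 0)" using q(3) by simp
    then show False using inj_onD[OF q(2) _ _ o, of p] p(1) by simp
  qed
  have Zeq: "q ` osq 3 = insert v Z" using q(3) o unfolding Z_def by (metis image_insert insert_Diff)
  have "connected (osq 3 - {(0, 0)})"
    by (rule connected_open_delete) (auto simp: open_osq convex_osq convex_connected)
  then have "connectedin (top_of_set (osq 3)) (osq 3 - {(0, 0)})" by (auto simp: connectedin_subtopology)
  then have Zc: "connectedin S Z" unfolding Z_def by (rule connectedin_continuous_map_image[OF q(1)])
  have Zstar: "Z \<subseteq> star v" using Zeq q(4) by blast
  have ZS: "Z \<subseteq> topspace S" using Zop openin_subset by blast
  have Zpt: "v \<in> carrier p \<and> p \<notin> V" if "p \<in> Z" for p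
  proof -
    have ps: "p \<in> star v" using that Zstar by blast
    then have "v \<in> carrier p" using star_carrier[OF ps] carrier_vertex[OF v] by simp
    moreover have "p \<notin> V" using ps that vZ unfolding star_def by blast
    ultimately show ?thesis by simp
  qed
  have dich: "carrier p - {v} \<subseteq> A" if p: "p \<in> Z" and cA: "carrier p \<inter> A \<noteq> {}" for p
  proof -
    have "p \<in> topspace S" using p ZS by blast
    then show ?thesis
    proof (cases rule: point_cases)
      case 1 then show ?thesis using Zpt[OF p] by blast
    next
      case (2 e)
      then have ce: "carrier p = e" by (rule carrier_edge)
      obtain y where y: "y \<in> e" "y \<in> A" using cA ce by blast
      have "v \<in> e" using Zpt[OF p] ce by simp
      moreover have "v \<noteq> y" using y vA by blast
      ultimately have "{v, y} = e" using y edge[OF 2(1)] by (intro card_subset_eq) (auto simp: card_ge_0_finite)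
      then show ?thesis using ce y by auto
    next
      case (3 F)
      then show ?thesis using cl[OF 3(1)] carrier_face[OF 3] Zpt[OF p] cA by simp
    qed
  qed
  have other: "carrier p - {v} \<noteq> {}" if p: "p \<in> Z" for p
  proof
    assume "carrier p - {v} = {}"
    then have cp: "carrier p = {v}" using Zpt[OF p] by blast
    have "p \<in> topspace S" using p ZS by blast
    then show False
    proof (cases rule: point_cases)
      case 1 then show ?thesis using Zpt[OF p] by blast
    next
      case (2 e) then show ?thesis using carrier_edge[OF 2] cp edge[OF 2(1)] by auto
    next
      case (3 F)
      have "corners F = {v}" using carrier_face[OF 3] cp by simp
      then show ?thesis using card_corners[OF 3(1)] by simp
    qed
  qed
  \<comment> \<open>The two sets split the connected punctured neighbourhood \<open>Z\<close> into
    open parts. By \<open>near\<close> neither is empty, as \<open>Z\<close> meets the edges from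
    \<open>v\<close> to \<open>a\<close> and to \<open>b\<close>.\<close>
  define M where "M = {p\<in>Z. carrier p \<inter> A \<noteq> {}}"
  define M' where "M' = {p\<in>Z. carrier p \<inter> A = {}}"
  have "openin S M"
  proof (subst openin_subopen, intro ballI)
    fix x assume x: "x \<in> M"
    then have xZ: "x \<in> Z" by (simp add: M_def)
    have "Z \<inter> star x \<subseteq> M" using x star_carrier[of _ x] unfolding M_def by blast
    then show "\<exists>T. openin S T \<and> x \<in> T \<and> T \<subseteq> M"
      using openin_Int[OF Zop star_open[of x]] star_self[of x] xZ ZS by blast
  qed
  moreover have "openin S M'"
  proof (subst openin_subopen, intro ballI)
    fix x assume x: "x \<in> M'"
    then have xZ: "x \<in> Z" by (simp add: M'_def)
    have "Z \<inter> star x \<subseteq> M'"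
    proof
      fix p assume p: "p \<in> Z \<inter> star x"
      have "carrier p \<inter> A = {}"
      proof (rule ccontr)
        assume "carrier p \<inter> A \<noteq> {}"
        then have "carrier p - {v} \<subseteq> A" using dich p by blast
        then have "carrier x - {v} \<subseteq> A" using star_carrier[of p x] p by blast
        then show False using other[OF xZ] x unfolding M'_def by blast
      qed
      then show "p \<in> M'" using p by (simp add: M'_def)
    qed
    then show "\<exists>T. openin S T \<and> x \<in> T \<and> T \<subseteq> M'"
      using openin_Int[OF Zop star_open[of x]] star_self[of x] xZ ZS by blast
  qed
  moreover have near: "\<exists>p\<in>Z. carrier p = {v, u}" if u: "{v, u} \<in> E" for u
  proof -
    obtain g where g: "pathin S g" "inj_on g {0..1}" "{g 0, g 1} = {v, u}" "g ` {0..1} = \<alpha> {v, u}"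
      by (rule edge_arc[OF u]) (rule that)
    obtain s0 where s0: "s0 = 0 \<or> s0 = 1" "g s0 = v" using g(3) by (metis doubleton_eq_iff)
    define T where "T = {s\<in>{0..1}. g s \<in> q ` osq 3}"
    have "openin (top_of_set {0..1}) {s\<in>topspace (top_of_set {0..1}). g s \<in> q ` osq 3}"
      using g(1) Zall unfolding pathin_def by (rule openin_continuous_map_preimage)
    then have "openin (top_of_set {0..1}) T" by (simp add: T_def)
    moreover have "s0 \<in> T" using s0 Zeq by (auto simp: T_def)
    ultimately obtain d where d: "d > 0" "\<And>s. s \<in> {0..1} \<Longrightarrow> dist s s0 < d \<Longrightarrow> s \<in> T"
      by (auto simp: openin_euclidean_subtopology_iff)
    define s where "s = (if s0 = 0 then min (d / 2) (1 / 2) else 1 - min (d / 2) (1 / 2))"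
    have s: "0 < s" "s < 1" "dist s s0 < d" using d(1) s0(1) by (auto simp: s_def dist_real_def)
    then have "s \<in> T" using d(2) by simp
    then have gs: "g s \<in> q ` osq 3" by (simp add: T_def)
    have "g s \<noteq> g 0" "g s \<noteq> g 1" using inj_onD[OF g(2), of s 0] inj_onD[OF g(2), of s 1] s by auto
    then have ne: "g s \<notin> {v, u}" using g(3) by auto
    then have "g s \<in> Z" using gs Zeq by blast
    moreover have "g s \<in> \<alpha> {v, u}" using g(4) s by force
    ultimately show ?thesis using carrier_edge[OF u _ ne] by blast
  qed
  moreover have "M \<noteq> {}" using near[OF a(2)] a(1) unfolding M_def by blast
  moreover have "M' \<noteq> {}"
  proof -
    obtain p where "p \<in> Z" "carrier p = {v, b}" using near[OF b(1)] by blast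
    then have "p \<in> M'" using b(2) vA by (simp add: M'_def)
    then show ?thesis by blast
  qed
  moreover have "Z \<subseteq> M \<union> M'" "M \<inter> M' \<inter> Z = {}" "M \<inter> Z = M" "M' \<inter> Z = M'" by (auto simp: M_def M'_def)
  ultimately show False using Zc unfolding connectedin by metis
qed

end

section \<open>A lower bound for the Euler characteristic\<close>

definition csq :: "real \<Rightarrow> (real \<times> real) set" where
  "csq r = {-r..r} \<times> {-r..r}"

lemma osq_csq: "osq r \<subseteq> csq r" and csq_osq: "r < s \<Longrightarrow> csq r \<subseteq> osq s" and csq_mono: "r \<le> s \<Longrightarrow> csq r \<subseteq> csq s"
  and osq_mono: "r \<le> s \<Longrightarrow> osq r \<subseteq> osq s"
  by (auto simp: csq_def osq_def)

lemma locally_constant_connected: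
  assumes C: "connectedin S C" and loc: "\<And>x. x \<in> C \<Longrightarrow> \<exists>N. openin S N \<and> x \<in> N \<and> (\<forall>p\<in>N \<inter> C. P p = P x)"
    and ab: "a \<in> C" "b \<in> C"
  shows "P a = (P b :: bool)"
proof (rule ccontr)
  assume ne: "P a \<noteq> P b"
  define U where "U = (\<lambda>v. \<Union>{N. openin S N \<and> (\<forall>p\<in>N \<inter> C. P p = v)})"
  have op: "openin S (U v)" for v unfolding U_def by (rule openin_Union) blast
  have val: "P p = v" if "p \<in> U v" "p \<in> C" for p v using that unfolding U_def by blast
  have mem: "x \<in> U (P x)" if "x \<in> C" for x using loc[OF that] unfolding U_def by blast
  have "C \<subseteq> U True \<union> U False"
  proof
    fix x assume "x \<in> C"
    then show "x \<in> U True \<union> U False" using mem[of x] by (cases "P x") auto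
  qed
  moreover have "U True \<inter> U False \<inter> C = {}" using val by blast
  moreover have "U True \<inter> C \<noteq> {}" "U False \<inter> C \<noteq> {}" using mem[OF ab(1)] mem[OF ab(2)] ab ne by (cases "P a"; auto)+
  ultimately show False using C op[of True] op[of False] unfolding connectedin by metis
qed

definition is_chart :: "'a topology \<Rightarrow> (real \<times> real \<Rightarrow> 'a) \<Rightarrow> bool" where
  "is_chart S q \<longleftrightarrow> continuous_map (top_of_set (osq 3)) S q \<and> inj_on q (osq 3)"

lemma chart_open: "surface S \<Longrightarrow> is_chart S q \<Longrightarrow> r \<le> 3 \<Longrightarrow> openin S (q ` osq r)"
  unfolding is_chart_def by (intro surface_open_chart_image) (auto simp: open_osq osq_mono)

lemma chart_image:
  assumes q: "is_chart S q" and A: "A \<subseteq> osq 3"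
  shows "compact A \<Longrightarrow> compactin S (q ` A)" "connected A \<Longrightarrow> connectedin S (q ` A)" "q ` A \<subseteq> topspace S"
proof -
  have c: "continuous_map (top_of_set (osq 3)) S q" using q by (simp add: is_chart_def)
  show "compactin S (q ` A)" if "compact A"
    by (rule image_compactin[OF _ c]) (use that A in \<open>simp add: compactin_subtopology\<close>)
  show "connectedin S (q ` A)" if "connected A"
    by (rule connectedin_continuous_map_image[OF c]) (use that A in \<open>simp add: connectedin_subtopology\<close>)
  show "q ` A \<subseteq> topspace S" using c A by (auto simp: continuous_map_def)
qed

text \<open>Overlaps of charts can have infinitely many components. Between the squares of
  half-width 1 and 2, compactness provides finitely many marked points \<open>A i j\<close> such
  that each point of the smaller overlap is joined to one of them inside the larger one.\<close>

lemma finite_atlas: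
  fixes S :: "'a topology"
  assumes S: "surface S"
  obtains I :: "'a set" and q :: "'a \<Rightarrow> real \<times> real \<Rightarrow> 'a" and A :: "'a \<Rightarrow> 'a \<Rightarrow> 'a set"
  where "finite I" "\<And>i. i \<in> I \<Longrightarrow> is_chart S (q i)" "topspace S \<subseteq> (\<Union>i\<in>I. q i ` osq 1)"
    "\<And>i j. i \<in> I \<Longrightarrow> j \<in> I \<Longrightarrow> finite (A i j)"
    "\<And>i j y. i \<in> I \<Longrightarrow> j \<in> I \<Longrightarrow> y \<in> q i ` csq 1 \<inter> q j ` csq 1 \<Longrightarrow>
       \<exists>x\<in>A i j. \<exists>C. connectedin S C \<and> x \<in> C \<and> y \<in> C \<and> C \<subseteq> q i ` csq 2 \<inter> q j ` csq 2"
proof -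
  have comp: "compactin S (topspace S)" using S by (simp add: surface_def compact_space_def)
  have ch: "\<exists>q. is_chart S q \<and> q (0, 0) = x \<and> q ` osq 3 \<subseteq> W" if "openin S W" "x \<in> W" for x W
    using surface_chart[OF S that] unfolding is_chart_def by metis
  have zero: "(0, 0) \<in> osq r" if "r > 0" for r using that by (simp add: osq_def)
  have "\<forall>x\<in>topspace S. \<exists>q. is_chart S q \<and> q (0, 0) = x" using ch[OF openin_topspace] by blast
  then obtain q where q: "\<And>x. x \<in> topspace S \<Longrightarrow> is_chart S (q x) \<and> q x (0, 0) = x" by metis
  have "\<exists>\<F>. finite \<F> \<and> \<F> \<subseteq> (\<lambda>x. q x ` osq 1) ` topspace S \<and> topspace S \<subseteq> \<Union>\<F>"
  proof (rule compactinD[OF comp])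
    show "openin S U" if "U \<in> (\<lambda>x. q x ` osq 1) ` topspace S" for U using that q chart_open[OF S] by force
    show "topspace S \<subseteq> \<Union> ((\<lambda>x. q x ` osq 1) ` topspace S)"
      using q zero[of 1] by (force intro: image_eqI[of _ _ "(0, 0)"])
  qed
  then obtain I where I: "finite I" "I \<subseteq> topspace S" "topspace S \<subseteq> (\<Union>i\<in>I. q i ` osq 1)"
    by (metis finite_subset_image)
  have qI: "is_chart S (q i)" if "i \<in> I" for i using q that I by blast
  have "\<exists>A. finite A \<and> (\<forall>y\<in>q i ` csq 1 \<inter> q j ` csq 1.
      \<exists>x\<in>A. \<exists>C. connectedin S C \<and> x \<in> C \<and> y \<in> C \<and> C \<subseteq> q i ` csq 2 \<inter> q j ` csq 2)" if ij: "i \<in> I" "j \<in> I" for i j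
  proof -
    define K where "K = q i ` csq 1 \<inter> q j ` csq 1"
    define W where "W = q i ` osq 2 \<inter> q j ` osq 2"
    have W: "openin S W" unfolding W_def using chart_open[OF S qI] ij by (intro openin_Int) auto
    have KW: "K \<subseteq> W" unfolding K_def W_def using csq_osq[of 1 2] by auto
    have cc: "compact (csq 1)" by (simp add: csq_def compact_Times)
    have "csq 1 \<subseteq> osq 3" by (rule csq_osq) simp
    then have c: "compactin S (q i ` csq 1)" "compactin S (q j ` csq 1)"
      using chart_image(1)[OF qI _ cc] ij by auto
    have "closedin S (q j ` csq 1)" using c(2) S compactin_imp_closedin unfolding surface_def by blast
    then have K: "compactin S K" unfolding K_def using c(1) compact_Int_closedin by blast
    have "\<forall>x\<in>K. \<exists>c. is_chart S c \<and> c (0, 0) = x \<and> c ` osq 3 \<subseteq> W" using ch[OF W] subsetD[OF KW] by simp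
    then obtain c where c: "\<And>x. x \<in> K \<Longrightarrow> is_chart S (c x) \<and> c x (0, 0) = x \<and> c x ` osq 3 \<subseteq> W" by metis
    have "\<exists>\<F>. finite \<F> \<and> \<F> \<subseteq> (\<lambda>x. c x ` osq 3) ` K \<and> K \<subseteq> \<Union>\<F>"
    proof (rule compactinD[OF K])
      show "openin S U" if "U \<in> (\<lambda>x. c x ` osq 3) ` K" for U using that c chart_open[OF S, of _ 3] by force
      show "K \<subseteq> \<Union> ((\<lambda>x. c x ` osq 3) ` K)"
      proof
        fix x assume x: "x \<in> K"
        have "x \<in> c x ` osq 3" using c[OF x] zero[of 3] by (intro image_eqI[of _ _ "(0, 0)"]) auto
        then show "x \<in> \<Union> ((\<lambda>x. c x ` osq 3) ` K)" using x by blast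
      qed
    qed
    then obtain A where A: "finite A" "A \<subseteq> K" "K \<subseteq> (\<Union>x\<in>A. c x ` osq 3)" by (metis finite_subset_image)
    have "\<exists>x\<in>A. \<exists>C. connectedin S C \<and> x \<in> C \<and> y \<in> C \<and> C \<subseteq> q i ` csq 2 \<inter> q j ` csq 2" if y: "y \<in> K" for y
    proof -
      obtain x where x: "x \<in> A" "y \<in> c x ` osq 3" using A(3) y by blast
      have cx: "is_chart S (c x)" "c x (0, 0) = x" "c x ` osq 3 \<subseteq> W" using c[of x] x(1) A(2) by blast+
      have "connectedin S (c x ` osq 3)"
        by (rule chart_image(2)[OF cx(1)]) (auto simp: convex_connected convex_osq)
      moreover have "x \<in> c x ` osq 3" using cx(2) zero[of 3] by (intro image_eqI[of _ _ "(0, 0)"]) auto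
      moreover have "c x ` osq 3 \<subseteq> q i ` csq 2 \<inter> q j ` csq 2" using cx(3) osq_csq[of 2] unfolding W_def by blast
      ultimately show ?thesis using x by blast
    qed
    then show ?thesis using A(1) unfolding K_def by blast
  qed
  then obtain A where A: "\<And>i j. i \<in> I \<Longrightarrow> j \<in> I \<Longrightarrow> finite (A i j) \<and> (\<forall>y\<in>q i ` csq 1 \<inter> q j ` csq 1.
      \<exists>x\<in>A i j. \<exists>C. connectedin S C \<and> x \<in> C \<and> y \<in> C \<and> C \<subseteq> q i ` csq 2 \<inter> q j ` csq 2)" by metis
  show ?thesis
  proof (rule that[of I q A])
    show "\<exists>x\<in>A i j. \<exists>C. connectedin S C \<and> x \<in> C \<and> y \<in> C \<and> C \<subseteq> q i ` csq 2 \<inter> q j ` csq 2"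
      if "i \<in> I" "j \<in> I" "y \<in> q i ` csq 1 \<inter> q j ` csq 1" for i j y
      using A[OF that(1,2)] that(3) by (elim conjE) (rule bspec)
  qed (use I qI A in simp_all)
qed

section \<open>Cocycles modulo 2 and their potentials\<close>

context surface_triangulation begin

definition rep :: "'a \<Rightarrow> 'a" where "rep p = (SOME a. a \<in> carrier p)"

lemma rep: "p \<in> topspace S \<Longrightarrow> rep p \<in> carrier p"
  unfolding rep_def by (rule someI_ex) (use carrier_sub(2) in blast)

lemma rep_vertex: "v \<in> V \<Longrightarrow> rep v = v"
  unfolding rep_def by (simp add: carrier_vertex)

text \<open>A simplicial 1-cocycle over the field with two elements; inequality of truth values is
  addition.\<close>

definition cocycle :: "('a \<Rightarrow> 'a \<Rightarrow> bool) \<Rightarrow> bool" where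
  "cocycle z \<longleftrightarrow> (\<forall>a b. z a b = z b a) \<and> (\<forall>a. \<not> z a a) \<and>
     (\<forall>F\<in>Fs. \<forall>a\<in>corners F. \<forall>b\<in>corners F. \<forall>c\<in>corners F. (z a b \<noteq> z b c) = z a c)"

lemma cocycle_carrier:
  assumes "cocycle z" "p \<in> topspace S" and abc: "a \<in> carrier p" "b \<in> carrier p" "c \<in> carrier p"
  shows "(z a b \<noteq> z b c) = z a c"
proof -
  have z: "z a b = z b a" "\<not> z a a" for a b using assms(1) by (simp_all add: cocycle_def)
  have eq: "(z a b \<noteq> z b c) = z a c" if "a = b \<or> b = c \<or> a = c" using that z by auto
  show ?thesis using assms(2)
  proof (cases rule: point_cases)
    case 1 then show ?thesis using eq abc by (simp add: carrier_vertex)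
  next
    case (2 e)
    then have "a \<in> e" "b \<in> e" "c \<in> e" "card e = 2" using abc carrier_edge edge by auto
    then show ?thesis using eq by (auto simp: card_2_iff)
  next
    case (3 F) then show ?thesis using assms(1) abc carrier_face[OF 3] unfolding cocycle_def by simp
  qed
qed

text \<open>A cocycle describes a double cover of the surface; a potential is a section of it, compared with the
  section over the open star of a vertex by way of an arbitrary vertex \<open>rep p\<close> of the cell of \<open>p\<close>.\<close>

definition pot :: "('a \<Rightarrow> 'a \<Rightarrow> bool) \<Rightarrow> 'a set \<Rightarrow> ('a \<Rightarrow> bool) \<Rightarrow> bool" where
  "pot z X s \<longleftrightarrow> (\<forall>x\<in>X. \<exists>N. openin S N \<and> x \<in> N \<and> (\<forall>p\<in>N \<inter> X. (s p \<noteq> s x) = z (rep p) (rep x)))"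

lemma pot_subset: assumes "pot z X s" "Y \<subseteq> X" shows "pot z Y s"
  unfolding pot_def
proof
  fix x assume "x \<in> Y"
  then obtain N where "openin S N" "x \<in> N" "\<forall>p\<in>N \<inter> X. (s p \<noteq> s x) = z (rep p) (rep x)"
    using assms unfolding pot_def by blast
  then show "\<exists>N. openin S N \<and> x \<in> N \<and> (\<forall>p\<in>N \<inter> Y. (s p \<noteq> s x) = z (rep p) (rep x))"
    using assms(2) by (intro exI[of _ N]) auto
qed

text \<open>All carriers in the star contain \<open>rep x\<close>, so the cocycle condition is
  applied inside a single cell.\<close>

lemma pot_star:
  assumes z: "cocycle z" and x: "x \<in> topspace S"
  shows "pot z (star x) (\<lambda>p. z (rep p) (rep x))"
  unfolding pot_def
proof (intro ballI exI conjI)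
  fix y assume y: "y \<in> star x"
  then have yS: "y \<in> topspace S" using star_sub by blast
  show "openin S (star y)" by (rule star_open)
  show "y \<in> star y" by (rule star_self[OF yS])
  fix p assume p: "p \<in> star y \<inter> star x"
  then have pS: "p \<in> topspace S" using star_sub by blast
  have "rep p \<in> carrier p" "rep x \<in> carrier p" "rep y \<in> carrier p"
    using rep[OF pS] rep[OF x] rep[OF yS] star_carrier[of p x] star_carrier[of p y] p by auto
  then have "(z (rep p) (rep x) \<noteq> z (rep x) (rep y)) = z (rep p) (rep y)"
    by (intro cocycle_carrier[OF z pS])
  then show "(z (rep p) (rep x) \<noteq> z (rep y) (rep x)) = z (rep p) (rep y)" using z unfolding cocycle_def by metis
qed

lemma pot_flip: "pot z X s \<Longrightarrow> pot z X (\<lambda>p. \<not> s p)"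
  unfolding pot_def by simp

text \<open>The transition term is the same for both potentials and cancels.\<close>

lemma pot_difference_locally_constant:
  assumes "pot z X s" "pot z X s'" "x \<in> X"
  shows "\<exists>N. openin S N \<and> x \<in> N \<and> (\<forall>p\<in>N \<inter> X. (s p \<noteq> s' p) = (s x \<noteq> s' x))"
proof -
  obtain N where N: "openin S N" "x \<in> N" "\<forall>p\<in>N \<inter> X. (s p \<noteq> s x) = z (rep p) (rep x)"
    using assms(1,3) unfolding pot_def by blast
  obtain N' where N': "openin S N'" "x \<in> N'" "\<forall>p\<in>N' \<inter> X. (s' p \<noteq> s' x) = z (rep p) (rep x)"
    using assms(2,3) unfolding pot_def by blast
  have "(s p \<noteq> s' p) = (s x \<noteq> s' x)" if "p \<in> N \<inter> N' \<inter> X" for p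
    using that N(3) N'(3) by blast
  then show ?thesis using N N' by (intro exI[of _ "N \<inter> N'"]) auto
qed

lemma pot_difference_constant:
  assumes "pot z X s" "pot z X s'" "connectedin S C" "C \<subseteq> X" "a \<in> C" "b \<in> C"
  shows "(s a \<noteq> s' a) = (s b \<noteq> s' b)"
proof (rule locally_constant_connected[OF assms(3) _ assms(5,6)])
  fix x assume "x \<in> C"
  then show "\<exists>N. openin S N \<and> x \<in> N \<and> (\<forall>p\<in>N \<inter> C. (s p \<noteq> s' p) = (s x \<noteq> s' x))"
    using pot_difference_locally_constant[OF pot_subset[OF assms(1,4)] pot_subset[OF assms(2,4)]] by blast
qed

text \<open>On the connected intersection the potentials agree everywhere or differ everywhere, and
  in the second case one of them is negated. Closedness gives a point outside a piece a
  neighbourhood that avoids this piece.\<close>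

lemma pot_glue:
  assumes 1: "pot z X1 s1" "closedin S X1" and 2: "pot z X2 s2" "closedin S X2" and con: "connectedin S (X1 \<inter> X2)"
  shows "\<exists>s. pot z (X1 \<union> X2) s"
proof -
  obtain s2' where s2': "pot z X2 s2'" "\<forall>x\<in>X1 \<inter> X2. s1 x = s2' x"
  proof (cases "\<exists>x\<in>X1 \<inter> X2. s1 x \<noteq> s2 x")
    case False then show ?thesis using that 2 by blast
  next
    case True
    then obtain x where x: "x \<in> X1 \<inter> X2" "s1 x \<noteq> s2 x" by blast
    have "s1 y \<noteq> s2 y" if "y \<in> X1 \<inter> X2" for y
      using pot_difference_constant[OF pot_subset[OF 1(1)] pot_subset[OF 2(1)] con _ x(1) that, of "X1 \<inter> X2"] x(2) by blast
    then show ?thesis using that[of "\<lambda>p. \<not> s2 p"] pot_flip[OF 2(1)] by blast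
  qed
  define s where "s = (\<lambda>p. if p \<in> X1 then s1 p else s2' p)"
  have s2: "s p = s2' p" if "p \<in> X2" for p using s2'(2) that by (auto simp: s_def)
  have s1: "s p = s1 p" if "p \<in> X1" for p using that by (simp add: s_def)
  have "\<exists>N. openin S N \<and> x \<in> N \<and> (\<forall>p\<in>N \<inter> (X1 \<union> X2). (s p \<noteq> s x) = z (rep p) (rep x))" if x: "x \<in> X1 \<union> X2" for x
  proof -
    have xS: "x \<in> topspace S" using x closedin_subset[OF 1(2)] closedin_subset[OF 2(2)] by blast
    have A: "\<exists>N. openin S N \<and> x \<in> N \<and> (\<forall>p\<in>N \<inter> X1. (s p \<noteq> s x) = z (rep p) (rep x))"
    proof (cases "x \<in> X1")
      case True
      then obtain N where "openin S N" "x \<in> N" "\<forall>p\<in>N \<inter> X1. (s1 p \<noteq> s1 x) = z (rep p) (rep x)"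
        using 1(1) unfolding pot_def by blast
      then show ?thesis using s1 True by (intro exI[of _ N]) auto
    next
      case False
      then show ?thesis using openin_diff[OF openin_topspace 1(2)] xS by (intro exI[of _ "topspace S - X1"]) auto
    qed
    have B: "\<exists>N. openin S N \<and> x \<in> N \<and> (\<forall>p\<in>N \<inter> X2. (s p \<noteq> s x) = z (rep p) (rep x))"
    proof (cases "x \<in> X2")
      case True
      then obtain N where "openin S N" "x \<in> N" "\<forall>p\<in>N \<inter> X2. (s2' p \<noteq> s2' x) = z (rep p) (rep x)"
        using s2'(1) unfolding pot_def by blast
      then show ?thesis using s2 True by (intro exI[of _ N]) auto
    next
      case False
      then show ?thesis using openin_diff[OF openin_topspace 2(2)] xS by (intro exI[of _ "topspace S - X2"]) auto
    qed
    obtain N where N: "openin S N" "x \<in> N" "\<forall>p\<in>N \<inter> X1. (s p \<noteq> s x) = z (rep p) (rep x)" using A by blast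
    obtain N' where N': "openin S N'" "x \<in> N'" "\<forall>p\<in>N' \<inter> X2. (s p \<noteq> s x) = z (rep p) (rep x)" using B by blast
    show ?thesis using N N' by (intro exI[of _ "N \<inter> N'"]) auto
  qed
  then have "pot z (X1 \<union> X2) s" unfolding pot_def by blast
  then show ?thesis by blast
qed

text \<open>A square is simply connected: potentials on small rectangles are glued along common sides.\<close>

lemma pot_chart:
  assumes z: "cocycle z" and q: "is_chart S q"
  shows "\<exists>s. pot z (q ` csq 2) s"
proof -
  define P where "P = (\<lambda>a b c d. \<exists>s. pot z (q ` ({a..b} \<times> {c..d})) s)"
  have H: "Hausdorff_space S" by (rule Hausdorff)
  have sub: "{a..b} \<times> {c..d} \<subseteq> osq 3" if "-2 \<le> a" "b \<le> 2" "-2 \<le> c" "d \<le> 2" for a b c d :: real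
    using that by (auto simp: osq_def)
  have cl: "closedin S (q ` ({a..b} \<times> {c..d}))" if "-2 \<le> a" "b \<le> 2" "-2 \<le> c" "d \<le> 2" for a b c d :: real
    using chart_image(1)[OF q sub[OF that]] H compactin_imp_closedin by (auto simp: compact_Times)
  have inj: "inj_on q (osq 3)" using q by (simp add: is_chart_def)
  have joinx: "P a b' c d" if "P a b c d" "P b b' c d" "a \<le> b" "b \<le> b'" "-2 \<le> a" "b' \<le> 2" "-2 \<le> c" "d \<le> 2" for a b b' c d
  proof -
    have s1: "{a..b} \<times> {c..d} \<subseteq> osq 3" "{b..b'} \<times> {c..d} \<subseteq> osq 3" "{b} \<times> {c..d} \<subseteq> osq 3" using that by (auto simp: osq_def)
    have i: "({a..b} \<times> {c..d}) \<inter> ({b..b'} \<times> {c..d}) = {b} \<times> {c..d}" using that by auto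
    have "q ` ({a..b} \<times> {c..d}) \<inter> q ` ({b..b'} \<times> {c..d}) = q ` ({b} \<times> {c..d})"
      using inj_on_image_Int[OF inj s1(1,2)] unfolding i by simp
    moreover have "connectedin S (q ` ({b} \<times> {c..d}))"
      by (rule chart_image(2)[OF q s1(3)]) (auto intro!: convex_connected convex_Times)
    ultimately have "\<exists>s. pot z (q ` ({a..b} \<times> {c..d}) \<union> q ` ({b..b'} \<times> {c..d})) s"
      using that cl unfolding P_def by (elim exE) (intro pot_glue, auto)
    moreover have "q ` ({a..b} \<times> {c..d}) \<union> q ` ({b..b'} \<times> {c..d}) = q ` ({a..b'} \<times> {c..d})"
      using that by (auto simp flip: image_Un)
    ultimately show ?thesis unfolding P_def by simp
  qed
  have joiny: "P a b c d'" if "P a b c d" "P a b d d'" "c \<le> d" "d \<le> d'" "-2 \<le> a" "b \<le> 2" "-2 \<le> c" "d' \<le> 2" for a b c d d'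
  proof -
    have s1: "{a..b} \<times> {c..d} \<subseteq> osq 3" "{a..b} \<times> {d..d'} \<subseteq> osq 3" "{a..b} \<times> {d} \<subseteq> osq 3" using that by (auto simp: osq_def)
    have i: "({a..b} \<times> {c..d}) \<inter> ({a..b} \<times> {d..d'}) = {a..b} \<times> {d}" using that by auto
    have "q ` ({a..b} \<times> {c..d}) \<inter> q ` ({a..b} \<times> {d..d'}) = q ` ({a..b} \<times> {d})"
      using inj_on_image_Int[OF inj s1(1,2)] unfolding i by simp
    moreover have "connectedin S (q ` ({a..b} \<times> {d}))"
      by (rule chart_image(2)[OF q s1(3)]) (auto intro!: convex_connected convex_Times)
    ultimately have "\<exists>s. pot z (q ` ({a..b} \<times> {c..d}) \<union> q ` ({a..b} \<times> {d..d'})) s"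
      using that cl unfolding P_def by (elim exE) (intro pot_glue, auto)
    moreover have "q ` ({a..b} \<times> {c..d}) \<union> q ` ({a..b} \<times> {d..d'}) = q ` ({a..b} \<times> {c..d'})"
      using that by (auto simp flip: image_Un)
    ultimately show ?thesis unfolding P_def by simp
  qed
  \<comment> \<open>Small rectangles are mapped into one star and so carry a potential. Bolzano's
    bisection principle is then used twice: in the second coordinate for narrow vertical strips, and
    in the first coordinate for the square.\<close>
  have local: "\<exists>\<delta>>0. \<forall>a b c d. a \<le> x \<and> x \<le> b \<and> b - a < \<delta> \<and> c \<le> y \<and> y \<le> d \<and> d - c < \<delta> \<longrightarrow> P a b c d"
    if xy: "-2 \<le> x" "x \<le> 2" "-2 \<le> y" "y \<le> 2" for x y
  proof -
    have m: "(x, y) \<in> osq 3" using xy by (simp add: osq_def)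
    have c: "continuous_map (top_of_set (osq 3)) S q" using q by (simp add: is_chart_def)
    have qS: "q (x, y) \<in> topspace S" using m c by (auto simp: continuous_map_def)
    have "openin (top_of_set (osq 3)) {p \<in> topspace (top_of_set (osq 3)). q p \<in> star (q (x, y))}"
      by (rule openin_continuous_map_preimage[OF c star_open])
    then have "open {p \<in> osq 3. q p \<in> star (q (x, y))}" by (simp add: openin_open_eq open_osq)
    moreover have "(x, y) \<in> {p \<in> osq 3. q p \<in> star (q (x, y))}" using m star_self[OF qS] by simp
    ultimately obtain e where e: "e > 0" "ball (x, y) e \<subseteq> {p \<in> osq 3. q p \<in> star (q (x, y))}"
      using open_contains_ball by blast
    have "P a b c d" if h: "a \<le> x" "x \<le> b" "b - a < e / 2" "c \<le> y" "y \<le> d" "d - c < e / 2" for a b c d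
    proof -
      have "{a..b} \<times> {c..d} \<subseteq> ball (x, y) e"
      proof
        fix p assume p: "p \<in> {a..b} \<times> {c..d}"
        have "dist (x, y) p \<le> dist x (fst p) + dist y (snd p)"
          using sqrt_sum_squares_le_sum_abs[of "dist x (fst p)" "dist y (snd p)"] by (simp add: dist_prod_def)
        also have "\<dots> < e" using p h by (auto simp: dist_real_def)
        finally show "p \<in> ball (x, y) e" by simp
      qed
      then have "q ` ({a..b} \<times> {c..d}) \<subseteq> star (q (x, y))" using e(2) by blast
      then show ?thesis unfolding P_def using pot_subset[OF pot_star[OF z qS]] by blast
    qed
    then show ?thesis using e(1) by (intro exI[of _ "e / 2"]) auto
  qed
  have strip: "\<exists>\<delta>>0. \<forall>a b. a \<le> x \<and> x \<le> b \<and> b - a < \<delta> \<and> -2 \<le> a \<and> b \<le> 2 \<longrightarrow> P a b (-2) 2" if x: "-2 \<le> x" "x \<le> 2" for x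
  proof -
    define Q where "Q = (\<lambda>c d. -2 \<le> c \<and> d \<le> 2 \<longrightarrow>
      (\<exists>\<delta>>0. \<forall>a b. a \<le> x \<and> x \<le> b \<and> b - a < \<delta> \<and> -2 \<le> a \<and> b \<le> 2 \<longrightarrow> P a b c d))"
    have "Q (-2) 2"
    proof (rule Bolzano)
      show "(-2 :: real) \<le> 2" by simp
      fix a b c assume h: "Q a b" "Q b c" "a \<le> b" "b \<le> c"
      show "Q a c" unfolding Q_def
      proof
        assume r: "-2 \<le> a \<and> c \<le> 2"
        then obtain d1 where d1: "d1 > 0" "\<forall>a' b'. a' \<le> x \<and> x \<le> b' \<and> b' - a' < d1 \<and> -2 \<le> a' \<and> b' \<le> 2 \<longrightarrow> P a' b' a b"
          using h unfolding Q_def by (meson order_trans)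
        obtain d2 where d2: "d2 > 0" "\<forall>a' b'. a' \<le> x \<and> x \<le> b' \<and> b' - a' < d2 \<and> -2 \<le> a' \<and> b' \<le> 2 \<longrightarrow> P a' b' b c"
          using h r unfolding Q_def by (meson order_trans)
        show "\<exists>\<delta>>0. \<forall>a' b'. a' \<le> x \<and> x \<le> b' \<and> b' - a' < \<delta> \<and> -2 \<le> a' \<and> b' \<le> 2 \<longrightarrow> P a' b' a c"
          using d1 d2 joiny[of _ _ a b c] h(3,4) r by (intro exI[of _ "min d1 d2"]) auto
      qed
    next
      fix y :: real assume y: "-2 \<le> y" "y \<le> 2"
      obtain \<delta> where \<delta>: "\<delta> > 0" "\<forall>a b c d. a \<le> x \<and> x \<le> b \<and> b - a < \<delta> \<and> c \<le> y \<and> y \<le> d \<and> d - c < \<delta> \<longrightarrow> P a b c d"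
        using local[OF x y] by blast
      then show "\<exists>d>0. \<forall>a b. a \<le> y \<and> y \<le> b \<and> b - a < d \<longrightarrow> Q a b" unfolding Q_def by blast
    qed
    then show ?thesis unfolding Q_def by simp
  qed
  define R where "R = (\<lambda>a b. -2 \<le> a \<and> b \<le> 2 \<longrightarrow> P a b (-2) 2)"
  have "R (-2) 2"
  proof (rule Bolzano)
    show "(-2 :: real) \<le> 2" by simp
    show "R a c" if "R a b" "R b c" "a \<le> b" "b \<le> c" for a b c
      using that joinx[of a b "-2" 2 c] unfolding R_def by auto
    show "\<exists>d>0. \<forall>a b. a \<le> x \<and> x \<le> b \<and> b - a < d \<longrightarrow> R a b" if "-2 \<le> x" "x \<le> 2" for x
      using strip[OF that] unfolding R_def by blast
  qed
  then show ?thesis unfolding R_def P_def csq_def by simp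
qed

text \<open>Along the closed edge the sum of \<open>s p\<close> and \<open>z (rep p) u\<close> is
  locally constant, hence equal at both ends.\<close>

lemma global_pot_coboundary:
  assumes z: "cocycle z" and s: "pot z (topspace S) s" and e: "{u, v} \<in> E"
  shows "z u v = (s u \<noteq> s v)"
proof -
  obtain g where g: "pathin S g" "g ` {0..1} = \<alpha> {u, v}" by (rule edge_arc[OF e]) (rule that)
  have con: "connectedin S (\<alpha> {u, v})" using connectedin_path_image[OF g(1)] g(2) by simp
  have uv: "u \<in> \<alpha> {u, v}" "v \<in> \<alpha> {u, v}" "u \<in> V" "v \<in> V" using edge_sub_arc[OF e] edge[OF e] by auto
  have zz: "z a b = z b a" "\<not> z a a" for a b using z by (simp_all add: cocycle_def)
  have tr: "(z a b \<noteq> z b c) = z a c" if "a \<in> {u, v}" "b \<in> {u, v}" "c \<in> {u, v}" for a b c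
    using that zz by auto
  have "(s u \<noteq> z (rep u) u) = (s v \<noteq> z (rep v) u)"
  proof (rule locally_constant_connected[OF con _ uv(1,2)])
    fix x assume x: "x \<in> \<alpha> {u, v}"
    then have xS: "x \<in> topspace S" using arc_sub[OF e] by blast
    then obtain N where N: "openin S N" "x \<in> N" "\<forall>p\<in>N \<inter> topspace S. (s p \<noteq> s x) = z (rep p) (rep x)"
      using s unfolding pot_def by blast
    have "(s p \<noteq> z (rep p) u) = (s x \<noteq> z (rep x) u)" if p: "p \<in> N \<inter> \<alpha> {u, v}" for p
    proof -
      have pS: "p \<in> topspace S" using p arc_sub[OF e] by blast
      have "rep p \<in> {u, v}" "rep x \<in> {u, v}"
        using rep[OF pS] rep[OF xS] carrier_arc[OF e, of p] carrier_arc[OF e x] p by auto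
      then have "(z (rep p) (rep x) \<noteq> z (rep x) u) = z (rep p) u" by (intro tr) auto
      moreover have "(s p \<noteq> s x) = z (rep p) (rep x)" using N(3) p pS by blast
      ultimately show ?thesis by blast
    qed
    then show "\<exists>N. openin S N \<and> x \<in> N \<and> (\<forall>p\<in>N \<inter> \<alpha> {u, v}. (s p \<noteq> z (rep p) u) = (s x \<noteq> z (rep x) u))"
      using N by blast
  qed
  then show ?thesis using rep_vertex uv zz by metis
qed

end

section \<open>Counting cocycles and edges\<close>

lemma card_le_fibres:
  assumes "finite T" "f ` A \<subseteq> T" "\<And>t. t \<in> T \<Longrightarrow> finite {a\<in>A. f a = t} \<and> card {a\<in>A. f a = t} \<le> k"
  shows "card A \<le> card T * k"
proof -
  have "A = (\<Union>t\<in>T. {a\<in>A. f a = t})" using assms(2) by auto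
  then have "card A \<le> (\<Sum>t\<in>T. card {a\<in>A. f a = t})" using card_UN_le[OF assms(1)] by metis
  also have "\<dots> \<le> (\<Sum>t\<in>T. k)" by (rule sum_mono) (use assms(3) in blast)
  finally show ?thesis by simp
qed

lemma sum_card_swap:
  assumes "finite A" "finite B"
  shows "(\<Sum>a\<in>A. card {b\<in>B. R a b}) = (\<Sum>b\<in>B. card {a\<in>A. R a b})"
proof -
  have "(\<Sum>a\<in>A. card {b\<in>B. R a b}) = (\<Sum>a\<in>A. \<Sum>b\<in>B. if R a b then 1 else 0)"
    using card_eq_sum sum.inter_filter[OF assms(2), of "\<lambda>_. 1::nat"] by (intro sum.cong) auto
  also have "\<dots> = (\<Sum>b\<in>B. \<Sum>a\<in>A. if R a b then 1 else 0)" by (rule sum.swap)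
  also have "\<dots> = (\<Sum>b\<in>B. card {a\<in>A. R a b})"
    using card_eq_sum sum.inter_filter[OF assms(1), of "\<lambda>_. 1::nat"] by (intro sum.cong) auto
  finally show ?thesis .
qed

lemma odd_card_Int_3:
  assumes "distinct [e1, e2, e3]"
  shows "odd (card (B \<inter> {e1, e2, e3})) = ((e1 \<in> B) \<noteq> ((e2 \<in> B) \<noteq> (e3 \<in> B)))"
  using assms by (cases "e1 \<in> B"; cases "e2 \<in> B"; cases "e3 \<in> B") (auto simp: Int_insert_right)

context surface_triangulation begin

text \<open>Double counting of sides: three for each face, and at most two faces for each
  edge.\<close>

lemma sum_corner_edges: "3 * card Fs \<le> 2 * card E"
proof -
  have "3 * card Fs = (\<Sum>F\<in>Fs. card {e\<in>E. e \<subseteq> corners F})"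
  proof -
    have "card {e\<in>E. e \<subseteq> corners F} = 3" if F: "F \<in> Fs" for F
    proof -
      have "{e\<in>E. e \<subseteq> corners F} = {e. e \<subseteq> corners F \<and> card e = 2}" using edge corners_edge[OF F] by auto
      moreover have "finite (corners F)" using card_corners[OF F] by (simp add: card_ge_0_finite)
      ultimately show ?thesis using n_subsets[of "corners F" 2] card_corners[OF F] by (simp add: choose_two)
    qed
    then show ?thesis by simp
  qed
  also have "\<dots> = (\<Sum>e\<in>E. card (edge_faces e))" unfolding edge_faces_def by (rule sum_card_swap[OF finFs finE])
  also have "\<dots> \<le> (\<Sum>e\<in>E. 2)" by (rule sum_mono) (rule edge_faces_card(2))
  finally show ?thesis by simp
qed

lemma sum_degrees: "(\<Sum>v\<in>V. vertex_degree E v) = 2 * card E"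
proof -
  have "(\<Sum>v\<in>V. vertex_degree E v) = (\<Sum>e\<in>E. card {v\<in>V. v \<in> e})"
    unfolding vertex_degree_def by (rule sum_card_swap[OF finV finE])
  also have "\<dots> = (\<Sum>e\<in>E. 2)"
  proof (rule sum.cong)
    fix e assume "e \<in> E"
    then have "{v\<in>V. v \<in> e} = e" "card e = 2" using edge by auto
    then show "card {v\<in>V. v \<in> e} = 2" by simp
  qed simp
  finally show ?thesis by simp
qed

lemma vertex_degree_neighbours: "vertex_degree E v = card {u. {v, u} \<in> E}"
proof -
  have "{e\<in>E. v \<in> e} = (\<lambda>u. {v, u}) ` {u. {v, u} \<in> E}"
  proof
    show "{e\<in>E. v \<in> e} \<subseteq> (\<lambda>u. {v, u}) ` {u. {v, u} \<in> E}"
    proof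
      fix e assume e: "e \<in> {e\<in>E. v \<in> e}"
      then obtain a b where "e = {a, b}" using edge[of e] by (auto simp: card_2_iff)
      then have "\<exists>u. e = {v, u}" using e by auto
      then show "e \<in> (\<lambda>u. {v, u}) ` {u. {v, u} \<in> E}" using e by auto
    qed
  qed auto
  moreover have "inj_on (\<lambda>u. {v, u}) {u. {v, u} \<in> E}"
    by (rule inj_onI) (metis doubleton_eq_iff)
  ultimately show ?thesis unfolding vertex_degree_def by (simp add: card_image)
qed

text \<open>The difference \<open>w\<close> of the cocycles has the potentials \<open>r i\<close> on
  the charts. Equal transition data make them agree at the marked points, hence on the overlaps of
  the unit squares, so they form a global potential and \<open>w\<close> is a coboundary.\<close>

lemma same_signature_coboundary:
  assumes fin: "finite I" and q: "\<And>i. i \<in> I \<Longrightarrow> is_chart S (q i)" and cov: "topspace S \<subseteq> (\<Union>i\<in>I. q i ` osq 1)"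
    and A: "\<And>i j y. i \<in> I \<Longrightarrow> j \<in> I \<Longrightarrow> y \<in> q i ` csq 1 \<inter> q j ` csq 1 \<Longrightarrow>
       \<exists>x\<in>A i j. \<exists>C. connectedin S C \<and> x \<in> C \<and> y \<in> C \<and> C \<subseteq> q i ` csq 2 \<inter> q j ` csq 2"
    and z: "cocycle z" and z': "cocycle z'"
    and s: "\<And>i. i \<in> I \<Longrightarrow> pot z (q i ` csq 2) (s i)" and s': "\<And>i. i \<in> I \<Longrightarrow> pot z' (q i ` csq 2) (s' i)"
    and sig: "\<And>i j x. i \<in> I \<Longrightarrow> j \<in> I \<Longrightarrow> x \<in> A i j \<Longrightarrow> (s i x \<noteq> s j x) = (s' i x \<noteq> s' j x)"
  shows "\<exists>f :: 'a \<Rightarrow> bool. \<forall>u v. {u, v} \<in> E \<longrightarrow> (z u v \<noteq> z' u v) = (f u \<noteq> f v)"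
proof -
  define w where "w = (\<lambda>a b. z a b \<noteq> z' a b)"
  define r where "r = (\<lambda>i p. s i p \<noteq> s' i p)"
  have w: "cocycle w"
  proof -
    have "(w a b \<noteq> w b c) = w a c" if "F \<in> Fs" "a \<in> corners F" "b \<in> corners F" "c \<in> corners F" for F a b c
    proof -
      have "(z a b \<noteq> z b c) = z a c" "(z' a b \<noteq> z' b c) = z' a c" using z z' that unfolding cocycle_def by blast+
      then show ?thesis unfolding w_def by blast
    qed
    moreover have "w a b = w b a" "\<not> w a a" for a b using z z' unfolding w_def cocycle_def by blast+
    ultimately show ?thesis unfolding cocycle_def by blast
  qed
  have r: "pot w (q i ` csq 2) (r i)" if i: "i \<in> I" for i
    unfolding pot_def
  proof
    fix x assume x: "x \<in> q i ` csq 2"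
    obtain N where N: "openin S N" "x \<in> N" "\<forall>p\<in>N \<inter> q i ` csq 2. (s i p \<noteq> s i x) = z (rep p) (rep x)"
      using s[OF i] x unfolding pot_def by blast
    obtain N' where N': "openin S N'" "x \<in> N'" "\<forall>p\<in>N' \<inter> q i ` csq 2. (s' i p \<noteq> s' i x) = z' (rep p) (rep x)"
      using s'[OF i] x unfolding pot_def by blast
    have "(r i p \<noteq> r i x) = w (rep p) (rep x)" if "p \<in> N \<inter> N' \<inter> q i ` csq 2" for p
    proof -
      have "(s i p \<noteq> s i x) = z (rep p) (rep x)" "(s' i p \<noteq> s' i x) = z' (rep p) (rep x)" using that N(3) N'(3) by blast+
      then show ?thesis unfolding r_def w_def by blast
    qed
    then show "\<exists>N. openin S N \<and> x \<in> N \<and> (\<forall>p\<in>N \<inter> q i ` csq 2. (r i p \<noteq> r i x) = w (rep p) (rep x))"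
      using N(1,2) N'(1,2) by (intro exI[of _ "N \<inter> N'"]) auto
  qed
  have agree: "r i y = r j y" if i: "i \<in> I" and j: "j \<in> I" and y: "y \<in> q i ` csq 1 \<inter> q j ` csq 1" for i j y
  proof -
    obtain x C where x: "x \<in> A i j" and C: "connectedin S C" "x \<in> C" "y \<in> C" "C \<subseteq> q i ` csq 2 \<inter> q j ` csq 2"
      using A[OF i j y] by blast
    have "(r i x \<noteq> r j x) = (r i y \<noteq> r j y)"
      by (rule pot_difference_constant[OF pot_subset[OF r[OF i]] pot_subset[OF r[OF j]] C(1) order_refl C(2,3)])
        (use C(4) in auto)
    moreover have "r i x = r j x" using sig[OF i j x] unfolding r_def by blast
    ultimately show ?thesis by blast
  qed
  have "\<forall>p\<in>topspace S. \<exists>i\<in>I. p \<in> q i ` osq 1" using cov by blast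
  then obtain idx where idx: "\<And>p. p \<in> topspace S \<Longrightarrow> idx p \<in> I \<and> p \<in> q (idx p) ` osq 1" by metis
  define f where "f = (\<lambda>p. r (idx p) p)"
  have "pot w (topspace S) f"
    unfolding pot_def
  proof
    fix x assume x: "x \<in> topspace S"
    define i where "i = idx x"
    have i: "i \<in> I" "x \<in> q i ` osq 1" using idx[OF x] by (simp_all add: i_def)
    have sub: "q i ` osq 1 \<subseteq> q i ` csq 1" "q i ` osq 1 \<subseteq> q i ` csq 2"
      using osq_csq[of 1] csq_mono[of 1 2] by auto
    obtain N where N: "openin S N" "x \<in> N" "\<forall>p\<in>N \<inter> q i ` csq 2. (r i p \<noteq> r i x) = w (rep p) (rep x)"
      using bspec[OF r[OF i(1), unfolded pot_def] subsetD[OF sub(2) i(2)]] by blast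
    have op: "openin S (q i ` osq 1)" by (rule chart_open[OF surf q[OF i(1)]]) simp
    have "(f p \<noteq> f x) = w (rep p) (rep x)" if p: "p \<in> (N \<inter> q i ` osq 1) \<inter> topspace S" for p
    proof -
      have "p \<in> q (idx p) ` csq 1" "idx p \<in> I" using idx[of p] p osq_csq[of 1] by blast+
      then have "f p = r i p" unfolding f_def using agree[OF _ i(1), of "idx p" p] p sub by blast
      moreover have "f x = r i x" by (simp add: f_def i_def)
      moreover have "(r i p \<noteq> r i x) = w (rep p) (rep x)" using N(3) p sub(2) by blast
      ultimately show ?thesis by simp
    qed
    then show "\<exists>N. openin S N \<and> x \<in> N \<and> (\<forall>p\<in>N \<inter> topspace S. (f p \<noteq> f x) = w (rep p) (rep x))"
      using openin_Int[OF N(1) op] N(2) i(2) by (intro exI[of _ "N \<inter> q i ` osq 1"]) simp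
  qed
  from global_pot_coboundary[OF w this] show ?thesis unfolding w_def by (intro exI[of _ f]) simp
qed

text \<open>Counting cocycles modulo 2 with and without the topology: the cocycles among the sets of edges have
  codimension at most the number of faces, while by the previous lemma they are determined up to
  coboundaries by their transition data on a fixed finite atlas.\<close>

lemma edge_count:
  assumes fin: "finite I" and q: "\<And>i. i \<in> I \<Longrightarrow> is_chart S (q i)" and cov: "topspace S \<subseteq> (\<Union>i\<in>I. q i ` osq 1)"
    and finA: "\<And>i j. i \<in> I \<Longrightarrow> j \<in> I \<Longrightarrow> finite (A i j)"
    and A: "\<And>i j y. i \<in> I \<Longrightarrow> j \<in> I \<Longrightarrow> y \<in> q i ` csq 1 \<inter> q j ` csq 1 \<Longrightarrow>
       \<exists>x\<in>A i j. \<exists>C. connectedin S C \<and> x \<in> C \<and> y \<in> C \<and> C \<subseteq> q i ` csq 2 \<inter> q j ` csq 2"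
  shows "card E \<le> card Fs + card (SIGMA i:I. SIGMA j:I. A i j) + card V"
proof -
  define J where "J = (SIGMA i:I. SIGMA j:I. A i j)"
  have finJ: "finite J" unfolding J_def using fin finA by (intro finite_SigmaI) auto
  define chi where "chi = (\<lambda>B a b. {a, b} \<in> (B :: 'a set set))"
  define sd where "sd = (\<lambda>B B' :: 'a set set. (B - B') \<union> (B' - B))"
  \<comment> \<open>The coboundary modulo 2 of an edge set. The symmetric difference of two edge
    sets with the same \<open>Phi\<close> is a cocycle.\<close>
  define Phi where "Phi = (\<lambda>B. {F\<in>Fs. odd (card {e\<in>B. e \<subseteq> corners F})})"
  define st where "st = (\<lambda>z i. SOME s. pot z (q i ` csq 2) s)"
  define sig where "sig = (\<lambda>z. {(i, j, x). (i, j, x) \<in> J \<and> st z i x \<noteq> st z j x})"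
  have st: "pot z (q i ` csq 2) (st z i)" if "cocycle z" "i \<in> I" for z i
    unfolding st_def using someI_ex[OF pot_chart[OF that(1) q[OF that(2)]]] .
  have coc: "cocycle (chi (sd B B'))" if B: "B \<subseteq> E" "B' \<subseteq> E" "Phi B = Phi B'" for B B'
  proof -
    have "(chi (sd B B') a b \<noteq> chi (sd B B') b c) = chi (sd B B') a c"
      if F: "F \<in> Fs" and abc: "a \<in> corners F" "b \<in> corners F" "c \<in> corners F" for F a b c
    proof (cases "a = b \<or> b = c \<or> a = c")
      case True
      have "{x} \<notin> B \<union> B'" for x using B(1,2) edge by force
      then show ?thesis using True unfolding chi_def sd_def by (auto simp: insert_commute)
    next
      case False
      then have ne: "a \<noteq> b" "b \<noteq> c" "a \<noteq> c" by auto
      have "finite (corners F)" using card_corners[OF F] by (simp add: card_ge_0_finite)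
      then have cF: "corners F = {a, b, c}" using abc ne card_corners[OF F] by (intro sym[OF card_subset_eq]) auto
      have par: "odd (card {e\<in>X. e \<subseteq> corners F}) = (({a, b} \<in> X) \<noteq> (({b, c} \<in> X) \<noteq> ({a, c} \<in> X)))" if X: "X \<subseteq> E" for X
      proof -
        have "{e\<in>X. e \<subseteq> corners F} = X \<inter> {e. e \<subseteq> {a, b, c} \<and> card e = 2}" using X edge unfolding cF by auto
        also have "\<dots> = X \<inter> {{a, b}, {b, c}, {a, c}}" unfolding pairs_of_triple[OF ne] by simp
        finally show ?thesis using odd_card_Int_3[of "{a, b}" "{b, c}" "{a, c}" X] ne by (simp add: doubleton_eq_iff)
      qed
      have "odd (card {e\<in>B. e \<subseteq> corners F}) = odd (card {e\<in>B'. e \<subseteq> corners F})"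
        using B(3) F unfolding Phi_def by blast
      then show ?thesis unfolding par[OF B(1)] par[OF B(2)] chi_def sd_def by blast
    qed
    moreover have "\<not> chi (sd B B') a a" for a using B(1,2) edge unfolding chi_def sd_def by force
    moreover have "chi (sd B B') a b = chi (sd B B') b a" for a b by (simp add: chi_def insert_commute)
    ultimately show ?thesis unfolding cocycle_def by blast
  qed
  have sig_same: "\<exists>f :: 'a \<Rightarrow> bool. \<forall>u v. {u, v} \<in> E \<longrightarrow> (chi X u v \<noteq> chi Y u v) = (f u \<noteq> f v)"
    if X: "cocycle (chi X)" and Y: "cocycle (chi Y)" and eq: "sig (chi X) = sig (chi Y)" for X Y
  proof -
    have s: "(st (chi X) i x \<noteq> st (chi X) j x) = (st (chi Y) i x \<noteq> st (chi Y) j x)"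
      if "i \<in> I" "j \<in> I" "x \<in> A i j" for i j x
    proof -
      have "(i, j, x) \<in> J" using that by (simp add: J_def)
      then show ?thesis using eq unfolding sig_def by blast
    qed
    show ?thesis
      by (rule same_signature_coboundary[of I q A "chi X" "chi Y" "st (chi X)" "st (chi Y)"])
        (rule fin q cov A X Y st[OF X] st[OF Y] s; assumption)+
  qed
  have fE: "finite (Pow E)" using finE by simp
  \<comment> \<open>Three nested fibrations: \<open>Phi B\<close> is a set of faces, the transition
    data relative to a fixed \<open>B0\<close> form a subset of \<open>J\<close>, and what remains
    is a coboundary, given by a set of vertices. The bound is the logarithm to base 2.\<close>
  have "card (Pow E) \<le> card (Pow Fs) * (card (Pow J) * card (Pow V))"
  proof (rule card_le_fibres[of _ Phi])
    show "finite (Pow Fs)" using finFs by simp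
    show "Phi ` Pow E \<subseteq> Pow Fs" by (auto simp: Phi_def)
    fix T assume "T \<in> Pow Fs"
    define Y where "Y = {B\<in>Pow E. Phi B = T}"
    have finY: "finite Y" unfolding Y_def using fE by simp
    have "card Y \<le> card (Pow J) * card (Pow V)"
    proof (cases "Y = {}")
      case True then show ?thesis by simp
    next
      case False
      then obtain B0 where B0: "B0 \<in> Y" by blast
      show ?thesis
      proof (rule card_le_fibres[of _ "\<lambda>B. sig (chi (sd B B0))"])
        show "finite (Pow J)" using finJ by simp
        show "(\<lambda>B. sig (chi (sd B B0))) ` Y \<subseteq> Pow J" by (auto simp: sig_def)
        fix \<sigma>
        define Y' where "Y' = {B\<in>Y. sig (chi (sd B B0)) = \<sigma>}"
        have "card Y' \<le> card (Pow V)"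
        proof (cases "Y' = {}")
          case True then show ?thesis by simp
        next
          case False
          then obtain B1 where B1: "B1 \<in> Y'" by blast
          \<comment> \<open>\<open>G U\<close> is \<open>B1\<close> changed on the cut between
            \<open>U\<close> and its complement.\<close>
          define G where "G = (\<lambda>U. {e\<in>E. (e \<in> B1) \<noteq> (\<exists>u\<in>U. \<exists>v\<in>V - U. e = {u, v})})"
          have "Y' \<subseteq> G ` Pow V"
          proof
            fix B assume B: "B \<in> Y'"
            have c: "cocycle (chi (sd B B0))" "cocycle (chi (sd B1 B0))"
              using B B1 B0 by (auto simp: Y'_def Y_def intro!: coc)
            have "sig (chi (sd B B0)) = sig (chi (sd B1 B0))" using B B1 by (simp add: Y'_def)
            then obtain f :: "'a \<Rightarrow> bool" where f: "\<And>u v. {u, v} \<in> E \<Longrightarrow> (chi (sd B B0) u v \<noteq> chi (sd B1 B0) u v) = (f u \<noteq> f v)"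
              using sig_same[OF c] by blast
            have f': "(({u, v} \<in> B) \<noteq> ({u, v} \<in> B1)) = (f u \<noteq> f v)" if "{u, v} \<in> E" for u v
              using f[OF that] unfolding chi_def sd_def by blast
            define U where "U = {v\<in>V. f v}"
            have "B = G U"
            proof (rule set_eqI)
              fix e
              have BE: "B \<subseteq> E" using B by (auto simp: Y'_def Y_def)
              show "e \<in> B \<longleftrightarrow> e \<in> G U"
              proof (cases "e \<in> E")
                case False then show ?thesis using BE by (auto simp: G_def)
              next
                case True
                then obtain u v where uv: "e = {u, v}" "u \<in> V" "v \<in> V" using edge[OF True] by (auto simp: card_2_iff)
                have "(\<exists>a\<in>U. \<exists>b\<in>V - U. e = {a, b}) = (f u \<noteq> f v)"
                  using uv unfolding U_def by (auto simp: doubleton_eq_iff)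
                moreover have "((e \<in> B) \<noteq> (e \<in> B1)) = (f u \<noteq> f v)" using f'[of u v] True by (simp only: uv(1))
                moreover have "e \<in> G U \<longleftrightarrow> (e \<in> B1) \<noteq> (\<exists>a\<in>U. \<exists>b\<in>V - U. e = {a, b})" using True by (simp only: G_def mem_Collect_eq simp_thms)
                ultimately show ?thesis by argo
              qed
            qed
            moreover have "U \<in> Pow V" by (auto simp: U_def)
            ultimately show "B \<in> G ` Pow V" by blast
          qed
          then show ?thesis using finV by (intro surj_card_le) auto
        qed
        moreover have "finite Y'" unfolding Y'_def using finY by simp
        ultimately show "finite {B\<in>Y. sig (chi (sd B B0)) = \<sigma>} \<and> card {B\<in>Y. sig (chi (sd B B0)) = \<sigma>} \<le> card (Pow V)"
          unfolding Y'_def by blast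
      qed
    qed
    then show "finite {B\<in>Pow E. Phi B = T} \<and> card {B\<in>Pow E. Phi B = T} \<le> card (Pow J) * card (Pow V)"
      using finY unfolding Y_def by blast
  qed
  then have "(2::nat) ^ card E \<le> 2 ^ (card Fs + card J + card V)"
    using finE finFs finJ finV by (simp add: card_Pow power_add mult.assoc)
  then show ?thesis unfolding J_def by (rule power_le_imp_le_exp[rotated]) simp
qed

end

text \<open>\<open>edge_count\<close> bounds the Euler characteristic below by the negative of the
  number \<open>J\<close> of marked triples, which depends on the atlas alone. With 3 F <= 2 E for
  the number \<open>F\<close> of faces this turns into a linear bound on the number of
  edges.\<close>

theorem surface_edge_bound:
  fixes S :: "'a topology"
  assumes S: "surface S"
  obtains J :: nat where "\<And>V E \<alpha>. triangulation_on S V E \<alpha> \<Longrightarrow> card E \<le> 3 * (J + card V)"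
proof -
  obtain I :: "'a set" and q :: "'a \<Rightarrow> real \<times> real \<Rightarrow> 'a" and A :: "'a \<Rightarrow> 'a \<Rightarrow> 'a set"
    where at: "finite I" "\<And>i. i \<in> I \<Longrightarrow> is_chart S (q i)" "topspace S \<subseteq> (\<Union>i\<in>I. q i ` osq 1)"
      "\<And>i j. i \<in> I \<Longrightarrow> j \<in> I \<Longrightarrow> finite (A i j)"
      "\<And>i j y. i \<in> I \<Longrightarrow> j \<in> I \<Longrightarrow> y \<in> q i ` csq 1 \<inter> q j ` csq 1 \<Longrightarrow>
         \<exists>x\<in>A i j. \<exists>C. connectedin S C \<and> x \<in> C \<and> y \<in> C \<and> C \<subseteq> q i ` csq 2 \<inter> q j ` csq 2"
    by (rule finite_atlas[OF S]) (rule that)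
  show ?thesis
  proof (rule that)
    fix V E \<alpha> assume t: "triangulation_on S V E \<alpha>"
    interpret surface_triangulation S V E \<alpha> by unfold_locales (rule S t)+
    define J where "J = card (SIGMA i:I. SIGMA j:I. A i j)"
    have "card E \<le> 3 * (J + card V)"
    proof -
      have "card E \<le> card Fs + card (SIGMA i:I. SIGMA j:I. A i j) + card V"
        by (rule edge_count[of I q A]) (rule at; assumption)+
      then show ?thesis using sum_corner_edges unfolding J_def[symmetric] by simp
    qed
    then show "card E \<le> 3 * (card (SIGMA i:I. SIGMA j:I. A i j) + card V)" by (simp only: J_def)
  qed
qed

section \<open>Links of vertices of degree 6\<close>

text \<open>A connected graph with all degrees 2 is a cycle. If the walk a0, a1, ... closed too
  early, at most five vertices would already form a component.\<close>

lemma six_cycle: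
  fixes N :: "'a set" and lk :: "'a \<Rightarrow> 'a \<Rightarrow> bool"
  assumes N: "card N = 6" and sym: "\<And>x y. lk x y \<Longrightarrow> lk y x" and irr: "\<And>x. \<not> lk x x" and lkN: "\<And>x y. lk x y \<Longrightarrow> y \<in> N"
    and two: "\<And>x. x \<in> N \<Longrightarrow> \<exists>y z. y \<noteq> z \<and> (\<forall>w. lk x w \<longleftrightarrow> w = y \<or> w = z)"
    and conn: "\<And>A. A \<subseteq> N \<Longrightarrow> A \<noteq> {} \<Longrightarrow> (\<And>x y. x \<in> A \<Longrightarrow> lk x y \<Longrightarrow> y \<in> A) \<Longrightarrow> A = N"
  obtains f :: "int \<Rightarrow> 'a" where "\<And>d. f (d + 6) = f d" "\<And>d d'. f d = f d' \<Longrightarrow> (d - d') mod 6 = 0"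
    "\<And>u. u \<in> N \<longleftrightarrow> (\<exists>d. u = f d)" "\<And>d x. lk (f d) x \<longleftrightarrow> x = f (d + 1) \<or> x = f (d - 1)"
proof -
  have other: "\<exists>z. z \<noteq> y \<and> (\<forall>w. lk x w \<longleftrightarrow> w = y \<or> w = z)" if l: "lk x y" for x y
  proof -
    obtain a b where "a \<noteq> b" "\<forall>w. lk x w \<longleftrightarrow> w = a \<or> w = b" using two[OF lkN[OF sym[OF l]]] by blast
    then show ?thesis using l by metis
  qed
  have "N \<noteq> {}" using N by auto
  then obtain a0 where a0: "a0 \<in> N" by blast
  then obtain a1 where l0: "lk a0 a1" using two by blast
  obtain b where b: "b \<noteq> a1" "\<And>w. lk a0 w \<longleftrightarrow> w = a1 \<or> w = b" using other[OF l0] by blast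
  obtain a2 where a2: "a2 \<noteq> a0" "\<And>w. lk a1 w \<longleftrightarrow> w = a0 \<or> w = a2" using other[OF sym[OF l0]] by blast
  have l1: "lk a1 a2" using a2 by blast
  obtain a3 where a3: "a3 \<noteq> a1" "\<And>w. lk a2 w \<longleftrightarrow> w = a1 \<or> w = a3" using other[OF sym[OF l1]] by blast
  have l2: "lk a2 a3" using a3 by blast
  obtain a4 where a4: "a4 \<noteq> a2" "\<And>w. lk a3 w \<longleftrightarrow> w = a2 \<or> w = a4" using other[OF sym[OF l2]] by blast
  have l3: "lk a3 a4" using a4 by blast
  obtain a5 where a5: "a5 \<noteq> a3" "\<And>w. lk a4 w \<longleftrightarrow> w = a3 \<or> w = a5" using other[OF sym[OF l3]] by blast
  have l4: "lk a4 a5" using a5 by blast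
  have inN: "a1 \<in> N" "a2 \<in> N" "a3 \<in> N" "a4 \<in> N" "a5 \<in> N" "b \<in> N" using l0 l1 l2 l3 l4 lkN b by blast+
  have ne: "a0 \<noteq> a1" "a1 \<noteq> a2" "a2 \<noteq> a3" "a3 \<noteq> a4" "a4 \<noteq> a5" using l0 l1 l2 l3 l4 irr by blast+
  have small: False if xs: "set xs \<subseteq> N" "a0 \<in> set xs" "\<And>x y. x \<in> set xs \<Longrightarrow> lk x y \<Longrightarrow> y \<in> set xs" "length xs \<le> 5" for xs
  proof -
    have "set xs \<noteq> {}" using xs(2) by auto
    then have "set xs = N" using xs(1,3) by (intro conn)
    then show False using card_length[of xs] xs(4) N by simp
  qed
  have 30: "a3 \<noteq> a0"
  proof
    assume e: "a3 = a0"
    then have "b = a2" using sym[OF l2] b(2)[of a2] ne by auto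
    show False
      by (rule small[of "[a0, a1, a2]"]) (use a0 inN b(2) a2(2) a3(2) e \<open>b = a2\<close> in auto)
  qed
  have 40: "a4 \<noteq> a0"
  proof
    assume e: "a4 = a0"
    then have "b = a3" using sym[OF l3] b(2)[of a3] a3(1) by auto
    show False
      by (rule small[of "[a0, a1, a2, a3]"]) (use a0 inN b(2) a2(2) a3(2) a4(2) e \<open>b = a3\<close> in auto)
  qed
  have 41: "a4 \<noteq> a1" using sym[OF l3] a2(2)[of a3] 30 ne by auto
  have 50: "a5 \<noteq> a0"
  proof
    assume e: "a5 = a0"
    then have "b = a4" using sym[OF l4] b(2)[of a4] 41 by auto
    show False
      by (rule small[of "[a0, a1, a2, a3, a4]"]) (use a0 inN b(2) a2(2) a3(2) a4(2) a5(2) e \<open>b = a4\<close> in auto)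
  qed
  have 51: "a5 \<noteq> a1" using sym[OF l4] a2(2)[of a4] 40 a4(1) by auto
  have 52: "a5 \<noteq> a2" using sym[OF l4] a3(2)[of a4] 41 ne by auto
  have dist: "distinct [a0, a1, a2, a3, a4, a5]" using ne a2(1) a3(1) a4(1) a5(1) 30 40 41 50 51 52 by auto
  have finN: "finite N" using N by (simp add: card_ge_0_finite)
  have Neq: "N = {a0, a1, a2, a3, a4, a5}"
    using card_subset_eq[OF finN, of "{a0, a1, a2, a3, a4, a5}"] a0 inN dist N by simp
  have "b = a5"
  proof -
    have l: "lk b a0" using b(2) sym by blast
    have "b \<noteq> a0" using l irr by blast
    moreover have "b \<noteq> a2" "b \<noteq> a3" "b \<noteq> a4" using l a3(2)[of a0] a4(2)[of a0] a5(2)[of a0] dist by auto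
    ultimately show ?thesis using inN(6) b(1) unfolding Neq by blast
  qed
  then have nb0: "\<And>w. lk a0 w \<longleftrightarrow> w = a1 \<or> w = a5" using b by blast
  have nb5: "\<And>w. lk a5 w \<longleftrightarrow> w = a4 \<or> w = a0"
  proof -
    obtain c where c: "c \<noteq> a4" "\<And>w. lk a5 w \<longleftrightarrow> w = a4 \<or> w = c" using other[OF sym[OF l4]] by blast
    have "lk a5 a0" using nb0 sym by blast
    then have "c = a0" using c 40 by auto
    then show "\<And>w. lk a5 w \<longleftrightarrow> w = a4 \<or> w = a0" using c by blast
  qed
  define f :: "int \<Rightarrow> 'a" where "f = (\<lambda>d. if d mod 6 = 0 then a0 else if d mod 6 = 1 then a1 else if d mod 6 = 2 then a2
     else if d mod 6 = 3 then a3 else if d mod 6 = 4 then a4 else a5)"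
  show ?thesis
  proof (rule that[of f])
    show "f (d + 6) = f d" for d by (simp add: f_def)
    show "(d - d') mod 6 = 0" if "f d = f d'" for d d'
    proof -
      have "d mod 6 = d' mod 6"
        using that dist by (cases d rule: mod6_cases; cases d' rule: mod6_cases) (simp_all add: f_def)
      then show ?thesis by (simp add: mod_eq_dvd_iff)
    qed
    have f: "f 0 = a0" "f 1 = a1" "f 2 = a2" "f 3 = a3" "f 4 = a4" "f 5 = a5" by (simp_all add: f_def)
    show "u \<in> N \<longleftrightarrow> (\<exists>d. u = f d)" for u
    proof
      assume "u \<in> N" then show "\<exists>d. u = f d" unfolding Neq using f by (metis empty_iff insert_iff)
    next
      assume "\<exists>d. u = f d" then show "u \<in> N" unfolding Neq f_def by auto
    qed
    show "lk (f d) x \<longleftrightarrow> x = f (d + 1) \<or> x = f (d - 1)" for d x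
    proof -
      have "(d + 1) mod 6 = (d mod 6 + 1) mod 6" "(d - 1) mod 6 = (d mod 6 - 1) mod 6"
        by (simp_all add: mod_simps)
      then show ?thesis
        by (cases d rule: mod6_cases) (auto simp: f_def nb0 nb5 a2(2) a3(2) a4(2) a5(2))
    qed
  qed
qed

context surface_triangulation begin

text \<open>The link has the neighbours of \<open>v\<close> as vertices and the faces at
  \<open>v\<close> as edges. Its degrees are 2 because an edge lies on two faces, and it is
  connected by \<open>link_connected\<close>.\<close>

lemma degree_6_frame:
  assumes v: "v \<in> V" "vertex_degree E v = 6"
  shows "\<exists>f. hexframe (\<lambda>a b. {a, b} \<in> E) (\<lambda>a b c. \<exists>F\<in>Fs. corners F = {a, b, c}) v f"
proof -
  define N where "N = {u. {v, u} \<in> E}"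
  define lk where "lk = (\<lambda>u w. \<exists>F\<in>Fs. corners F = {v, u, w})"
  have N6: "card N = 6" using v vertex_degree_neighbours by (simp add: N_def)
  have vN: "v \<notin> N" using edge[of "{v, v}"] by (auto simp: N_def)
  have lk_ne: "v \<noteq> u \<and> u \<noteq> w \<and> v \<noteq> w" if "F \<in> Fs" "corners F = {v, u, w}" for F u w
  proof -
    have "card {v, u, w} = 3" using card_corners[OF that(1)] that(2) by simp
    then show ?thesis by (auto simp: card_insert_if split: if_splits)
  qed
  have lk_N: "u \<in> N" if l: "lk u w" for u w
  proof -
    obtain F where F: "F \<in> Fs" "corners F = {v, u, w}" using l by (auto simp: lk_def)
    then have "{v, u} \<in> E" using lk_ne[OF F] corners_edge[OF F(1), of "{v, u}"] by auto
    then show ?thesis by (simp add: N_def)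
  qed
  have lk_sym: "lk w u" if "lk u w" for u w using that unfolding lk_def by (simp add: insert_commute)
  have lk_irr: "\<not> lk u u" for u using lk_ne unfolding lk_def by blast
  have third: "\<exists>w. corners F = {v, u, w}" if F: "F \<in> Fs" "v \<in> corners F" "u \<in> corners F" "u \<noteq> v" for F u
  proof -
    have "card (corners F - {v, u}) = 1"
      using card_corners[OF F(1)] F by (subst card_Diff_subset) auto
    then obtain w where "corners F - {v, u} = {w}" by (auto simp: card_1_singleton_iff)
    then show ?thesis using F by (intro exI[of _ w]) auto
  qed
  have link: "A = N" if A: "A \<subseteq> N" "A \<noteq> {}" "\<And>x y. x \<in> A \<Longrightarrow> lk x y \<Longrightarrow> y \<in> A" for A
    unfolding N_def
  proof (rule link_connected[OF v(1) _ A(2)])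
    show "A \<subseteq> {u. {v, u} \<in> E}" using A(1) by (simp add: N_def)
    fix F assume F: "F \<in> Fs" "v \<in> corners F" "corners F \<inter> A \<noteq> {}"
    then obtain y where y: "y \<in> corners F" "y \<in> A" by blast
    then have "y \<noteq> v" using A(1) vN by blast
    then obtain x where x: "corners F = {v, y, x}" using third[OF F(1,2) y(1)] by blast
    then have "lk y x" using F(1) by (auto simp: lk_def)
    then show "corners F - {v} \<subseteq> A" using A(3)[OF y(2)] y(2) x by blast
  qed
  have two: "\<exists>y z. y \<noteq> z \<and> (\<forall>w. lk u w \<longleftrightarrow> w = y \<or> w = z)" if u: "u \<in> N" for u
  proof -
    have uE: "{v, u} \<in> E" and uv: "u \<noteq> v" using u vN by (auto simp: N_def)
    obtain F1 F2 where F: "F1 \<noteq> F2" "edge_faces {v, u} = {F1, F2}" by (rule edge_two_faces[OF uE])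
    then have F12: "F1 \<in> Fs" "F2 \<in> Fs" "{v, u} \<subseteq> corners F1" "{v, u} \<subseteq> corners F2" by (auto simp: edge_faces_def)
    obtain w1 where w1: "corners F1 = {v, u, w1}" using third[OF F12(1)] F12 uv by blast
    obtain w2 where w2: "corners F2 = {v, u, w2}" using third[OF F12(2)] F12 uv by blast
    have lk: "lk u x \<longleftrightarrow> x = w1 \<or> x = w2" for x
    proof
      assume "lk u x"
      then obtain F where G: "F \<in> Fs" "corners F = {v, u, x}" by (auto simp: lk_def)
      then have "F \<in> edge_faces {v, u}" by (auto simp: edge_faces_def)
      then have "corners F = {v, u, w1} \<or> corners F = {v, u, w2}" using F(2) w1 w2 by auto
      then show "x = w1 \<or> x = w2" using G lk_ne[OF G] by auto
    next
      assume "x = w1 \<or> x = w2" then show "lk u x" using F12 w1 w2 by (auto simp: lk_def)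
    qed
    \<comment> \<open>If both faces had the same corners, \<open>u\<close> and \<open>w1\<close>
      would form a component of the link, which has six vertices.\<close>
    have "w1 \<noteq> w2"
    proof
      assume eq: "w1 = w2"
      have w1N: "w1 \<in> N" using lk[of w1] lk_sym lk_N by blast
      then have wE: "{v, w1} \<in> E" by (simp add: N_def)
      have Fw: "F1 \<in> edge_faces {v, w1}" "F2 \<in> edge_faces {v, w1}" using F12 w1 w2 eq by (auto simp: edge_faces_def)
      have "{u, w1} = N"
      proof (rule link)
        show "{u, w1} \<subseteq> N" using u w1N by simp
        fix x y assume x: "x \<in> {u, w1}" and "lk x y"
        then obtain F where G: "F \<in> Fs" "corners F = {v, x, y}" by (auto simp: lk_def)
        have "F = F1 \<or> F = F2"
        proof (cases "x = u")
          case True then show ?thesis using G F(2) by (auto simp: edge_faces_def)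
        next
          case False
          then have "F \<in> edge_faces {v, w1}" using x G by (auto simp: edge_faces_def)
          then show ?thesis by (rule edge_faces_le_2[OF wE Fw F(1)])
        qed
        then have "corners F = {v, u, w1}" using w1 w2 eq by auto
        then show "y \<in> {u, w1}" using G lk_ne[OF G] by auto
      qed simp
      moreover have "card {u, w1} \<le> 2" by (simp add: card_insert_if)
      ultimately have "card N \<le> 2" by simp
      then show False using N6 by simp
    qed
    then show ?thesis using lk by blast
  qed
  obtain f :: "int \<Rightarrow> 'a" where f: "\<And>d. f (d + 6) = f d" "\<And>d d'. f d = f d' \<Longrightarrow> (d - d') mod 6 = 0"
    "\<And>u. u \<in> N \<longleftrightarrow> (\<exists>d. u = f d)" "\<And>d x. lk (f d) x \<longleftrightarrow> x = f (d + 1) \<or> x = f (d - 1)"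
    by (rule six_cycle[of N lk]) (rule N6 lk_sym lk_irr lk_N[OF lk_sym] two link that; assumption?)+
  have "hexframe (\<lambda>a b. {a, b} \<in> E) (\<lambda>a b c. \<exists>F\<in>Fs. corners F = {a, b, c}) v f"
    unfolding hexframe_def using f unfolding N_def lk_def by simp
  then show ?thesis by blast
qed

lemma hexmesh:
  "hexmesh V (\<lambda>a b. {a, b} \<in> E) (\<lambda>a b c. \<exists>F\<in>Fs. corners F = {a, b, c}) {v\<in>V. vertex_degree E v = 6}"
proof
  show "finite V" by (rule finV)
  show "u \<in> V \<and> v \<in> V" if "{u, v} \<in> E" for u v using edge[OF that] by simp
  show "{v, u} \<in> E" if "{u, v} \<in> E" for u v using that by (simp add: insert_commute)
  show "{v, v} \<notin> E" for v using edge[of "{v, v}"] by auto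
  show "\<exists>F\<in>Fs. corners F = {b, a, c}" if "\<exists>F\<in>Fs. corners F = {a, b, c}" for a b c
    using that by (simp add: insert_commute)
  show "A = V" if "A \<subseteq> V" "A \<noteq> {}" "\<And>a b. a \<in> A \<Longrightarrow> {a, b} \<in> E \<Longrightarrow> b \<in> A" for A
    by (rule graph_connected[OF that])
qed (use degree_6_frame in auto)

text \<open>All but t + 1 vertices are sure to contribute 6 to the degree sum besides
  \<open>v\<close>, while the sum is at most 6 J + 6 n; what is left bounds the degree of
  \<open>v\<close>.\<close>

lemma degree_bound:
  assumes E: "card E \<le> 3 * (J + card V)" and t: "card {v\<in>V. vertex_degree E v \<noteq> 6} \<le> t" and v: "v \<in> V"
  shows "vertex_degree E v \<le> 6 * J + 6 * t + 6"
proof -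
  define G where "G = {v\<in>V. vertex_degree E v = 6} - {v}"
  have "V \<subseteq> {v\<in>V. vertex_degree E v \<noteq> 6} \<union> G \<union> {v}" by (auto simp: G_def)
  then have "card V \<le> card ({v\<in>V. vertex_degree E v \<noteq> 6} \<union> G \<union> {v})"
    using finV by (intro card_mono) (auto simp: G_def)
  also have "\<dots> \<le> card {v\<in>V. vertex_degree E v \<noteq> 6} + card G + 1"
    by (metis (no_types, lifting) add_le_mono card_Un_le is_singletonI is_singleton_altdef order_refl order_trans)
  finally have G: "card V \<le> t + card G + 1" using t by simp
  have finG: "finite G" "v \<notin> G" using finV by (auto simp: G_def)
  have "(\<Sum>w\<in>G. vertex_degree E w) = (\<Sum>w\<in>G. 6)" by (rule sum.cong) (auto simp: G_def)
  then have "vertex_degree E v + 6 * card G = (\<Sum>w\<in>insert v G. vertex_degree E w)"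
    using finG by simp
  also have "\<dots> \<le> (\<Sum>w\<in>V. vertex_degree E w)" using finV v by (intro sum_mono2) (auto simp: G_def)
  also have "\<dots> = 2 * card E" by (rule sum_degrees)
  finally show ?thesis using E G by simp
qed

end

theorem theorem4:
  fixes S :: "'a topology" and t :: nat and \<epsilon> :: real
  assumes "surface S" and "\<epsilon> > 0"
  shows "\<exists>c :: real. \<forall>V E \<alpha> n.
           triangulation_on S V E \<alpha> \<and> card V = n \<and> card {v \<in> V. vertex_degree E v \<noteq> 6} \<le> t \<longrightarrow>
           (\<exists>D. dominating_set V E D \<and> real (card D) \<le> real n * (1 / 6 + \<epsilon>) + c)"
proof -
  obtain J where J: "\<And>V E \<alpha>. triangulation_on S V E \<alpha> \<Longrightarrow> card E \<le> 3 * (J + card V)"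
    using surface_edge_bound[OF assms(1)] by blast
  \<comment> \<open>The value of \<open>degree_bound\<close>; it is the same for all triangulations,
    so that \<open>c\<close> can be fixed before any of them is given.\<close>
  define \<Delta> where "\<Delta> = 6 * J + 6 * t + 6"
  obtain c :: real where c: "\<forall>(V :: 'a set) adj tri good. hexmesh V adj tri good \<and> card (V - good) \<le> t \<and>
     (\<forall>v\<in>V. card {u. adj v u} \<le> \<Delta>) \<longrightarrow>
     (\<exists>D\<subseteq>V. (\<forall>v\<in>V. v \<in> D \<or> (\<exists>u\<in>D. adj u v)) \<and> real (card D) \<le> real (card V) * (1 / 6 + \<epsilon>) + c)"
    using hexmesh_domination[OF assms(2), of t \<Delta>, where 'a = 'a] by (elim exE) (rule that)
  show ?thesis
  proof (intro exI[of _ c] allI impI, elim conjE)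
    fix V E \<alpha> n
    assume tr: "triangulation_on S V E \<alpha>" and n: "card V = n" and bad: "card {v \<in> V. vertex_degree E v \<noteq> 6} \<le> t"
    interpret surface_triangulation S V E \<alpha> by unfold_locales (rule assms(1) tr)+
    have "V - {v\<in>V. vertex_degree E v = 6} = {v \<in> V. vertex_degree E v \<noteq> 6}" by blast
    then have "card (V - {v\<in>V. vertex_degree E v = 6}) \<le> t" using bad by simp
    moreover have "\<forall>v\<in>V. card {u. {v, u} \<in> E} \<le> \<Delta>"
      using degree_bound[OF J[OF tr] bad] by (simp add: \<Delta>_def vertex_degree_neighbours)
    ultimately obtain D where D: "D \<subseteq> V" "\<forall>v\<in>V. v \<in> D \<or> (\<exists>u\<in>D. {u, v} \<in> E)"
      "real (card D) \<le> real (card V) * (1 / 6 + \<epsilon>) + c"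
      using c[rule_format, OF conjI[OF hexmesh conjI]] by blast
    then show "\<exists>D. dominating_set V E D \<and> real (card D) \<le> real n * (1 / 6 + \<epsilon>) + c"
      using n by (intro exI[of _ D]) (simp add: dominating_set_def)
  qed
qed

end
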